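(* The kernel $G(Z,Z',\xi)$ of the resolvent of the Rayleigh operator with traction-free boundary condition has a (meromorphic) analytic continuation in $\xi$ from the physical sheet to the whole Riemann surface $\mathcal{R}$. Moreover, apart from the branch points of $q_P$ and $q_S$ (the points where $q_P=0$ or $q_S=0$), the poles of the continued resolvent kernel are exactly the zeros on $\mathcal{R}$ of the Rayleigh determinant $\Delta$, that is, the wavenumber resonances.
   Context: Setting. Fix $\omega>0$, $H>0$ and real functions $\lambda,\mu\in C^3((-\infty,0])$ with $\mu\ge\alpha_0>0$, $2\mu+3\lambda\ge\beta_0>0$ for some constants $\alpha_0,\beta_0$, and $\lambda(Z)=\lambda_0$, $\mu(Z)=\mu_0$ (constants) for $Z<-H$. Put $\sigma_0=\lambda_0+2\mu_0$. For $\xi\in\mathbb{C}$ the Rayleigh operator acts on $\psi=(\psi_1,\psi_2)^{T}$, $Z<0$, by $$\mathcal{L}_\xi\psi=(P\psi')'+\xi\,(N\psi'-(N^{T}\psi)')+(\omega^2 I-\xi^2M)\psi,$$ with $P=\begin{pmatrix}\mu&0\\0&\lambda+2\mu\end{pmatrix}$, $M=\begin{pmatrix}\lambda+2\mu&0\\0&\mu\end{pmatrix}$, $N=\begin{pmatrix}0&-\lambda\\ \mu&0\end{pmatrix}$, $'=d/dZ$. Riemann surface. $\mathcal{R}$ is the four-fold cover of $\mathbb{C}$ on which $q_P=\sqrt{\omega^2/\sigma_0-\xi^2}$ and $q_S=\sqrt{\omega^2/\mu_0-\xi^2}$ are single-valued; a point of $\mathcal{R}$ is a triple $(\xi,q_P,q_S)$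 with $q_P^2=\omega^2/\sigma_0-\xi^2$, $q_S^2=\omega^2/\mu_0-\xi^2$, and is denoted simply by $\xi$. The physical sheet is $\{\operatorname{Im}q_P>0,\ \operatorname{Im}q_S>0\}$. Jost solutions. $\psi_P^\pm,\psi_S^\pm$ are the solutions of $\mathcal{L}_\xi\psi=0$ which for $Z\le -H$ equal $$\psi_P^\pm=\begin{pmatrix}-\xi\\ \pm i q_P\end{pmatrix}e^{\pm iZq_P},\qquad \psi_S^\pm=\begin{pmatrix}\pm i q_S\\ -\xi\end{pmatrix}e^{\pm iZq_S}.$$ Boundary tractions: $\hat a(\psi)=i\big(\lambda(0^-)\xi\psi_1(0^-)+(\lambda(0^-)+2\mu(0^-))\psi_2'(0^-)\big)$, $\hat b(\psi)=-\xi\mu(0^-)\psi_2(0^-)+\mu(0^-)\psi_1'(0^-)$. The Rayleigh determinant is $\Delta=\hat a(\psi_P^-)\hat b(\psi_S^-)-\hat a(\psi_S^-)\hat b(\psi_P^-)$, a function on $\mathcal{R}$; its zeros are the wavenumber resonances. Resolvent kernel: for $\xi$ on the physical sheet with $\Delta(\xi)\neq0$, $G(\cdot,Z',\xi)$ is the $2\times2$ matrix function with $\mathcal{L}_\xi G(\cdot,Z',\xi)=\delta(\cdot-Z')I_2$ on $Z<0$, whose columns $\psi$ satisfy $\hat a(\psi)=\hat b(\psi)=0$ and decay as $Z\to-\infty$. A point of $\mathcal{R}$ is called a pole of the resolvent kernel if it is a pole of $\xi\mapsto G(Z,Z',\xi)$ for some $Z,Z'<0$. *)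

theory Defs
  imports "HOL-Complex_Analysis.Complex_Analysis"
begin

text \<open>
  Functions of class $C^k$ on a set of reals. The derivatives are taken within the set, hence they
  are one-sided at an endpoint belonging to it.
\<close>

primrec Ck_on :: "nat \<Rightarrow> (real \<Rightarrow> 'a::real_normed_vector) \<Rightarrow> real set \<Rightarrow> bool" where
  "Ck_on 0 f S \<longleftrightarrow> continuous_on S f"
| "Ck_on (Suc k) f S \<longleftrightarrow>
     (\<exists>f'. (\<forall>x\<in>S. (f has_vector_derivative f' x) (at x within S)) \<and> Ck_on k f' S)"

text \<open>The one-sided value $f(0^-)$.\<close>

definition at_0_minus :: "(real \<Rightarrow> 'a::t2_space) \<Rightarrow> 'a" where
  "at_0_minus f = Lim (at_left 0) f"

definition vderiv :: "(real \<Rightarrow> 'a::real_normed_vector) \<Rightarrow> real \<Rightarrow> 'a" where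
  "vderiv f Z = vector_derivative f (at Z)"

text \<open>
  Points $(\xi, q_P, q_S)$ of the Riemann surface. Outside this context the constants below take as
  arguments those of the parameters that they depend on, in the order of the context declaration.
\<close>

type_synonym point = "complex \<times> complex \<times> complex"

context
  fixes \<omega> H lam0 mu0 :: real and lam mu :: "real \<Rightarrow> real"
begin

subsection \<open>The Rayleigh operator\<close>

definition P_mat :: "real \<Rightarrow> complex^2^2" where
  "P_mat Z = vector [vector [of_real (mu Z), 0], vector [0, of_real (lam Z + 2 * mu Z)]]"

definition M_mat :: "real \<Rightarrow> complex^2^2" where
  "M_mat Z = vector [vector [of_real (lam Z + 2 * mu Z), 0], vector [0, of_real (mu Z)]]"

definition N_mat :: "real \<Rightarrow> complex^2^2" where
  "N_mat Z = vector [vector [0, - of_real (lam Z)], vector [of_real (mu Z), 0]]"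

definition rayleigh_op :: "complex \<Rightarrow> (real \<Rightarrow> complex^2) \<Rightarrow> real \<Rightarrow> complex^2" where
  "rayleigh_op \<xi> \<psi> Z =
     vderiv (\<lambda>z. P_mat z *v vderiv \<psi> z) Z
     + \<xi> *s (N_mat Z *v vderiv \<psi> Z - vderiv (\<lambda>z. transpose (N_mat z) *v \<psi> z) Z)
     + ((of_real \<omega>)\<^sup>2 *s \<psi> Z - \<xi>\<^sup>2 *s (M_mat Z *v \<psi> Z))"

definition rayleigh_solution :: "complex \<Rightarrow> (real \<Rightarrow> complex^2) \<Rightarrow> bool" where
  "rayleigh_solution \<xi> \<psi> \<longleftrightarrow>
     (\<forall>Z<0. \<psi> differentiable (at Z) \<and> vderiv \<psi> differentiable (at Z) \<and> rayleigh_op \<xi> \<psi> Z = 0)"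

subsection \<open>The Riemann surface\<close>

definition sigma0 :: real where
  "sigma0 = lam0 + 2 * mu0"

definition surface :: "point set" where
  "surface = {(\<xi>, qP, qS). qP\<^sup>2 = of_real (\<omega>\<^sup>2 / sigma0) - \<xi>\<^sup>2 \<and>
                            qS\<^sup>2 = of_real (\<omega>\<^sup>2 / mu0) - \<xi>\<^sup>2}"

definition physical_sheet :: "point set" where
  "physical_sheet = {(\<xi>, qP, qS) \<in> surface. Im qP > 0 \<and> Im qS > 0}"

definition branch_points :: "point set" where
  "branch_points = {(\<xi>, qP, qS) \<in> surface. qP = 0 \<or> qS = 0}"

text \<open>
  The two equations of the surface have independent differentials at each of its points when
  $\omega \neq 0$ and $\sigma_0 \neq \mu_0$, so it is a complex submanifold of $\mathbb{C}^3$ of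
  dimension one. A holomorphic curve in it with nonzero derivative at $0$ is therefore the inverse
  of a holomorphic chart around its value at $0$. Such charts exist around every point, and whether
  a function is holomorphic, meromorphic or has a pole at a point does not depend on the choice.
\<close>

definition local_param :: "point \<Rightarrow> (complex \<Rightarrow> point) \<Rightarrow> bool" where
  "local_param p \<gamma> \<longleftrightarrow>
     \<gamma> 0 = p \<and> (\<forall>\<^sub>F t in nhds 0. \<gamma> t \<in> surface) \<and>
     (\<lambda>t. fst (\<gamma> t)) analytic_on {0} \<and>
     (\<lambda>t. fst (snd (\<gamma> t))) analytic_on {0} \<and>
     (\<lambda>t. snd (snd (\<gamma> t))) analytic_on {0} \<and>
     (deriv (\<lambda>t. fst (\<gamma> t)) 0, deriv (\<lambda>t. fst (snd (\<gamma> t))) 0, deriv (\<lambda>t. snd (snd (\<gamma> t))) 0)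
       \<noteq> (0, 0, 0)"

text \<open>
  With \<open>nicely_meromorphic_on\<close> instead of \<open>meromorphic_on\<close>, such a function is holomorphic at every
  point of the surface that is not one of its poles; at the poles its value is $0$ by convention.
\<close>

definition surface_meromorphic :: "(point \<Rightarrow> complex) \<Rightarrow> bool" where
  "surface_meromorphic f \<longleftrightarrow>
     (\<forall>p\<in>surface. \<exists>\<gamma>. local_param p \<gamma> \<and> (\<lambda>t. f (\<gamma> t)) nicely_meromorphic_on {0})"

definition surface_pole :: "(point \<Rightarrow> complex) \<Rightarrow> point \<Rightarrow> bool" where
  "surface_pole f p \<longleftrightarrow> (\<exists>\<gamma>. local_param p \<gamma> \<and> is_pole (\<lambda>t. f (\<gamma> t)) 0)"

subsection \<open>Jost solutions and the Rayleigh determinant\<close>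

text \<open>
  The argument \<open>s\<close> is the sign $\pm 1$. The Jost solutions are unique on $Z < 0$; their values at
  $Z \ge 0$ are irrelevant.
\<close>

definition jost_P :: "complex \<Rightarrow> point \<Rightarrow> real \<Rightarrow> complex^2" where
  "jost_P s = (\<lambda>(\<xi>, qP, qS). SOME \<psi>. rayleigh_solution \<xi> \<psi> \<and>
     (\<forall>Z\<le>-H. \<psi> Z = exp (s * \<i> * of_real Z * qP) *s vector [- \<xi>, s * \<i> * qP]))"

definition jost_S :: "complex \<Rightarrow> point \<Rightarrow> real \<Rightarrow> complex^2" where
  "jost_S s = (\<lambda>(\<xi>, qP, qS). SOME \<psi>. rayleigh_solution \<xi> \<psi> \<and>
     (\<forall>Z\<le>-H. \<psi> Z = exp (s * \<i> * of_real Z * qS) *s vector [s * \<i> * qS, - \<xi>]))"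

definition a_hat :: "complex \<Rightarrow> (real \<Rightarrow> complex^2) \<Rightarrow> complex" where
  "a_hat \<xi> \<psi> = \<i> * (of_real (at_0_minus lam) * \<xi> * at_0_minus (\<lambda>Z. \<psi> Z $ 1)
     + of_real (at_0_minus lam + 2 * at_0_minus mu) * at_0_minus (\<lambda>Z. vderiv \<psi> Z $ 2))"

definition b_hat :: "complex \<Rightarrow> (real \<Rightarrow> complex^2) \<Rightarrow> complex" where
  "b_hat \<xi> \<psi> = - \<xi> * of_real (at_0_minus mu) * at_0_minus (\<lambda>Z. \<psi> Z $ 2)
     + of_real (at_0_minus mu) * at_0_minus (\<lambda>Z. vderiv \<psi> Z $ 1)"

definition rayleigh_det :: "point \<Rightarrow> complex" where
  "rayleigh_det p =
     a_hat (fst p) (jost_P (-1) p) * b_hat (fst p) (jost_S (-1) p)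
     - a_hat (fst p) (jost_S (-1) p) * b_hat (fst p) (jost_P (-1) p)"

subsection \<open>The resolvent kernel\<close>

definition test_function :: "(real \<Rightarrow> complex^2) \<Rightarrow> bool" where
  "test_function \<phi> \<longleftrightarrow>
     (\<forall>k. Ck_on k \<phi> UNIV) \<and> (\<exists>a b. b < 0 \<and> (\<forall>Z. Z \<notin> {a..b} \<longrightarrow> \<phi> Z = 0))"

text \<open>
  The distributional form of $\mathcal{L}_\xi g = \delta(\cdot - Z') I_2$ on $Z < 0$. Since $P$ and
  $M$ are symmetric, the operator is its own transpose for the bilinear pairing
  $\int \phi^T \psi \, dZ$, so the equation means
  $\int (\mathcal{L}_\xi \phi)^T g \, dZ = \phi(Z')^T$ for all test functions $\phi$.
\<close>

definition fundamental_solution :: "complex \<Rightarrow> real \<Rightarrow> (real \<Rightarrow> complex^2^2) \<Rightarrow> bool" where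
  "fundamental_solution \<xi> Z' g \<longleftrightarrow>
     (\<forall>\<phi>. test_function \<phi> \<longrightarrow> ((\<lambda>Z. rayleigh_op \<xi> \<phi> Z v* g Z) has_integral \<phi> Z') {..<0})"

text \<open>
  Continuity singles out, among the functions that are equal almost everywhere, the representative
  with a definite value at every point, including $Z = Z'$. It is automatically twice continuously
  differentiable off $Z'$, so that the boundary tractions make sense.
\<close>

definition resolvent_kernel :: "point \<Rightarrow> real \<Rightarrow> (real \<Rightarrow> complex^2^2) \<Rightarrow> bool" where
  "resolvent_kernel p Z' g \<longleftrightarrow>
     continuous_on {..<0} g \<and>
     fundamental_solution (fst p) Z' g \<and>
     (\<forall>j. a_hat (fst p) (\<lambda>Z. column j (g Z)) = 0 \<and>
          b_hat (fst p) (\<lambda>Z. column j (g Z)) = 0 \<and>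
          ((\<lambda>Z. column j (g Z)) \<longlongrightarrow> 0) at_bot)"

definition kernel_pole :: "(real \<Rightarrow> real \<Rightarrow> point \<Rightarrow> complex^2^2) \<Rightarrow> point \<Rightarrow> bool" where
  "kernel_pole G p \<longleftrightarrow> (\<exists>Z<0. \<exists>Z'<0. \<exists>i j. surface_pole (\<lambda>p. G Z Z' p $ i $ j) p)"

end

end

theory Submission
  imports Defs
begin

text \<open>
  With the traction $t = P \psi' - \xi N^T \psi$ the equation $\mathcal{L}_\xi \psi = 0$ becomes a
  Hamiltonian first-order system for $(\psi, t)$, polynomial in $\xi$, so its solutions are entire
  in $\xi$ and a symplectic form of any two of them is constant. Let the columns of $J$ be the two Jost
  solutions that decay on the physical sheet, $T$ their tractions at $0$, and let the columns of $B$ be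
  the solutions equal to the unit vectors and free of traction at $0$. Then $\det T = i \Delta$ and
  $G(Z, Z') = - J(Z) T^{-1} B(Z')^T$ for $Z \le Z'$, which makes sense on all of $\mathcal{R}$.

  The zeros of $\Delta$ are isolated: up to a nonvanishing factor, $\Delta$ is
  $D_0 + q_P D_1 + q_S D_2 + q_P q_S D_3$ with entire $D_i(\xi)$, and if this vanished near one point then
  all $D_i$ would be zero, whereas an energy estimate gives $\Delta \neq 0$ on the physical sheet for large
  real $\xi$. At a zero of $\Delta$ some entry of $G$ has a pole, for otherwise $T^{-1}$, which can be
  recovered from finitely many values of $G$, would have a limit.
\<close>

text \<open>The two square roots enter a Jost solution only through its state at \<open>-H\<close>,
  which is explicit and, apart from an exponential factor, of degree at most one in the root;
  transport from \<open>-H\<close> to 0 is entire in \<xi>. This is where the four entire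
  coefficients of the determinant come from. They replace an identity theorem on the surface, for
  which connectedness would have to be shown: one point with nonzero determinant rules out vanishing
  near any other point, whatever the sheet.

  Analyticity of numerator and determinant only places the poles among the zeros of \<Delta>. The
  converse is harder, because the numerator could vanish at such a zero as well, and because the
  kernel shows displacements while T consists of tractions. The factors B and J must therefore be
  inverted at suitable depths before T can be reached.

  No Gronwall argument is needed for uniqueness of solutions: the conserved symplectic form, paired
  with a full set of solutions, already gives it.\<close>

no_notation fps_nth (infixl \<open>$\<close> 75)

subsection \<open>Linear systems depending polynomially on a parameter\<close>

text \<open>Polynomials in \<xi> with coefficients continuous in Z. Generated without mention of a
  degree, they admit products, bounds and primitives in Z by rule induction, and Picard iteration
  does not leave the class.\<close>

inductive_set poly_family :: "(real \<Rightarrow> complex \<Rightarrow> complex) set" where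
  coeff: "continuous_on UNIV c \<Longrightarrow> (\<lambda>Z \<xi>. c Z) \<in> poly_family"
| add: "f \<in> poly_family \<Longrightarrow> g \<in> poly_family \<Longrightarrow> (\<lambda>Z \<xi>. f Z \<xi> + g Z \<xi>) \<in> poly_family"
| shift: "f \<in> poly_family \<Longrightarrow> (\<lambda>Z \<xi>. \<xi> * f Z \<xi>) \<in> poly_family"

lemma poly_family_mult_coeff:
  assumes "f \<in> poly_family" "continuous_on UNIV c"
  shows "(\<lambda>Z \<xi>. c Z * f Z \<xi>) \<in> poly_family"
  using assms(1)
proof induction
  case (coeff d)
  then show ?case using assms(2) by (intro poly_family.coeff continuous_intros)
next
  case (add f g)
  then show ?case using poly_family.add[OF add.IH] by (simp add: distrib_left)
next
  case (shift f)
  then show ?case using poly_family.shift[OF shift.IH] by (simp add: mult.left_commute)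
qed

lemma poly_family_mult:
  assumes "f \<in> poly_family" "g \<in> poly_family"
  shows "(\<lambda>Z \<xi>. f Z \<xi> * g Z \<xi>) \<in> poly_family"
  using assms(1)
proof induction
  case (coeff c)
  then show ?case using poly_family_mult_coeff[OF assms(2)] by simp
next
  case (add f h)
  then show ?case using poly_family.add[OF add.IH] by (simp add: distrib_right)
next
  case (shift f)
  then show ?case using poly_family.shift[OF shift.IH] by (simp add: mult.assoc)
qed

lemma poly_family_const: "(\<lambda>Z \<xi>. a) \<in> poly_family"
  by (rule poly_family.coeff) (rule continuous_on_const)

lemma poly_family_id: "(\<lambda>Z \<xi>. \<xi>) \<in> poly_family"
  using poly_family.shift[OF poly_family_const[of 1]] by simp

lemma poly_family_uminus: "f \<in> poly_family \<Longrightarrow> (\<lambda>Z \<xi>. - f Z \<xi>) \<in> poly_family"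
  using poly_family_mult[OF poly_family_const[of "-1"]] by simp

lemma poly_family_diff:
  "f \<in> poly_family \<Longrightarrow> g \<in> poly_family \<Longrightarrow> (\<lambda>Z \<xi>. f Z \<xi> - g Z \<xi>) \<in> poly_family"
  using poly_family.add[OF _ poly_family_uminus, of f g] by simp

lemma poly_family_sum:
  assumes "\<And>j. j \<in> S \<Longrightarrow> f j \<in> poly_family"
  shows "(\<lambda>Z \<xi>. \<Sum>j\<in>S. f j Z \<xi>) \<in> poly_family"
  using assms
  by (induction S rule: infinite_finite_induct) (auto intro: poly_family_const poly_family.add)

lemma poly_family_power: "f \<in> poly_family \<Longrightarrow> (\<lambda>Z \<xi>. f Z \<xi> ^ n) \<in> poly_family"
  by (induction n) (auto intro: poly_family_const poly_family_mult)

lemmas poly_family_intros = poly_family.coeff poly_family.add poly_family_mult poly_family_const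
  poly_family_id poly_family_uminus poly_family_diff poly_family_sum poly_family_power

lemma poly_family_holomorphic: "f \<in> poly_family \<Longrightarrow> (\<lambda>\<xi>. f Z \<xi>) holomorphic_on S"
  by (induction rule: poly_family.induct) (auto intro!: holomorphic_intros)

lemma poly_family_bounded:
  assumes "f \<in> poly_family" "compact K"
  shows "\<exists>M\<ge>0. \<forall>Z\<in>K. \<forall>\<xi>\<in>cball 0 R. norm (f Z \<xi>) \<le> M"
  using assms(1)
proof induction
  case (coeff c)
  then have "bounded (c ` K)"
    using assms(2) by (intro compact_imp_bounded compact_continuous_image)
      (auto intro: continuous_on_subset)
  then show ?case by (auto simp: bounded_pos image_iff intro: less_imp_le)
next
  case (add f g)
  then obtain M N where "M \<ge> 0" "N \<ge> 0" "\<forall>Z\<in>K. \<forall>\<xi>\<in>cball 0 R. norm (f Z \<xi>) \<le> M"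
      "\<forall>Z\<in>K. \<forall>\<xi>\<in>cball 0 R. norm (g Z \<xi>) \<le> N" by blast
  then show ?case by (intro exI[of _ "M + N"]) (auto intro!: norm_triangle_mono)
next
  case (shift f)
  then obtain M where M: "M \<ge> 0" "\<forall>Z\<in>K. \<forall>\<xi>\<in>cball 0 R. norm (f Z \<xi>) \<le> M" by blast
  have "norm (\<xi> * f Z \<xi>) \<le> \<bar>R\<bar> * M" if "Z \<in> K" "\<xi> \<in> cball 0 R" for Z \<xi>
    unfolding norm_mult using M that by (intro mult_mono) auto
  then show ?case using M(1) by (intro exI[of _ "\<bar>R\<bar> * M"]) auto
qed

text \<open>Integration in Z does not touch \<xi>, so primitives of the coefficients suffice.
  Holomorphy of the Picard iterates then needs no differentiation under an integral.\<close>

lemma poly_family_antiderivative: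
  assumes "f \<in> poly_family"
  shows "\<exists>F\<in>poly_family. \<forall>\<xi>. F c \<xi> = 0 \<and> (\<forall>Z. ((\<lambda>Z. F Z \<xi>) has_vector_derivative f Z \<xi>) (at Z))"
  using assms
proof induction
  case (coeff d)
  have "\<exists>D. \<forall>x::real. -\<infinity> < ereal x \<longrightarrow> ereal x < \<infinity> \<longrightarrow> (D has_vector_derivative d x) (at x)"
    using coeff by (intro einterval_antiderivative)
      (auto simp: continuous_on_eq_continuous_at)
  then obtain D where D: "\<And>x. (D has_vector_derivative d x) (at x)" by auto
  then have "continuous_on UNIV D"
    by (meson continuous_at_imp_continuous_on has_vector_derivative_continuous)
  then have "(\<lambda>Z \<xi>. D Z - D c) \<in> poly_family"
    by (intro poly_family_intros continuous_intros)
  then show ?case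
    by (intro bexI[of _ "\<lambda>Z \<xi>. D Z - D c"]) (auto intro!: derivative_eq_intros D)
next
  case (add f g)
  then obtain F G where "F \<in> poly_family" "G \<in> poly_family"
    "\<forall>\<xi>. F c \<xi> = 0 \<and> (\<forall>Z. ((\<lambda>Z. F Z \<xi>) has_vector_derivative f Z \<xi>) (at Z))"
    "\<forall>\<xi>. G c \<xi> = 0 \<and> (\<forall>Z. ((\<lambda>Z. G Z \<xi>) has_vector_derivative g Z \<xi>) (at Z))" by blast
  then show ?case
    by (intro bexI[of _ "\<lambda>Z \<xi>. F Z \<xi> + G Z \<xi>"]) (auto intro: poly_family.add has_vector_derivative_add)
next
  case (shift f)
  then obtain F where "F \<in> poly_family"
    "\<forall>\<xi>. F c \<xi> = 0 \<and> (\<forall>Z. ((\<lambda>Z. F Z \<xi>) has_vector_derivative f Z \<xi>) (at Z))" by blast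
  then show ?case
    by (intro bexI[of _ "\<lambda>Z \<xi>. \<xi> * F Z \<xi>"])
       (auto intro: poly_family.shift has_vector_derivative_mult_right)
qed

text \<open>The induction step of the Picard estimate: integration raises the power and divides by
  the new exponent, which builds up the factorial. The two sides of c are separate because the
  comparison function has to increase away from the left endpoint.\<close>

lemma norm_le_power_of_derivative_le:
  fixes f :: "real \<Rightarrow> 'a::real_normed_vector"
  assumes f: "\<And>Z. (f has_vector_derivative f' Z) (at Z)" and "f c = 0"
    and bound: "\<And>Z. \<bar>Z - c\<bar> \<le> L \<Longrightarrow> norm (f' Z) \<le> K * \<bar>Z - c\<bar> ^ k"
    and Z: "\<bar>Z - c\<bar> \<le> L"
  shows "norm (f Z) \<le> K * \<bar>Z - c\<bar> ^ Suc k / real (Suc k)"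
proof -
  have cont: "continuous_on A f" for A
    by (meson continuous_at_imp_continuous_on has_vector_derivative_continuous f)
  consider "Z = c" | "c < Z" | "Z < c" by linarith
  then show ?thesis
  proof cases
    case 1
    then show ?thesis using \<open>f c = 0\<close> by simp
  next
    case 2
    have "norm (f Z - f c) \<le> K * (Z - c) ^ Suc k / real (Suc k) - K * (c - c) ^ Suc k / real (Suc k)"
    proof (rule differentiable_bound_general[where f' = f' and \<phi>' = "\<lambda>s. K * (s - c) ^ k"])
      fix s assume "c < s" "s < Z"
      then show "norm (f' s) \<le> K * (s - c) ^ k" using bound[of s] Z by simp
      have "((\<lambda>s. K * (s - c) ^ Suc k / real (Suc k)) has_field_derivative
              K * (real (Suc k) * (s - c) ^ k) / real (Suc k)) (at s)"
        by (auto intro!: derivative_eq_intros simp del: of_nat_Suc power_Suc)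
      then show "((\<lambda>s. K * (s - c) ^ Suc k / real (Suc k)) has_vector_derivative K * (s - c) ^ k) (at s)"
        by (simp add: has_real_derivative_iff_has_vector_derivative del: power_Suc)
    qed (use 2 f cont in \<open>auto intro!: continuous_intros\<close>)
    then show ?thesis using 2 \<open>f c = 0\<close> by simp
  next
    case 3
    have "norm (f c - f Z) \<le> - (K * (c - c) ^ Suc k / real (Suc k)) - - (K * (c - Z) ^ Suc k / real (Suc k))"
    proof (rule differentiable_bound_general[where f' = f' and \<phi>' = "\<lambda>s. K * (c - s) ^ k"])
      fix s assume "Z < s" "s < c"
      then show "norm (f' s) \<le> K * (c - s) ^ k" using bound[of s] Z by simp
      have "((\<lambda>s. - (K * (c - s) ^ Suc k / real (Suc k))) has_field_derivative
              K * (real (Suc k) * (c - s) ^ k) / real (Suc k)) (at s)"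
        by (auto intro!: derivative_eq_intros simp del: of_nat_Suc power_Suc)
      then show "((\<lambda>s. - (K * (c - s) ^ Suc k / real (Suc k))) has_vector_derivative K * (c - s) ^ k) (at s)"
        by (simp add: has_real_derivative_iff_has_vector_derivative del: power_Suc)
    qed (use 3 f cont in \<open>auto intro!: continuous_intros\<close>)
    then show ?thesis using 3 \<open>f c = 0\<close> by simp
  qed
qed

text \<open>For one real variable, uniform convergence of the derivatives is the uniform operator
  bound needed for termwise differentiation; the limit function found that way is g by uniqueness of
  sums.\<close>

lemma has_vector_derivative_series:
  fixes f :: "nat \<Rightarrow> real \<Rightarrow> 'b::banach"
  assumes "open S" "convex S"
    and f: "\<And>n x. x \<in> S \<Longrightarrow> (f n has_vector_derivative f' n x) (at x)"
    and lim: "uniform_limit S (\<lambda>n x. \<Sum>i<n. f' i x) g' sequentially"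
    and sums: "\<And>x. x \<in> S \<Longrightarrow> (\<lambda>n. f n x) sums g x"
    and x: "x \<in> S"
  shows "(g has_vector_derivative g' x) (at x)"
proof -
  have "\<exists>h. \<forall>x\<in>S. (\<lambda>n. f n x) sums h x \<and> (h has_derivative (\<lambda>t. t *\<^sub>R g' x)) (at x within S)"
  proof (rule has_derivative_series[where f = f and f' = "\<lambda>n x t. t *\<^sub>R f' n x" and g' = "\<lambda>x t. t *\<^sub>R g' x" and x = x and l = "g x", OF \<open>convex S\<close> _ _ x sums[OF x]])
    show "(f n has_derivative (\<lambda>t. t *\<^sub>R f' n x)) (at x within S)" if "x \<in> S" for n x
      using f[OF that] unfolding has_vector_derivative_def by (rule has_derivative_at_withinI)
    fix e :: real assume "e > 0"
    from uniform_limitD[OF lim this]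
    show "\<forall>\<^sub>F n in sequentially. \<forall>x\<in>S. \<forall>h. norm ((\<Sum>i<n. h *\<^sub>R f' i x) - h *\<^sub>R g' x) \<le> e * norm h"
    proof (rule eventually_mono, intro ballI allI)
      fix n x h assume *: "\<forall>x\<in>S. dist (\<Sum>i<n. f' i x) (g' x) < e" "x \<in> S"
      have "(\<Sum>i<n. h *\<^sub>R f' i x) - h *\<^sub>R g' x = h *\<^sub>R ((\<Sum>i<n. f' i x) - g' x)"
        by (simp add: scaleR_sum_right scaleR_diff_right)
      then have "norm ((\<Sum>i<n. h *\<^sub>R f' i x) - h *\<^sub>R g' x) = dist (\<Sum>i<n. f' i x) (g' x) * norm h"
        by (simp add: dist_norm)
      also have "\<dots> \<le> e * norm h" using * by (intro mult_right_mono) (auto intro: less_imp_le)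
      finally show "norm ((\<Sum>i<n. h *\<^sub>R f' i x) - h *\<^sub>R g' x) \<le> e * norm h" .
    qed
  qed
  then obtain h where h: "\<And>x. x \<in> S \<Longrightarrow> (\<lambda>n. f n x) sums h x"
      "\<And>x. x \<in> S \<Longrightarrow> (h has_derivative (\<lambda>t. t *\<^sub>R g' x)) (at x within S)" by blast
  have eq: "g y = h y" if "y \<in> S" for y using sums_unique2[OF sums[OF that] h(1)[OF that]] .
  have "(h has_derivative (\<lambda>t. t *\<^sub>R g' x)) (at x)"
    using h(2)[OF x] by (simp only: at_within_open[OF x \<open>open S\<close>])
  then have "(g has_derivative (\<lambda>t. t *\<^sub>R g' x)) (at x)"
    by (rule has_derivative_transform_within_open[OF _ \<open>open S\<close> x]) (simp add: eq)
  then show ?thesis by (simp add: has_vector_derivative_def)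
qed

text \<open>Picard iteration, written as a series of increments \<open>Y k\<close>. The k-th one is
  at most C (M |Z - c|)^k / k! for bounded Z and \<xi>, so the increments and their Z-derivatives
  both sum uniformly on bounded sets. The former gives holomorphy in \<xi>, the latter the
  equation.\<close>

theorem linear_system_holomorphic_solution:
  fixes A :: "'n::finite \<Rightarrow> 'n \<Rightarrow> real \<Rightarrow> complex \<Rightarrow> complex" and y0 :: "'n \<Rightarrow> complex"
  assumes A: "\<And>i j. A i j \<in> poly_family"
  shows "\<exists>y. (\<forall>i \<xi>. y i c \<xi> = y0 i) \<and>
    (\<forall>i Z \<xi>. ((\<lambda>Z. y i Z \<xi>) has_vector_derivative (\<Sum>j\<in>UNIV. A i j Z \<xi> * y j Z \<xi>)) (at Z)) \<and>
    (\<forall>i Z. (\<lambda>\<xi>. y i Z \<xi>) holomorphic_on UNIV)"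
proof -
  define I where "I f = (SOME F. F \<in> poly_family \<and>
    (\<forall>\<xi>. F c \<xi> = 0 \<and> (\<forall>Z. ((\<lambda>Z. F Z \<xi>) has_vector_derivative f Z \<xi>) (at Z))))" for f
  have I: "I f \<in> poly_family" "I f c \<xi> = 0" "((\<lambda>Z. I f Z \<xi>) has_vector_derivative f Z \<xi>) (at Z)"
    if "f \<in> poly_family" for f \<xi> Z
    using someI_ex[of "\<lambda>F. F \<in> poly_family \<and>
    (\<forall>\<xi>. F c \<xi> = 0 \<and> (\<forall>Z. ((\<lambda>Z. F Z \<xi>) has_vector_derivative f Z \<xi>) (at Z)))"]
      poly_family_antiderivative[OF that] unfolding I_def by blast+
  define Y where "Y = rec_nat (\<lambda>i Z \<xi>. y0 i) (\<lambda>_ Yk i. I (\<lambda>Z \<xi>. \<Sum>j\<in>UNIV. A i j Z \<xi> * Yk j Z \<xi>))"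
  have Y0: "Y 0 i Z \<xi> = y0 i" for i Z \<xi> by (simp add: Y_def)
  have YS: "Y (Suc k) i = I (\<lambda>Z \<xi>. \<Sum>j\<in>UNIV. A i j Z \<xi> * Y k j Z \<xi>)" for k i by (simp add: Y_def)
  have Yp: "Y k i \<in> poly_family" for k i
  proof (induction k arbitrary: i)
    case 0
    have "Y 0 i = (\<lambda>Z \<xi>. y0 i)" by (simp add: Y_def)
    then show ?case by (simp add: poly_family_const)
  next
    case (Suc k)
    then show ?case unfolding YS by (intro I(1) poly_family_intros A)
  qed
  \<comment> \<open>The Z-derivative of \<open>Y k\<close>. The zeroth increment is constant, whence
    the value 0 and the index shift by one in all estimates of \<open>d\<close>.\<close>
  define d where "d k i Z \<xi> = (case k of 0 \<Rightarrow> 0 | Suc k \<Rightarrow> \<Sum>j\<in>UNIV. A i j Z \<xi> * Y k j Z \<xi>)"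
    for k i Z \<xi>
  have dp: "(\<lambda>Z \<xi>. \<Sum>j\<in>UNIV. A i j Z \<xi> * Y k j Z \<xi>) \<in> poly_family" for i k
    by (intro poly_family_intros A Yp)
  have Yd: "((\<lambda>Z. Y k i Z \<xi>) has_vector_derivative d k i Z \<xi>) (at Z)" for k i Z \<xi>
  proof (cases k)
    case 0
    then show ?thesis by (simp add: Y0 d_def)
  next
    case (Suc k')
    then show ?thesis using I(3)[OF dp[of i k'], of \<xi> Z] by (simp add: YS d_def)
  qed
  have Yc: "Y (Suc k) i c \<xi> = 0" for k i \<xi> using I(2)[OF dp] by (simp add: YS)
  define C where "C = (\<Sum>i\<in>UNIV. norm (y0 i))"
  have C: "norm (y0 i) \<le> C" for i unfolding C_def by (rule member_le_sum) auto
  have C0: "C \<ge> 0" unfolding C_def by (intro sum_nonneg) auto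

  have bound: "\<exists>M\<ge>0. \<forall>k i Z \<xi>. \<bar>Z - c\<bar> \<le> L \<longrightarrow> norm \<xi> \<le> R \<longrightarrow>
      norm (Y k i Z \<xi>) \<le> C * (M * \<bar>Z - c\<bar>) ^ k / fact k \<and>
      norm (d (Suc k) i Z \<xi>) \<le> M * (C * (M * \<bar>Z - c\<bar>) ^ k / fact k)" for L R
  proof -
    have "\<exists>M\<ge>0. \<forall>Z\<in>cball c L. \<forall>\<xi>\<in>cball 0 R. norm (A i j Z \<xi>) \<le> M" for i j
      by (rule poly_family_bounded[OF A]) simp
    then obtain m where m: "\<And>i j. m i j \<ge> 0"
      "\<And>i j Z \<xi>. Z \<in> cball c L \<Longrightarrow> \<xi> \<in> cball 0 R \<Longrightarrow> norm (A i j Z \<xi>) \<le> m i j" by metis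
    define M where "M = (\<Sum>i\<in>UNIV. \<Sum>j\<in>UNIV. m i j)"
    have M0: "M \<ge> 0" unfolding M_def by (intro sum_nonneg m)
    have row: "(\<Sum>j\<in>UNIV. norm (A i j Z \<xi>)) \<le> M" if "\<bar>Z - c\<bar> \<le> L" "norm \<xi> \<le> R" for i Z \<xi>
    proof -
      have "(\<Sum>j\<in>UNIV. norm (A i j Z \<xi>)) \<le> (\<Sum>j\<in>UNIV. m i j)"
        using that by (intro sum_mono m) (auto simp: dist_norm abs_minus_commute)
      also have "\<dots> \<le> M" unfolding M_def
        by (rule member_le_sum[of i UNIV "\<lambda>i. \<Sum>j\<in>UNIV. m i j"]) (auto intro: sum_nonneg m)
      finally show ?thesis .
    qed
    have dbound: "norm (d (Suc k) i Z \<xi>) \<le> M * B"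
      if "\<bar>Z - c\<bar> \<le> L" "norm \<xi> \<le> R" "\<And>j. norm (Y k j Z \<xi>) \<le> B" for k i Z \<xi> B
    proof -
      have B0: "B \<ge> 0" using order_trans[OF norm_ge_zero that(3)] .
      have "norm (d (Suc k) i Z \<xi>) \<le> (\<Sum>j\<in>UNIV. norm (A i j Z \<xi>) * norm (Y k j Z \<xi>))"
        unfolding d_def by (auto intro!: order_trans[OF norm_sum] sum_mono simp: norm_mult)
      also have "\<dots> \<le> (\<Sum>j\<in>UNIV. norm (A i j Z \<xi>) * B)"
        by (intro sum_mono mult_left_mono that) auto
      also have "\<dots> = (\<Sum>j\<in>UNIV. norm (A i j Z \<xi>)) * B" by (simp add: sum_distrib_right)
      also have "\<dots> \<le> M * B" by (intro mult_right_mono row that B0)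
      finally show ?thesis .
    qed
    have Yb: "norm (Y k i Z \<xi>) \<le> C * (M * \<bar>Z - c\<bar>) ^ k / fact k"
      if "\<bar>Z - c\<bar> \<le> L" "norm \<xi> \<le> R" for k i Z \<xi>
      using that(1)
    proof (induction k arbitrary: i Z)
      case 0
      then show ?case by (simp add: Y0 C)
    next
      case (Suc k)
      have "norm (Y (Suc k) i Z \<xi>) \<le> (M * C * M ^ k / fact k) * \<bar>Z - c\<bar> ^ Suc k / real (Suc k)"
      proof (rule norm_le_power_of_derivative_le[where L = L and f' = "\<lambda>Z. d (Suc k) i Z \<xi>"])
        show "norm (d (Suc k) i Z \<xi>) \<le> M * C * M ^ k / fact k * \<bar>Z - c\<bar> ^ k" if "\<bar>Z - c\<bar> \<le> L" for Z
          using dbound[OF that \<open>norm \<xi> \<le> R\<close> Suc.IH[OF that], of i] by (simp add: power_mult_distrib)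
      qed (use Yd Yc Suc.prems in auto)
      also have "\<dots> = C * (M * \<bar>Z - c\<bar>) ^ Suc k / fact (Suc k)"
        by (simp add: power_mult_distrib field_simps)
      finally show ?case .
    qed
    show ?thesis
      by (intro exI[of _ M] conjI allI impI M0 Yb dbound; assumption)
  qed
  have summ: "summable (\<lambda>k. K * (x::real) ^ k / fact k)" for K x
    using summable_mult[OF summable_exp[of x], of K] by (simp add: divide_inverse mult_ac)

  define y where "y i Z \<xi> = (\<Sum>k. Y k i Z \<xi>)" for i Z \<xi>
  have lim: "uniform_limit (cball c L \<times> cball 0 R) (\<lambda>n (Z, \<xi>). \<Sum>k<n. Y k i Z \<xi>) (\<lambda>(Z, \<xi>). y i Z \<xi>) sequentially"
    (is ?L1)
    and limd: "\<exists>g. uniform_limit (cball c L \<times> cball 0 R) (\<lambda>n (Z, \<xi>). \<Sum>k<n. d k i Z \<xi>) g sequentially"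
    (is ?L2) if "L \<ge> 0" for L R :: real and i
  proof -
    obtain M where M: "M \<ge> 0" "\<And>k i Z \<xi>. \<bar>Z - c\<bar> \<le> L \<Longrightarrow> norm \<xi> \<le> R \<Longrightarrow>
      norm (Y k i Z \<xi>) \<le> C * (M * \<bar>Z - c\<bar>) ^ k / fact k"
      "\<And>k i Z \<xi>. \<bar>Z - c\<bar> \<le> L \<Longrightarrow> norm \<xi> \<le> R \<Longrightarrow>
      norm (d (Suc k) i Z \<xi>) \<le> M * (C * (M * \<bar>Z - c\<bar>) ^ k / fact k)" using bound[of L R] by blast
    have mono: "C * (M * \<bar>Z - c\<bar>) ^ k / fact k \<le> C * (M * L) ^ k / fact k" if "\<bar>Z - c\<bar> \<le> L" for Z k
      using that M(1) C0 by (intro divide_right_mono mult_left_mono power_mono) auto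
    have "uniform_limit (cball c L \<times> cball 0 R) (\<lambda>n x. \<Sum>k<n. Y k i (fst x) (snd x))
        (\<lambda>x. \<Sum>k. Y k i (fst x) (snd x)) sequentially"
    proof (rule Weierstrass_m_test[where M = "\<lambda>k. C * (M * L) ^ k / fact k"])
      show "norm (Y k i (fst x) (snd x)) \<le> C * (M * L) ^ k / fact k" if "x \<in> cball c L \<times> cball 0 R" for k x
        using that by (intro order_trans[OF M(2) mono]) (auto simp: dist_norm abs_minus_commute)
    qed (rule summ)
    then show ?L1 by (simp add: y_def case_prod_unfold)
    have "uniform_limit (cball c L \<times> cball 0 R) (\<lambda>n x. \<Sum>k<n. d k i (fst x) (snd x))
        (\<lambda>x. \<Sum>k. d k i (fst x) (snd x)) sequentially"
    proof (rule Weierstrass_m_test[where M = "\<lambda>k. case k of 0 \<Rightarrow> 0 | Suc k \<Rightarrow> M * (C * (M * L) ^ k / fact k)"])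
      show "norm (d k i (fst x) (snd x)) \<le> (case k of 0 \<Rightarrow> 0 | Suc k \<Rightarrow> M * (C * (M * L) ^ k / fact k))"
        if "x \<in> cball c L \<times> cball 0 R" for k x
      proof (cases k)
        case 0
        then show ?thesis by (simp add: d_def)
      next
        case (Suc k')
        have x: "\<bar>fst x - c\<bar> \<le> L" "norm (snd x) \<le> R"
          using that by (auto simp: dist_norm abs_minus_commute)
        have "norm (d (Suc k') i (fst x) (snd x)) \<le> M * (C * (M * L) ^ k' / fact k')"
          by (rule order_trans[OF M(3)[OF x] mult_left_mono[OF mono[OF x(1)] M(1)]])
        then show ?thesis using Suc by simp
      qed
      show "summable (\<lambda>k. case k of 0 \<Rightarrow> 0 | Suc k \<Rightarrow> M * (C * (M * L) ^ k / fact k))"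
        using summable_mult[OF summ[of C "M * L"], of M] by (subst summable_Suc_iff[symmetric]) simp
    qed
    then show ?L2 by (auto simp: case_prod_unfold)
  qed
  have sums: "(\<lambda>k. Y k i Z \<xi>) sums y i Z \<xi>" for i Z \<xi>
  proof -
    have "(\<lambda>n. \<Sum>k<n. Y k i Z \<xi>) \<longlonglongrightarrow> y i Z \<xi>"
      using tendsto_uniform_limitI[OF lim[where L = "\<bar>Z - c\<bar>" and R = "norm \<xi>" and i = i], of "(Z, \<xi>)"]
      by (simp add: dist_norm)
    then show ?thesis by (simp add: sums_def)
  qed
  have "(\<lambda>k. d k i Z \<xi>) sums (\<Sum>j\<in>UNIV. A i j Z \<xi> * y j Z \<xi>)" for i Z \<xi>
  proof -
    have "(\<lambda>k. d (Suc k) i Z \<xi>) sums (\<Sum>j\<in>UNIV. A i j Z \<xi> * y j Z \<xi>)"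
      unfolding d_def by (simp) (intro sums_sum sums_mult sums)
    then show ?thesis using sums_Suc_iff[of "\<lambda>k. d k i Z \<xi>"] by (simp add: d_def)
  qed
  note dsums = this
  have deriv: "((\<lambda>Z. y i Z \<xi>) has_vector_derivative (\<Sum>j\<in>UNIV. A i j Z \<xi> * y j Z \<xi>)) (at Z)" for i Z \<xi>
  proof -
    define L where "L = \<bar>Z - c\<bar> + 1"
    obtain g where g: "uniform_limit (cball c L \<times> cball 0 (norm \<xi>)) (\<lambda>n (Z, \<xi>). \<Sum>k<n. d k i Z \<xi>) g sequentially"
      using limd[where L = L and R = "norm \<xi>" and i = i] by (auto simp: L_def)
    have g_eq: "g (s, \<xi>) = (\<Sum>j\<in>UNIV. A i j s \<xi> * y j s \<xi>)" if "s \<in> ball c L" for s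
      using tendsto_uniform_limitI[OF g, of "(s, \<xi>)"] dsums[of i s \<xi>] that
      by (auto simp: sums_def dest: LIMSEQ_unique)
    show ?thesis
    proof (rule has_vector_derivative_series[where S = "ball c L" and f = "\<lambda>k Z. Y k i Z \<xi>" and f' = "\<lambda>k Z. d k i Z \<xi>"])
      have "uniform_limit (ball c L) (\<lambda>n s. \<Sum>k<n. d k i s \<xi>) (\<lambda>s. g (s, \<xi>)) sequentially"
        using uniform_limit_compose'[OF g, where h = "\<lambda>s. (s, \<xi>)" and B = "ball c L"] by auto
      then show "uniform_limit (ball c L) (\<lambda>n s. \<Sum>k<n. d k i s \<xi>) (\<lambda>Z. \<Sum>j\<in>UNIV. A i j Z \<xi> * y j Z \<xi>) sequentially"
        by (subst uniform_limit_cong'[of _ _ "\<lambda>n s. \<Sum>k<n. d k i s \<xi>" _ "\<lambda>s. g (s, \<xi>)"]) (auto simp: g_eq)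
    qed (use Yd sums in \<open>auto simp: L_def dist_norm\<close>)
  qed
  have hol: "(\<lambda>\<xi>. y i Z \<xi>) holomorphic_on UNIV" for i Z
  proof (rule holomorphic_uniform_sequence[where f = "\<lambda>n \<xi>. \<Sum>k<n. Y k i Z \<xi>"])
    show "(\<lambda>\<xi>. \<Sum>k<n. Y k i Z \<xi>) holomorphic_on UNIV" for n
      by (intro holomorphic_on_sum poly_family_holomorphic Yp)
    fix x :: complex
    have sub: "norm \<xi> \<le> norm x + 1" if "\<xi> \<in> cball x 1" for \<xi>
      using norm_triangle_ineq2[of \<xi> x] that by (simp add: dist_norm norm_minus_commute)
    have "uniform_limit (cball x 1) (\<lambda>n \<xi>. \<Sum>k<n. Y k i Z \<xi>) (\<lambda>\<xi>. y i Z \<xi>) sequentially"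
      using uniform_limit_compose'[OF lim[where L = "\<bar>Z - c\<bar>" and R = "norm x + 1" and i = i],
          where h = "\<lambda>\<xi>. (Z, \<xi>)" and B = "cball x 1"] sub
      by (auto simp: dist_norm abs_minus_commute)
    then show "\<exists>e>0. cball x e \<subseteq> UNIV \<and> uniform_limit (cball x e) (\<lambda>n \<xi>. \<Sum>k<n. Y k i Z \<xi>) (\<lambda>\<xi>. y i Z \<xi>) sequentially"
      by (intro exI[of _ 1]) auto
  qed simp
  have init: "y i c \<xi> = y0 i" for i \<xi>
  proof -
    have "(\<lambda>k. Y k i c \<xi>) sums Y 0 i c \<xi>"
      using sums_finite[of "{0}" "\<lambda>k. Y k i c \<xi>"] Yc by (auto simp: gr0_conv_Suc)
    then show ?thesis using sums_unique2[OF sums] by (simp add: Y0)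
  qed
  show ?thesis using init deriv hol by blast
qed

subsection \<open>Square roots and entire functions\<close>

text \<open>Parity of orders: if g, hence f, were not locally zero, then 2 ord f = 1 + 2 ord
  g.\<close>

lemma analytic_square_eq_simple_zero_times_square:
  fixes f g h :: "complex \<Rightarrow> complex"
  assumes an: "f analytic_on {r}" "g analytic_on {r}" "h analytic_on {r}"
    and h: "h r = 0" "deriv h r \<noteq> 0"
    and eq: "\<forall>\<^sub>F z in at r. f z ^ 2 = h z * g z ^ 2"
  shows "(\<forall>\<^sub>F z in at r. f z = 0) \<and> (\<forall>\<^sub>F z in at r. g z = 0)"
proof (cases "\<exists>\<^sub>F z in at r. g z \<noteq> 0")
  case False
  then have g: "\<forall>\<^sub>F z in at r. g z = 0" by (simp add: not_frequently)
  with eq have "\<forall>\<^sub>F z in at r. f z = 0" by eventually_elim simp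
  with g show ?thesis by blast
next
  case True
  have mero: "f meromorphic_on {r}" "g meromorphic_on {r}" "h meromorphic_on {r}"
    using an by (auto intro: analytic_on_imp_meromorphic_on)
  have zh: "zorder h r = 1"
    using h an(3) by (intro zorder_zero_eqI') auto
  have ev_g: "\<forall>\<^sub>F z in at r. g z \<noteq> 0"
    using True an(2) by (intro non_zero_neighbour isolated_singularity_at_analytic not_essential_analytic)
  have "\<exists>\<^sub>F z in at r. h z \<noteq> 0"
  proof (rule ccontr)
    assume "\<not> ?thesis"
    then have "\<forall>\<^sub>F z in at r. h z = 0" by (simp add: not_frequently)
    then have "\<forall>\<^sub>F z in nhds r. h z = (\<lambda>_. 0) z" using h by (simp add: eventually_nhds_conv_at)
    from deriv_cong_ev[OF this refl] h show False by simp
  qed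
  moreover from this have ev_h: "\<forall>\<^sub>F z in at r. h z \<noteq> 0"
    using an(3) by (intro non_zero_neighbour isolated_singularity_at_analytic not_essential_analytic)
  moreover have ev_f: "\<forall>\<^sub>F z in at r. f z \<noteq> 0" using eq ev_g ev_h by eventually_elim auto
  have fr: "\<exists>\<^sub>F z in at r. f z \<noteq> 0" "\<exists>\<^sub>F z in at r. g z ^ 2 \<noteq> 0"
    using ev_f ev_g by (auto intro!: eventually_frequently)
  moreover have "zorder (\<lambda>z. f z ^ 2) r = zorder (\<lambda>z. h z * g z ^ 2) r"
    using eq by (intro zorder_cong) auto
  ultimately have "2 * zorder f r = 1 + 2 * zorder g r"
    using mero True zh by (simp add: zorder_power zorder_mult meromorphic_on_power)
  then show ?thesis by presburger
qed

lemma entire_eq_0: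
  assumes "f holomorphic_on UNIV" "\<exists>\<^sub>F z in at r. f z = 0"
  shows "f z = 0"
proof (rule analytic_continuation[of f UNIV "{z. f z = 0}" r])
  show "r islimpt {z. f z = 0}" using assms(2) by (simp add: islimpt_conv_frequently_at)
qed (use assms(1) in auto)

text \<open>Carries an identity along a curve over to the \<xi>-plane, where the identity theorem
  for entire functions applies.\<close>

lemma frequently_at_filterlim:
  assumes "filterlim X (at x) F" "F \<noteq> bot" "\<forall>\<^sub>F t in F. P (X t)"
  shows "\<exists>\<^sub>F z in at x. P z"
proof (rule ccontr)
  assume "\<not> ?thesis"
  then have "\<forall>\<^sub>F z in at x. \<not> P z" by (simp add: not_frequently)
  then have "\<forall>\<^sub>F t in F. \<not> P (X t)" using assms(1) by (rule eventually_compose_filterlim)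
  with assms(3) have "\<forall>\<^sub>F t in F. False" by eventually_elim simp
  then show False using assms(2) by simp
qed

text \<open>
  The square roots of $a - \xi^2$ and $b - \xi^2$ are independent over the entire functions: squaring
  away one root after the other leaves identities $f^2 = h g^2$ with a simple zero of $h$.
\<close>

lemma entire_coefficients_unique:
  fixes a b :: complex and D0 D1 D2 D3 X QP QS :: "complex \<Rightarrow> complex"
  assumes ab: "a \<noteq> 0" "b \<noteq> 0" "a \<noteq> b"
    and D: "D0 holomorphic_on UNIV" "D1 holomorphic_on UNIV" "D2 holomorphic_on UNIV" "D3 holomorphic_on UNIV"
    and X: "filterlim X (at x) F" "F \<noteq> bot"
    and Q: "\<forall>\<^sub>F t in F. QP t ^ 2 = a - X t ^ 2" "\<forall>\<^sub>F t in F. QS t ^ 2 = b - X t ^ 2"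
    and zero: "\<forall>\<^sub>F t in F. D0 (X t) + QP t * D1 (X t) + QS t * D2 (X t) + QP t * QS t * D3 (X t) = 0"
  shows "D0 z = 0 \<and> D1 z = 0 \<and> D2 z = 0 \<and> D3 z = 0"
proof -
  \<comment> \<open>Multiplying by the conjugate under q_S -> -q_S leaves \<open>E0 + q * E1\<close>
    with q a root of a - z^2. The same step for q yields \<open>E0^2 - (a - z^2) * E1^2\<close>,
    which is entire in z alone.\<close>
  define E0 where "E0 z = D0 z ^ 2 + (a - z ^ 2) * D1 z ^ 2 - (b - z ^ 2) * (D2 z ^ 2 + (a - z ^ 2) * D3 z ^ 2)" for z
  define E1 where "E1 z = 2 * D0 z * D1 z - 2 * (b - z ^ 2) * D2 z * D3 z" for z
  have E: "(D0 z + q * D1 z) ^ 2 - (b - z ^ 2) * (D2 z + q * D3 z) ^ 2 = E0 z + q * E1 z"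
    if "q ^ 2 = a - z ^ 2" for z q
    unfolding E0_def E1_def that[symmetric] by (simp add: algebra_simps power2_eq_square)
  have hol: "E0 holomorphic_on UNIV" "E1 holomorphic_on UNIV"
    unfolding E0_def E1_def using D by (auto intro!: holomorphic_intros)
  have an: "f analytic_on {r}" if "f holomorphic_on UNIV" for f and r :: complex
    using that analytic_at by blast
  have "\<forall>\<^sub>F t in F. E0 (X t) ^ 2 - (a - X t ^ 2) * E1 (X t) ^ 2 = 0"
    using Q zero
  proof eventually_elim
    case (elim t)
    have "D0 (X t) + QP t * D1 (X t) = - QS t * (D2 (X t) + QP t * D3 (X t))"
      using elim(3) by algebra
    then have "(D0 (X t) + QP t * D1 (X t)) ^ 2 = (- QS t * (D2 (X t) + QP t * D3 (X t))) ^ 2"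
      by (rule arg_cong)
    then have "E0 (X t) + QP t * E1 (X t) = 0"
      using E[OF elim(1)] elim(2) by (simp add: power_mult_distrib)
    then have "E0 (X t) = - QP t * E1 (X t)" by (simp add: add_eq_0_iff2)
    then show ?case using elim(1) by (simp add: power_mult_distrib)
  qed
  then have fr: "\<exists>\<^sub>F z in at x. E0 z ^ 2 - (a - z ^ 2) * E1 z ^ 2 = 0"
    by (rule frequently_at_filterlim[OF X])
  have E01: "E0 z ^ 2 - (a - z ^ 2) * E1 z ^ 2 = 0" for z
    by (rule entire_eq_0[OF _ fr]) (auto intro!: holomorphic_intros hol)
  \<comment> \<open>For c \<noteq> 0 the function c - z^2 has a simple zero at
    \<open>csqrt c\<close>, so the parity of orders applies there.\<close>
  have parity: "(\<forall>\<^sub>F z in at (csqrt c). f z = 0) \<and> (\<forall>\<^sub>F z in at (csqrt c). g z = 0)"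
    if "f analytic_on {csqrt c}" "g analytic_on {csqrt c}" "c \<noteq> 0"
      "\<And>z. f z ^ 2 = (c - z ^ 2) * g z ^ 2" for f g c
  proof (rule analytic_square_eq_simple_zero_times_square[OF that(1,2)])
    have "((\<lambda>z. c - z ^ 2) has_field_derivative - 2 * csqrt c) (at (csqrt c))"
      by (auto intro!: derivative_eq_intros)
    then show "deriv (\<lambda>z. c - z ^ 2) (csqrt c) \<noteq> 0" using that(3) by (simp add: DERIV_imp_deriv)
  qed (use that in \<open>auto intro!: analytic_intros\<close>)
  have fr0: "\<exists>\<^sub>F z in at r. f z = 0" if "\<forall>\<^sub>F z in at r. f z = (0::complex)" for f and r :: complex
    using that by (intro eventually_frequently) auto
  have "E0 z = 0 \<and> E1 z = 0" for z
    using parity[OF an[OF hol(1)] an[OF hol(2)] ab(1)] E01 entire_eq_0[OF hol(1) fr0] entire_eq_0[OF hol(2) fr0]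
    by auto
  note E_0 = this
  \<comment> \<open>A branch of the root of a - z^2 that is analytic near \<open>csqrt b\<close>:
    after division by a - b the argument of \<open>csqrt\<close> is 1 at that point, away from the
    cut.\<close>
  define q where "q z = csqrt ((a - z ^ 2) / (a - b)) * csqrt (a - b)" for z
  have q2: "q z ^ 2 = a - z ^ 2" for z using ab by (simp add: q_def power_mult_distrib)
  have q_an: "q analytic_on {csqrt b}" unfolding q_def
    using ab by (auto intro!: analytic_intros)
  have q0: "\<forall>\<^sub>F z in at (csqrt b). q z \<noteq> 0"
  proof -
    have "isCont q (csqrt b)" using q_an by (rule analytic_at_imp_isCont)
    moreover have "q (csqrt b) \<noteq> 0" using ab by (simp add: q_def)
    ultimately show ?thesis by (intro tendsto_imp_eventually_ne) (auto simp: isCont_def)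
  qed
  have D': "D0 analytic_on {csqrt b}" "D1 analytic_on {csqrt b}" "D2 analytic_on {csqrt b}" "D3 analytic_on {csqrt b}"
    using D by (auto intro: an)
  \<comment> \<open>The norm identity holds for q and for -q. Having both separates D0 from D1 and
    D2 from D3, since q does not vanish near \<open>csqrt b\<close>.\<close>
  have plus: "(D0 z + q z * D1 z) ^ 2 = (b - z ^ 2) * (D2 z + q z * D3 z) ^ 2"
    and minus: "(D0 z - q z * D1 z) ^ 2 = (b - z ^ 2) * (D2 z - q z * D3 z) ^ 2" for z
    using E[OF q2, of z] E[of "- q z" z] q2[of z] E_0[of z] by auto
  have "(\<forall>\<^sub>F z in at (csqrt b). D0 z + q z * D1 z = 0) \<and> (\<forall>\<^sub>F z in at (csqrt b). D2 z + q z * D3 z = 0)"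
    using plus by (intro parity analytic_intros D' q_an ab)
  moreover have "(\<forall>\<^sub>F z in at (csqrt b). D0 z - q z * D1 z = 0) \<and> (\<forall>\<^sub>F z in at (csqrt b). D2 z - q z * D3 z = 0)"
    using minus by (intro parity analytic_intros D' q_an ab)
  ultimately have "\<forall>\<^sub>F z in at (csqrt b). D0 z + q z * D1 z = 0 \<and> D0 z - q z * D1 z = 0 \<and>
      D2 z + q z * D3 z = 0 \<and> D2 z - q z * D3 z = 0"
    unfolding eventually_conj_iff by blast
  then have ev: "\<forall>\<^sub>F z in at (csqrt b). D0 z = 0 \<and> D1 z = 0 \<and> D2 z = 0 \<and> D3 z = 0"
    using q0
  proof eventually_elim
    case (elim z)
    have *: "u = 0 \<and> v = 0" if "u + q z * v = 0" "u - q z * v = 0" for u v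
    proof -
      have "2 * u = 0" using arg_cong2[OF that, of "(+)"] by simp
      then show ?thesis using that elim(2) by simp
    qed
    show ?case using elim(1) *[of "D0 z" "D1 z"] *[of "D2 z" "D3 z"] by blast
  qed
  have "\<exists>\<^sub>F z in at (csqrt b). D0 z = 0" "\<exists>\<^sub>F z in at (csqrt b). D1 z = 0"
    "\<exists>\<^sub>F z in at (csqrt b). D2 z = 0" "\<exists>\<^sub>F z in at (csqrt b). D3 z = 0"
    by (rule fr0[OF eventually_mono[OF ev]]; simp)+
  then show ?thesis by (intro conjI entire_eq_0 D)
qed

subsection \<open>The energy estimate\<close>

text \<open>Put U = x u and V = x v. Three times the elastic energy (the terms without \<kappa>) is
  3 m e^2 + (3 l + 2 m)(w + U)^2 + 2 m (w - U)^2 + 2 m (w^2 + U^2). The part m (3 e^2 + 2 w^2 + 2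
  U^2) has to pay for the \<kappa> terms: completing the square in V - U + e - w does this once m is
  at least 9 \<kappa>. The proof lists the squares.\<close>

lemma energy_form_bound:
  fixes l m \<kappa> x u v e w :: real
  assumes "m \<ge> 9 * \<kappa>" "\<kappa> \<ge> 0" "2 * m + 3 * l \<ge> 0"
  shows "m * e\<^sup>2 + (l + 2 * m) * w\<^sup>2 + 2 * x * l * u * w + x\<^sup>2 * (l + 2 * m) * u\<^sup>2
       - 2 * \<kappa> * x * (u - v) * (x * v + e - w) \<ge> \<kappa> * x\<^sup>2 * (u\<^sup>2 + v\<^sup>2)"
proof -
  define U V where "U = x * u" and "V = x * v"
  have "0 \<le> (3 * l + 2 * m) * (w + U)\<^sup>2" "0 \<le> 2 * m * (w - U)\<^sup>2"
    "0 \<le> (m - 9 * \<kappa>) * (3 * e\<^sup>2 + 2 * w\<^sup>2 + 2 * U\<^sup>2)" "0 \<le> 9 * \<kappa> * e\<^sup>2"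
    "0 \<le> 3 * \<kappa> * ((V - U + e - w)\<^sup>2 + (e + w)\<^sup>2 + 4 * e\<^sup>2 + 4 * w\<^sup>2 + 4 * U\<^sup>2)"
    using assms by auto
  then have "3 * (\<kappa> * (U\<^sup>2 + V\<^sup>2)) \<le> 3 * (m * e\<^sup>2 + (l + 2 * m) * w\<^sup>2 + 2 * l * U * w + (l + 2 * m) * U\<^sup>2
      - 2 * \<kappa> * (U - V) * (V + e - w))"
    by (simp add: power2_eq_square algebra_simps)
  then show ?thesis by (simp add: U_def V_def power2_eq_square algebra_simps)
qed

text \<open>
  The quadratic form $u s + v t$ has the elastic energy density minus $\omega^2 (u^2 + v^2)$ as
  derivative. The energy alone does not control $v$; subtracting the total derivative of
  $\kappa x (u - v)^2$, whose boundary term has a favourable sign, plays the role of Korn's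
  inequality and makes the function monotone for large $x$.
\<close>

lemma no_surface_wave_of_large_wavenumber:
  fixes u v s t l m :: "real \<Rightarrow> real" and x \<omega> \<kappa> :: real
  defines "w \<equiv> \<lambda>Z. (t Z - x * l Z * u Z) / (l Z + 2 * m Z)"
  assumes u: "\<And>Z. (u has_real_derivative s Z / m Z + x * v Z) (at Z)"
    and v: "\<And>Z. (v has_real_derivative w Z) (at Z)"
    and s: "\<And>Z. (s has_real_derivative x * l Z * w Z - (\<omega>\<^sup>2 - x\<^sup>2 * (l Z + 2 * m Z)) * u Z) (at Z)"
    and t: "\<And>Z. (t has_real_derivative - x * s Z - \<omega>\<^sup>2 * v Z) (at Z)"
    and pos: "\<kappa> > 0" "\<And>Z. m Z \<ge> 9 * \<kappa>" "\<And>Z. 2 * m Z + 3 * l Z \<ge> 0"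
    and x: "x > 0" "\<omega>\<^sup>2 < \<kappa> * x\<^sup>2"
    and lim: "(u \<longlongrightarrow> 0) at_bot" "(v \<longlongrightarrow> 0) at_bot" "(s \<longlongrightarrow> 0) at_bot" "(t \<longlongrightarrow> 0) at_bot"
    and bc: "s 0 = 0" "t 0 = 0" and Z: "Z < 0"
  shows "u Z = 0 \<and> v Z = 0"
proof -
  define g where "g Z = u Z * s Z + v Z * t Z - \<kappa> * x * (u Z - v Z)\<^sup>2" for Z
  define g' where "g' Z = (s Z / m Z + x * v Z) * s Z + u Z * (x * l Z * w Z - (\<omega>\<^sup>2 - x\<^sup>2 * (l Z + 2 * m Z)) * u Z)
      + w Z * t Z + v Z * (- x * s Z - \<omega>\<^sup>2 * v Z)
      - 2 * \<kappa> * x * (u Z - v Z) * (x * v Z + s Z / m Z - w Z)" for Z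
  have dg: "(g has_real_derivative g' Z) (at Z)" for Z
    unfolding g_def g'_def by (rule derivative_eq_intros u v s t refl)+ (simp add: algebra_simps diff_divide_distrib)
  have g'_ge: "g' Z \<ge> (\<kappa> * x\<^sup>2 - \<omega>\<^sup>2) * ((u Z)\<^sup>2 + (v Z)\<^sup>2)" for Z
  proof -
    have m: "m Z \<ge> 9 * \<kappa>" "2 * m Z + 3 * l Z \<ge> 0" "m Z > 0" using pos(1) pos(2,3)[of Z] by auto
    then have sig: "l Z + 2 * m Z > 0" by linarith
    define e where "e = s Z / m Z"
    have se: "s Z = m Z * e" using m by (simp add: e_def)
    have tw: "t Z = (l Z + 2 * m Z) * w Z + x * l Z * u Z" using sig by (simp add: w_def)
    have "g' Z = m Z * e\<^sup>2 + (l Z + 2 * m Z) * (w Z)\<^sup>2 + 2 * x * l Z * u Z * w Z + x\<^sup>2 * (l Z + 2 * m Z) * (u Z)\<^sup>2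
       - 2 * \<kappa> * x * (u Z - v Z) * (x * v Z + e - w Z) - \<omega>\<^sup>2 * ((u Z)\<^sup>2 + (v Z)\<^sup>2)"
      using m(3) unfolding g'_def e_def[symmetric] se tw by (simp add: power2_eq_square algebra_simps)
    then show ?thesis
      using energy_form_bound[where \<kappa> = \<kappa> and m = "m Z" and l = "l Z" and e = e and w = "w Z" and x = x and u = "u Z" and v = "v Z"] m pos(1) by (simp add: left_diff_distrib)
  qed
  have coeff: "\<kappa> * x\<^sup>2 - \<omega>\<^sup>2 > 0" using x by simp
  have g'_nonneg: "g' Z \<ge> 0" for Z
    by (rule order_trans[OF _ g'_ge]) (use coeff in auto)
  have mono: "g a \<le> g b" if "a \<le> b" for a b
    using DERIV_nonneg_imp_nondecreasing[OF that, of g] dg g'_nonneg by blast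
  have glim: "(g \<longlongrightarrow> 0) at_bot" unfolding g_def
    by (rule tendsto_eq_intros lim refl)+ simp
  \<comment> \<open>At 0 the tractions vanish and only -\<kappa> x (u - v)^2 remains. A
    nondecreasing function with limit 0 at minus infinity and a nonpositive value at 0 is zero in
    between; then \<open>g'\<close> vanishes too and forces u and v to vanish.\<close>
  have "g a = 0" if "a \<le> 0" for a
  proof (rule antisym)
    have "g 0 \<le> 0" unfolding g_def bc using pos(1) x by simp
    then show "g a \<le> 0" using mono[OF that] by simp
    show "0 \<le> g a"
      by (rule tendsto_upperbound[OF glim]) (auto simp: eventually_at_bot_linorder intro!: mono)
  qed
  then have "((\<lambda>_. 0) has_real_derivative g' Z) (at Z)"
    using Z by (intro has_field_derivative_transform_within_open[OF dg, of "{..<0}"]) auto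
  then have "g' Z = 0" using DERIV_const DERIV_unique by blast
  then have "(\<kappa> * x\<^sup>2 - \<omega>\<^sup>2) * ((u Z)\<^sup>2 + (v Z)\<^sup>2) \<le> 0" using g'_ge[of Z] by simp
  then have "(u Z)\<^sup>2 + (v Z)\<^sup>2 \<le> 0" using coeff by (simp add: mult_le_0_iff)
  then show ?thesis using sum_power2_le_zero_iff by blast
qed

subsection \<open>Vector-valued derivatives\<close>

definition quad :: "'a \<Rightarrow> 'a \<Rightarrow> 'a \<Rightarrow> 'a \<Rightarrow> 4 \<Rightarrow> 'a" where
  "quad a b c d i = (if i = 1 then a else if i = 2 then b else if i = 3 then c else d)"

lemma quad_simps [simp]:
  "quad a b c d 1 = a" "quad a b c d 2 = b" "quad a b c d 3 = c" "quad a b c d 4 = d"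
  by (simp_all add: quad_def)

lemma has_vector_derivative_vector_2:
  assumes "(f has_vector_derivative f') F" "(g has_vector_derivative g') F"
  shows "((\<lambda>z. vector [f z, g z] :: complex^2) has_vector_derivative vector [f', g']) F"
proof -
  have eq: "(vector [a, b] :: complex^2) = axis 1 a + axis 2 b" for a b :: complex
    by (simp add: vec_eq_iff forall_2 axis_def)
  have "bounded_linear (axis i :: complex \<Rightarrow> complex^2)" for i
    by (auto simp: linear_conv_bounded_linear[symmetric] linear_iff vec_eq_iff axis_def)
  then show ?thesis unfolding eq
    by (intro has_vector_derivative_add bounded_linear.has_vector_derivative[OF _ assms(1)]
        bounded_linear.has_vector_derivative[OF _ assms(2)])
qed

lemma has_vector_derivative_vec_nth:
  "(f has_vector_derivative f') F \<Longrightarrow> ((\<lambda>z. f z $ i) has_vector_derivative f' $ i) F"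
  by (rule bounded_linear.has_vector_derivative[OF bounded_linear_vec_nth])

lemma vderivI: "(f has_vector_derivative f') (at Z) \<Longrightarrow> vderiv f Z = f'"
  unfolding vderiv_def by (rule vector_derivative_at)

lemma vderiv_works: "f differentiable (at Z) \<Longrightarrow> (f has_vector_derivative vderiv f Z) (at Z)"
  unfolding vderiv_def by (simp add: vector_derivative_works)

subsection \<open>The coefficients\<close>

locale rayleigh =
  fixes \<omega> H lam0 mu0 alpha0 beta0 :: real and lam mu :: "real \<Rightarrow> real"
  assumes \<omega>: "\<omega> > 0" and H: "H > 0"
    and lam_smooth: "Ck_on 3 lam {..0}" and mu_smooth: "Ck_on 3 mu {..0}"
    and alpha0: "alpha0 > 0" and mu_ge: "\<And>Z. Z \<le> 0 \<Longrightarrow> mu Z \<ge> alpha0"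
    and beta0: "beta0 > 0" and bulk_ge: "\<And>Z. Z \<le> 0 \<Longrightarrow> 2 * mu Z + 3 * lam Z \<ge> beta0"
    and lam_const: "\<And>Z. Z < - H \<Longrightarrow> lam Z = lam0" and mu_const: "\<And>Z. Z < - H \<Longrightarrow> mu Z = mu0"
begin

text \<open>Extending the coefficients continuously beyond $0$ lets the solutions live on all of the real line.\<close>

definition l :: "real \<Rightarrow> real" where "l Z = lam (min Z 0)"
definition m :: "real \<Rightarrow> real" where "m Z = mu (min Z 0)"
definition sg :: "real \<Rightarrow> real" where "sg Z = l Z + 2 * m Z"
abbreviation sigma :: real where "sigma \<equiv> sigma0 lam0 mu0"

lemma Ck_on_differentiable:
  fixes f :: "real \<Rightarrow> real"
  assumes "Ck_on 3 f {..0}" "Z < 0"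
  shows "\<exists>f'. (f has_vector_derivative f') (at Z)"
proof -
  obtain f' where "\<forall>x\<in>{..0}. (f has_vector_derivative f' x) (at x within {..0})"
    using assms(1) by (auto simp: numeral_3_eq_3)
  then have "(f has_vector_derivative f' Z) (at Z within {..0})" using assms(2) by auto
  then have "(f has_vector_derivative f' Z) (at Z within {..<0})"
    by (rule has_vector_derivative_within_subset) auto
  then show ?thesis using assms(2) at_within_open[of Z "{..<0}"] by auto
qed

lemma Ck_on_continuous:
  fixes f :: "real \<Rightarrow> real"
  assumes "Ck_on 3 f {..0}"
  shows "continuous_on {..0} f"
  using assms unfolding numeral_3_eq_3
  by (auto simp: continuous_on_eq_continuous_within intro: has_vector_derivative_continuous)

lemma continuous_extension:
  assumes "continuous_on {..0::real} f"
  shows "continuous_on UNIV (\<lambda>Z::real. f (min Z 0))"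
  by (rule continuous_on_compose2[OF assms]) (auto intro!: continuous_intros)

lemma l_continuous: "continuous_on UNIV l"
  unfolding l_def by (rule continuous_extension Ck_on_continuous lam_smooth)+

lemma m_continuous: "continuous_on UNIV m"
  unfolding m_def by (rule continuous_extension Ck_on_continuous mu_smooth)+

lemma sg_continuous: "continuous_on UNIV sg"
  unfolding sg_def by (intro continuous_intros l_continuous m_continuous)

lemma m_ge: "m Z \<ge> alpha0" unfolding m_def by (rule mu_ge) simp

lemma m_pos: "m Z > 0" using m_ge[of Z] alpha0 by linarith

lemma bulk_pos: "2 * m Z + 3 * l Z > 0"
  using bulk_ge[of "min Z 0"] beta0 by (simp add: m_def l_def)

lemma sg_pos: "sg Z > 0" using m_pos[of Z] bulk_pos[of Z] by (simp add: sg_def)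

lemma l_eq: "Z \<le> 0 \<Longrightarrow> l Z = lam Z" by (simp add: l_def)
lemma m_eq: "Z \<le> 0 \<Longrightarrow> m Z = mu Z" by (simp add: m_def)

lemma m_nz: "(of_real (m Z) :: complex) \<noteq> 0" using m_pos[of Z] by simp
lemma sg_nz: "(of_real (sg Z) :: complex) \<noteq> 0" using sg_pos[of Z] by simp

text \<open>The coefficients are given as constant only strictly below \<open>-H\<close>; continuity
  adds the endpoint, where the Jost data are prescribed.\<close>

lemma constant_below:
  fixes f :: "real \<Rightarrow> real"
  assumes "continuous_on UNIV f" "\<And>Z. Z < - H \<Longrightarrow> f Z = c" "Z \<le> - H"
  shows "f Z = c"
  using continuous_constant_on_closure[of "{..<-H}" f c Z] assms
  by (auto intro: continuous_on_subset)

lemma l_below: "Z \<le> - H \<Longrightarrow> l Z = lam0"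
  by (rule constant_below[OF l_continuous]) (use lam_const H in \<open>auto simp: l_def\<close>)

lemma m_below: "Z \<le> - H \<Longrightarrow> m Z = mu0"
  by (rule constant_below[OF m_continuous]) (use mu_const H in \<open>auto simp: m_def\<close>)

lemma sg_below: "Z \<le> - H \<Longrightarrow> sg Z = sigma"
  by (simp add: sg_def sigma0_def l_below m_below)

lemma mu0_pos: "mu0 > 0" using m_pos[of "-H"] m_below[of "-H"] by simp
text \<open>The bulk bound gives lam0 > -(2/3) mu0, hence sigma > (4/3) mu0. So the two wave speeds
  differ, and q_P and q_S never vanish together.\<close>

lemma mu0_less_sigma: "mu0 < sigma"
  using bulk_pos[of "-H"] mu0_pos l_below[of "-H"] m_below[of "-H"] by (simp add: sigma0_def)
lemma sigma_pos: "sigma > 0" using mu0_pos mu0_less_sigma by linarith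

lemma l_differentiable: "Z < 0 \<Longrightarrow> \<exists>d. (l has_vector_derivative d) (at Z)"
  and m_differentiable: "Z < 0 \<Longrightarrow> \<exists>d. (m has_vector_derivative d) (at Z)"
proof -
  assume Z: "Z < 0"
  have *: "\<exists>d. (g has_vector_derivative d) (at Z)"
    if f: "Ck_on 3 f {..0}" "\<And>Z. Z \<le> 0 \<Longrightarrow> g Z = f Z" for f g :: "real \<Rightarrow> real"
  proof -
    obtain d where "(f has_vector_derivative d) (at Z)" using Ck_on_differentiable[OF f(1) Z] by blast
    then have "(g has_vector_derivative d) (at Z)"
      by (rule has_vector_derivative_transform_within_open[where S = "{..<0}"]) (use Z f(2) in auto)
    then show ?thesis by blast
  qed
  show "\<exists>d. (l has_vector_derivative d) (at Z)" by (rule *[OF lam_smooth l_eq])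
  show "\<exists>d. (m has_vector_derivative d) (at Z)" by (rule *[OF mu_smooth m_eq])
qed

subsection \<open>The first-order system\<close>

text \<open>
  The state is $(\psi_1, \psi_2, t_1, t_2)$ with $t = P \psi' - \xi N^T \psi$; at $Z = 0^-$ one has
  $\hat b = t_1$ and $\hat a = i t_2$. No derivative of the coefficients enters.
\<close>

definition sysmat :: "4 \<Rightarrow> 4 \<Rightarrow> real \<Rightarrow> complex \<Rightarrow> complex" where
  "sysmat i j Z \<xi> = quad
     (quad 0 \<xi> (of_real (1 / m Z)) 0 j)
     (quad (- \<xi> * of_real (l Z / sg Z)) 0 0 (of_real (1 / sg Z)) j)
     (quad (\<xi>\<^sup>2 * of_real (sg Z) - (of_real \<omega>)\<^sup>2 - \<xi>\<^sup>2 * of_real (l Z ^ 2 / sg Z)) 0 0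
           (\<xi> * of_real (l Z / sg Z)) j)
     (quad 0 (- (of_real \<omega>)\<^sup>2) (- \<xi>) 0 j) i"

lemma sysmat_poly_family: "sysmat i j \<in> poly_family"
proof -
  have nz: "m Z \<noteq> 0" "sg Z \<noteq> 0" for Z using m_pos[of Z] sg_pos[of Z] by auto
  have "\<forall>i j. sysmat i j \<in> poly_family"
    unfolding forall_4 sysmat_def quad_simps
    by (intro conjI poly_family_intros continuous_intros continuous_on_of_real
        l_continuous m_continuous sg_continuous) (auto simp: nz)
  then show ?thesis by blast
qed

text \<open>Derivatives within S accommodate both half-lines that occur: the closed one
  \<open>{..-H}\<close> of the explicit exponentials and the open one \<open>{..<0}\<close> of
  Rayleigh solutions.\<close>

definition solves :: "real set \<Rightarrow> complex \<Rightarrow> (4 \<Rightarrow> real \<Rightarrow> complex) \<Rightarrow> bool" where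
  "solves S \<xi> y \<longleftrightarrow> (\<forall>Z\<in>S. \<forall>i.
     (y i has_vector_derivative (\<Sum>j\<in>UNIV. sysmat i j Z \<xi> * y j Z)) (at Z within S))"

text \<open>The derivatives of the two displacements, recovered from displacement and traction by
  inverting P.\<close>

definition slope1 :: "complex \<Rightarrow> (4 \<Rightarrow> real \<Rightarrow> complex) \<Rightarrow> real \<Rightarrow> complex" where
  "slope1 \<xi> y Z = y 3 Z / of_real (m Z) + \<xi> * y 2 Z"
definition slope2 :: "complex \<Rightarrow> (4 \<Rightarrow> real \<Rightarrow> complex) \<Rightarrow> real \<Rightarrow> complex" where
  "slope2 \<xi> y Z = (y 4 Z - \<xi> * of_real (l Z) * y 1 Z) / of_real (sg Z)"

lemma solves_iff:
  "solves S \<xi> y \<longleftrightarrow> (\<forall>Z\<in>S.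
     (y 1 has_vector_derivative slope1 \<xi> y Z) (at Z within S) \<and>
     (y 2 has_vector_derivative slope2 \<xi> y Z) (at Z within S) \<and>
     (y 3 has_vector_derivative \<xi> * of_real (l Z) * slope2 \<xi> y Z
        - ((of_real \<omega>)\<^sup>2 - \<xi>\<^sup>2 * of_real (sg Z)) * y 1 Z) (at Z within S) \<and>
     (y 4 has_vector_derivative - \<xi> * y 3 Z - (of_real \<omega>)\<^sup>2 * y 2 Z) (at Z within S))"
proof -
  have "(\<Sum>j\<in>UNIV. sysmat 1 j Z \<xi> * y j Z) = slope1 \<xi> y Z"
    "(\<Sum>j\<in>UNIV. sysmat 2 j Z \<xi> * y j Z) = slope2 \<xi> y Z"
    "(\<Sum>j\<in>UNIV. sysmat 3 j Z \<xi> * y j Z) = \<xi> * of_real (l Z) * slope2 \<xi> y Z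
        - ((of_real \<omega>)\<^sup>2 - \<xi>\<^sup>2 * of_real (sg Z)) * y 1 Z"
    "(\<Sum>j\<in>UNIV. sysmat 4 j Z \<xi> * y j Z) = - \<xi> * y 3 Z - (of_real \<omega>)\<^sup>2 * y 2 Z" for Z
    using m_nz[of Z] sg_nz[of Z]
    by (simp_all add: sum_4 sysmat_def slope1_def slope2_def field_simps power2_eq_square)
  then show ?thesis by (simp add: solves_def forall_4)
qed

lemma solves_subset: "solves S \<xi> y \<Longrightarrow> T \<subseteq> S \<Longrightarrow> solves T \<xi> y"
  unfolding solves_def by (meson has_vector_derivative_within_subset subsetD)

lemma solves_combination:
  assumes "\<And>k. k \<in> K \<Longrightarrow> solves S \<xi> (y k)"
  shows "solves S \<xi> (\<lambda>i Z. \<Sum>k\<in>K. c k * y k i Z)"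
  unfolding solves_def
proof (intro ballI allI)
  fix Z i assume Z: "Z \<in> S"
  have "((\<lambda>Z. \<Sum>k\<in>K. c k * y k i Z) has_vector_derivative
      (\<Sum>k\<in>K. c k * (\<Sum>j\<in>UNIV. sysmat i j Z \<xi> * y k j Z))) (at Z within S)"
    using assms Z unfolding solves_def
    by (intro has_vector_derivative_sum has_vector_derivative_mult_right) auto
  also have "(\<Sum>k\<in>K. c k * (\<Sum>j\<in>UNIV. sysmat i j Z \<xi> * y k j Z))
      = (\<Sum>j\<in>UNIV. sysmat i j Z \<xi> * (\<Sum>k\<in>K. c k * y k j Z))"
    unfolding sum_distrib_left by (subst sum.swap) (simp add: mult_ac)
  finally show "((\<lambda>Z. \<Sum>k\<in>K. c k * y k i Z) has_vector_derivative
      (\<Sum>j\<in>UNIV. sysmat i j Z \<xi> * (\<Sum>k\<in>K. c k * y k j Z))) (at Z within S)" .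
qed

section \<open>Conserved symplectic form, fundamental matrix and uniqueness\<close>

definition wronskian :: "(4 \<Rightarrow> real \<Rightarrow> complex) \<Rightarrow> (4 \<Rightarrow> real \<Rightarrow> complex) \<Rightarrow> real \<Rightarrow> complex" where
  "wronskian x y Z = x 1 Z * y 3 Z + x 2 Z * y 4 Z - x 3 Z * y 1 Z - x 4 Z * y 2 Z"

text \<open>The system is Hamiltonian for complex \<xi> as well, because the form is bilinear and
  not sesquilinear; all terms of the derivative cancel in pairs.\<close>

lemma wronskian_eq:
  assumes x: "solves S \<xi> x" and y: "solves S \<xi> y" and "convex S" "c \<in> S" "d \<in> S"
  shows "wronskian x y c = wronskian x y d"
proof -
  have "(wronskian x y has_vector_derivative 0) (at Z within S)" if "Z \<in> S" for Z
  proof -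
    note dx = x[unfolded solves_iff, rule_format, OF that]
    note dy = y[unfolded solves_iff, rule_format, OF that]
    have prods: "((\<lambda>Z. p Z * q Z) has_vector_derivative p Z * q' + p' * q Z) (at Z within S)"
      if "(p has_vector_derivative p') (at Z within S)" "(q has_vector_derivative q') (at Z within S)"
      for p q :: "real \<Rightarrow> complex" and p' q' using has_vector_derivative_mult[OF that] .
    have "(wronskian x y has_vector_derivative
       (x 1 Z * (\<xi> * of_real (l Z) * slope2 \<xi> y Z - ((of_real \<omega>)\<^sup>2 - \<xi>\<^sup>2 * of_real (sg Z)) * y 1 Z)
         + slope1 \<xi> x Z * y 3 Z)
       + (x 2 Z * (- \<xi> * y 3 Z - (of_real \<omega>)\<^sup>2 * y 2 Z) + slope2 \<xi> x Z * y 4 Z)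
       - (x 3 Z * slope1 \<xi> y Z
         + (\<xi> * of_real (l Z) * slope2 \<xi> x Z - ((of_real \<omega>)\<^sup>2 - \<xi>\<^sup>2 * of_real (sg Z)) * x 1 Z) * y 1 Z)
       - (x 4 Z * slope2 \<xi> y Z + (- \<xi> * x 3 Z - (of_real \<omega>)\<^sup>2 * x 2 Z) * y 2 Z)) (at Z within S)"
      unfolding wronskian_def using dx dy
      by (intro has_vector_derivative_add has_vector_derivative_diff prods) auto
    moreover have "(x 1 Z * (\<xi> * of_real (l Z) * slope2 \<xi> y Z - ((of_real \<omega>)\<^sup>2 - \<xi>\<^sup>2 * of_real (sg Z)) * y 1 Z)
         + slope1 \<xi> x Z * y 3 Z)
       + (x 2 Z * (- \<xi> * y 3 Z - (of_real \<omega>)\<^sup>2 * y 2 Z) + slope2 \<xi> x Z * y 4 Z)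
       - (x 3 Z * slope1 \<xi> y Z
         + (\<xi> * of_real (l Z) * slope2 \<xi> x Z - ((of_real \<omega>)\<^sup>2 - \<xi>\<^sup>2 * of_real (sg Z)) * x 1 Z) * y 1 Z)
       - (x 4 Z * slope2 \<xi> y Z + (- \<xi> * x 3 Z - (of_real \<omega>)\<^sup>2 * x 2 Z) * y 2 Z) = 0"
      using m_nz[of Z] sg_nz[of Z] unfolding slope1_def slope2_def
      by (simp add: divide_simps) (simp add: algebra_simps)
    ultimately show ?thesis by simp
  qed
  then show ?thesis
    using has_vector_derivative_zero_constant[OF \<open>convex S\<close>, of "wronskian x y"] assms(4,5) by metis
qed

text \<open>One choice is made for all \<xi> at once; choosing separately for each \<xi> would give
  no hold on holomorphy.\<close>

definition fund :: "real \<Rightarrow> 4 \<Rightarrow> 4 \<Rightarrow> real \<Rightarrow> complex \<Rightarrow> complex" where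
  "fund c k = (SOME y. (\<forall>i \<xi>. y i c \<xi> = (if i = k then 1 else 0)) \<and>
     (\<forall>i Z \<xi>. ((\<lambda>Z. y i Z \<xi>) has_vector_derivative (\<Sum>j\<in>UNIV. sysmat i j Z \<xi> * y j Z \<xi>)) (at Z)) \<and>
     (\<forall>i Z. (\<lambda>\<xi>. y i Z \<xi>) holomorphic_on UNIV))"

lemma fund_init: "fund c k i c \<xi> = (if i = k then 1 else 0)"
  and fund_solves: "solves UNIV \<xi> (\<lambda>i Z. fund c k i Z \<xi>)"
  and fund_holomorphic: "(\<lambda>\<xi>. fund c k i Z \<xi>) holomorphic_on UNIV"
  using someI_ex[OF linear_system_holomorphic_solution[of sysmat c "\<lambda>i. if i = k then 1 else 0", OF sysmat_poly_family]]
  unfolding fund_def[symmetric] solves_def by blast+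

definition flow :: "real \<Rightarrow> (4 \<Rightarrow> complex) \<Rightarrow> complex \<Rightarrow> 4 \<Rightarrow> real \<Rightarrow> complex" where
  "flow c e \<xi> i Z = (\<Sum>k\<in>UNIV. e k * fund c k i Z \<xi>)"

lemma flow_init [simp]: "flow c e \<xi> i c = e i"
  by (simp add: flow_def fund_init if_distrib cong: if_cong)

lemma flow_solves: "solves S \<xi> (flow c e \<xi>)"
  unfolding flow_def[abs_def]
  by (rule solves_subset[where S = UNIV]) (auto intro: solves_combination fund_solves)

text \<open>The pairing of y with any solution vanishes at c, hence at d. Solutions starting at d
  from the unit vectors read off every component of y there, since the form is
  nondegenerate.\<close>

lemma solves_unique_zero:
  assumes y: "solves S \<xi> y" "convex S" "c \<in> S" "d \<in> S" and zero: "\<And>i. y i c = 0"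
  shows "y i d = 0"
proof -
  have "wronskian y (flow d e \<xi>) d = 0" for e
    using wronskian_eq[OF y(1) flow_solves y(2,3,4), of d e] zero by (simp add: wronskian_def)
  from this[of "quad 0 0 1 0"] this[of "quad 0 0 0 1"] this[of "quad 1 0 0 0"] this[of "quad 0 1 0 0"]
  have "\<forall>i. y i d = 0" by (simp add: wronskian_def forall_4)
  then show ?thesis by blast
qed

lemma solves_unique:
  assumes x: "solves S \<xi> x" and y: "solves S \<xi> y" and "convex S" "c \<in> S" "d \<in> S" and eq: "\<And>i. x i c = y i c"
  shows "x i d = y i d"
proof -
  have "solves S \<xi> (\<lambda>i Z. \<Sum>k\<in>UNIV. (if k then 1 else -1) * (if k then x else y) i Z)"
    using x y by (intro solves_combination) auto
  then have "solves S \<xi> (\<lambda>i Z. x i Z - y i Z)" by (simp add: UNIV_bool)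
  from solves_unique_zero[OF this assms(3-5)] eq show ?thesis by simp
qed

end

subsection \<open>The Rayleigh operator and the system\<close>

context rayleigh begin

text \<open>The operator is t' + \<xi> N \<psi>' + (\<omega>^2 - \<xi>^2 M) \<psi>, with t the
  traction. Below 0 the coefficients are differentiable, so the products in t can be differentiated
  one by one and regrouped.\<close>

lemma rayleigh_op_components:
  assumes Z: "Z < 0" and \<psi>: "\<psi> differentiable (at Z)" "vderiv \<psi> differentiable (at Z)"
  obtains d3 d4 where
    "((\<lambda>z. of_real (m z) * vderiv \<psi> z $ 1 - \<xi> * of_real (m z) * \<psi> z $ 2) has_vector_derivative d3) (at Z)"
    "((\<lambda>z. of_real (sg z) * vderiv \<psi> z $ 2 + \<xi> * of_real (l z) * \<psi> z $ 1) has_vector_derivative d4) (at Z)"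
    "rayleigh_op \<omega> lam mu \<xi> \<psi> Z = vector
      [d3 - \<xi> * of_real (l Z) * vderiv \<psi> Z $ 2 + ((of_real \<omega>)\<^sup>2 - \<xi>\<^sup>2 * of_real (sg Z)) * \<psi> Z $ 1,
       d4 + \<xi> * of_real (m Z) * vderiv \<psi> Z $ 1 + ((of_real \<omega>)\<^sup>2 - \<xi>\<^sup>2 * of_real (m Z)) * \<psi> Z $ 2]"
proof -
  obtain l' m' where l': "(l has_vector_derivative l') (at Z)" and m': "(m has_vector_derivative m') (at Z)"
    using l_differentiable[OF Z] m_differentiable[OF Z] by blast
  have sg': "(sg has_vector_derivative l' + 2 * m') (at Z)"
    unfolding sg_def[abs_def] by (intro has_vector_derivative_add has_vector_derivative_mult_right l' m')
  have cx: "((\<lambda>z. of_real (f z) :: complex) has_vector_derivative of_real f') (at Z)"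
    if "(f has_vector_derivative f') (at Z)" for f f' using has_vector_derivative_of_real[of f] that by (simp add: has_real_derivative_iff_has_vector_derivative)
  have d: "(\<lambda>z. of_real (f z) * g z $ i) differentiable (at Z)"
    if "(f has_vector_derivative f') (at Z)" "g differentiable (at Z)"
    for f f' and g :: "real \<Rightarrow> complex^2" and i
    using has_vector_derivative_mult[OF cx[OF that(1)] has_vector_derivative_vec_nth[OF vderiv_works[OF that(2)]]]
    by (auto intro: differentiableI_vector)
  define a1 a2 b1 b2 where "a1 = vderiv (\<lambda>z. of_real (m z) * vderiv \<psi> z $ 1) Z"
    and "a2 = vderiv (\<lambda>z. of_real (sg z) * vderiv \<psi> z $ 2) Z"
    and "b1 = vderiv (\<lambda>z. of_real (m z) * \<psi> z $ 2) Z"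
    and "b2 = vderiv (\<lambda>z. of_real (l z) * \<psi> z $ 1) Z"
  have a1: "((\<lambda>z. of_real (m z) * vderiv \<psi> z $ 1) has_vector_derivative a1) (at Z)"
    and a2: "((\<lambda>z. of_real (sg z) * vderiv \<psi> z $ 2) has_vector_derivative a2) (at Z)"
    and b1: "((\<lambda>z. of_real (m z) * \<psi> z $ 2) has_vector_derivative b1) (at Z)"
    and b2: "((\<lambda>z. of_real (l z) * \<psi> z $ 1) has_vector_derivative b2) (at Z)"
    unfolding a1_def a2_def b1_def b2_def
    by (intro vderiv_works d[OF m' \<psi>(2)] d[OF sg' \<psi>(2)] d[OF m' \<psi>(1)] d[OF l' \<psi>(1)])+
  have "((\<lambda>z. P_mat lam mu z *v vderiv \<psi> z) has_vector_derivative vector [a1, a2]) (at Z)"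
    by (rule has_vector_derivative_transform_within_open[OF has_vector_derivative_vector_2[OF a1 a2], of "{..<0}"])
       (use Z in \<open>auto simp: vec_eq_iff forall_2 P_mat_def matrix_vector_mult_def sum_2 l_eq m_eq sg_def\<close>)
  note P = vderivI[OF this]
  have "((\<lambda>z. transpose (N_mat lam mu z) *v \<psi> z) has_vector_derivative vector [b1, - b2]) (at Z)"
    by (rule has_vector_derivative_transform_within_open[OF has_vector_derivative_vector_2[OF b1 has_vector_derivative_minus[OF b2]], of "{..<0}"])
       (use Z in \<open>auto simp: vec_eq_iff forall_2 N_mat_def matrix_vector_mult_def sum_2 l_eq m_eq transpose_def\<close>)
  note N = vderivI[OF this]
  show thesis
  proof (rule that)
    show "((\<lambda>z. of_real (m z) * vderiv \<psi> z $ 1 - \<xi> * of_real (m z) * \<psi> z $ 2) has_vector_derivative a1 - \<xi> * b1) (at Z)"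
      using has_vector_derivative_diff[OF a1 has_vector_derivative_mult_right[OF b1, of \<xi>]] by (simp add: mult.assoc)
    show "((\<lambda>z. of_real (sg z) * vderiv \<psi> z $ 2 + \<xi> * of_real (l z) * \<psi> z $ 1) has_vector_derivative a2 + \<xi> * b2) (at Z)"
      using has_vector_derivative_add[OF a2 has_vector_derivative_mult_right[OF b2, of \<xi>]] by (simp add: mult.assoc)
    show "rayleigh_op \<omega> lam mu \<xi> \<psi> Z = vector
      [a1 - \<xi> * b1 - \<xi> * of_real (l Z) * vderiv \<psi> Z $ 2 + ((of_real \<omega>)\<^sup>2 - \<xi>\<^sup>2 * of_real (sg Z)) * \<psi> Z $ 1,
       a2 + \<xi> * b2 + \<xi> * of_real (m Z) * vderiv \<psi> Z $ 1 + ((of_real \<omega>)\<^sup>2 - \<xi>\<^sup>2 * of_real (m Z)) * \<psi> Z $ 2]"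
      unfolding rayleigh_op_def P N using Z
      by (simp add: vec_eq_iff forall_2 M_mat_def N_mat_def matrix_vector_mult_def sum_2 l_eq m_eq sg_def
          algebra_simps)
  qed
qed

definition displacement :: "(4 \<Rightarrow> real \<Rightarrow> complex) \<Rightarrow> real \<Rightarrow> complex^2" where
  "displacement y Z = vector [y 1 Z, y 2 Z]"

definition state :: "complex \<Rightarrow> (real \<Rightarrow> complex^2) \<Rightarrow> 4 \<Rightarrow> real \<Rightarrow> complex" where
  "state \<xi> \<psi> i Z = quad (\<psi> Z $ 1) (\<psi> Z $ 2)
     (of_real (m Z) * vderiv \<psi> Z $ 1 - \<xi> * of_real (m Z) * \<psi> Z $ 2)
     (of_real (sg Z) * vderiv \<psi> Z $ 2 + \<xi> * of_real (l Z) * \<psi> Z $ 1) i"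

lemma state_simps:
  "state \<xi> \<psi> 1 = (\<lambda>Z. \<psi> Z $ 1)" "state \<xi> \<psi> 2 = (\<lambda>Z. \<psi> Z $ 2)"
  "state \<xi> \<psi> 3 = (\<lambda>Z. of_real (m Z) * vderiv \<psi> Z $ 1 - \<xi> * of_real (m Z) * \<psi> Z $ 2)"
  "state \<xi> \<psi> 4 = (\<lambda>Z. of_real (sg Z) * vderiv \<psi> Z $ 2 + \<xi> * of_real (l Z) * \<psi> Z $ 1)"
  by (simp_all add: state_def fun_eq_iff)

lemma slope_state:
  "slope1 \<xi> (state \<xi> \<psi>) Z = vderiv \<psi> Z $ 1" "slope2 \<xi> (state \<xi> \<psi>) Z = vderiv \<psi> Z $ 2"
  using m_nz[of Z] sg_nz[of Z] by (simp_all add: slope1_def slope2_def state_simps field_simps)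

lemma rayleigh_solution_solves:
  assumes "rayleigh_solution \<omega> lam mu \<xi> \<psi>"
  shows "solves {..<0} \<xi> (state \<xi> \<psi>)"
  unfolding solves_iff
proof
  fix Z :: real assume "Z \<in> {..<0}"
  then have Z: "Z < 0" by simp
  have \<psi>: "\<psi> differentiable (at Z)" "vderiv \<psi> differentiable (at Z)" "rayleigh_op \<omega> lam mu \<xi> \<psi> Z = 0"
    using assms Z unfolding rayleigh_solution_def by auto
  obtain d3 d4 where d:
    "((\<lambda>z. of_real (m z) * vderiv \<psi> z $ 1 - \<xi> * of_real (m z) * \<psi> z $ 2) has_vector_derivative d3) (at Z)"
    "((\<lambda>z. of_real (sg z) * vderiv \<psi> z $ 2 + \<xi> * of_real (l z) * \<psi> z $ 1) has_vector_derivative d4) (at Z)"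
    "rayleigh_op \<omega> lam mu \<xi> \<psi> Z = vector
      [d3 - \<xi> * of_real (l Z) * vderiv \<psi> Z $ 2 + ((of_real \<omega>)\<^sup>2 - \<xi>\<^sup>2 * of_real (sg Z)) * \<psi> Z $ 1,
       d4 + \<xi> * of_real (m Z) * vderiv \<psi> Z $ 1 + ((of_real \<omega>)\<^sup>2 - \<xi>\<^sup>2 * of_real (m Z)) * \<psi> Z $ 2]"
    by (rule rayleigh_op_components[OF Z \<psi>(1,2)])
  have d3: "d3 = \<xi> * of_real (l Z) * vderiv \<psi> Z $ 2 - ((of_real \<omega>)\<^sup>2 - \<xi>\<^sup>2 * of_real (sg Z)) * \<psi> Z $ 1"
    and d4: "d4 = - \<xi> * (of_real (m Z) * vderiv \<psi> Z $ 1 - \<xi> * of_real (m Z) * \<psi> Z $ 2) - (of_real \<omega>)\<^sup>2 * \<psi> Z $ 2"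
    using d(3) \<psi>(3) by (simp_all add: vec_eq_iff forall_2 algebra_simps power2_eq_square add_eq_0_iff)
  have \<psi>': "(\<psi> has_vector_derivative vderiv \<psi> Z) (at Z)" by (rule vderiv_works[OF \<psi>(1)])
  have w: "(f has_vector_derivative f') (at Z) \<Longrightarrow> (f has_vector_derivative f') (at Z within {..<0})"
    for f :: "real \<Rightarrow> complex" and f' by (rule has_vector_derivative_at_within)
  show "(state \<xi> \<psi> 1 has_vector_derivative slope1 \<xi> (state \<xi> \<psi>) Z) (at Z within {..<0}) \<and>
     (state \<xi> \<psi> 2 has_vector_derivative slope2 \<xi> (state \<xi> \<psi>) Z) (at Z within {..<0}) \<and>
     (state \<xi> \<psi> 3 has_vector_derivative \<xi> * of_real (l Z) * slope2 \<xi> (state \<xi> \<psi>) Z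
        - ((of_real \<omega>)\<^sup>2 - \<xi>\<^sup>2 * of_real (sg Z)) * state \<xi> \<psi> 1 Z) (at Z within {..<0}) \<and>
     (state \<xi> \<psi> 4 has_vector_derivative - \<xi> * state \<xi> \<psi> 3 Z - (of_real \<omega>)\<^sup>2 * state \<xi> \<psi> 2 Z) (at Z within {..<0})"
    unfolding slope_state state_simps
    using d(1)[unfolded d3] d(2)[unfolded d4] \<psi>'
    by (intro conjI w) (auto intro: has_vector_derivative_vec_nth)
qed

lemma
  assumes y: "solves {..<0} \<xi> y"
  shows vderiv_displacement: "Z < 0 \<Longrightarrow> vderiv (displacement y) Z = vector [slope1 \<xi> y Z, slope2 \<xi> y Z]"
    and rayleigh_solution_displacement: "rayleigh_solution \<omega> lam mu \<xi> (displacement y)"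
proof -
  have at: "(f has_vector_derivative f') (at Z)"
    if "(f has_vector_derivative f') (at Z within {..<0})" "Z < 0" for f :: "real \<Rightarrow> complex" and f' Z
    using that(1) at_within_open[of Z "{..<0}"] that(2) by simp
  have dy: "(y 1 has_vector_derivative slope1 \<xi> y Z) (at Z)" "(y 2 has_vector_derivative slope2 \<xi> y Z) (at Z)"
     "(y 3 has_vector_derivative \<xi> * of_real (l Z) * slope2 \<xi> y Z
        - ((of_real \<omega>)\<^sup>2 - \<xi>\<^sup>2 * of_real (sg Z)) * y 1 Z) (at Z)"
     "(y 4 has_vector_derivative - \<xi> * y 3 Z - (of_real \<omega>)\<^sup>2 * y 2 Z) (at Z)" if "Z < 0" for Z
    using y[unfolded solves_iff, rule_format, of Z] that by (auto intro: at)
  have d: "(displacement y has_vector_derivative vector [slope1 \<xi> y Z, slope2 \<xi> y Z]) (at Z)" if "Z < 0" for Z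
    unfolding displacement_def[abs_def] by (rule has_vector_derivative_vector_2[OF dy(1,2)[OF that]])
  have v: "vderiv (displacement y) Z = vector [slope1 \<xi> y Z, slope2 \<xi> y Z]" if "Z < 0" for Z
    by (rule vderivI[OF d[OF that]])
  then show "Z < 0 \<Longrightarrow> vderiv (displacement y) Z = vector [slope1 \<xi> y Z, slope2 \<xi> y Z]" .
  show "rayleigh_solution \<omega> lam mu \<xi> (displacement y)"
    unfolding rayleigh_solution_def
  proof (intro allI impI)
    fix Z :: real assume Z: "Z < 0"
    obtain l' m' where l': "(l has_vector_derivative l') (at Z)" and m': "(m has_vector_derivative m') (at Z)"
      using l_differentiable[OF Z] m_differentiable[OF Z] by blast
    have sg': "(sg has_vector_derivative l' + 2 * m') (at Z)"
      unfolding sg_def[abs_def] by (intro has_vector_derivative_add has_vector_derivative_mult_right l' m')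
    have diff: "f differentiable (at Z)" if "(f has_vector_derivative f') (at Z)"
      for f :: "real \<Rightarrow> complex" and f' using that by (rule differentiableI_vector)
    have cdiff: "(\<lambda>z. of_real (f z) :: complex) differentiable (at Z)" if "(f has_vector_derivative f') (at Z)" for f f'
      using has_vector_derivative_of_real[of f] that
      by (intro diff) (simp add: has_real_derivative_iff_has_vector_derivative)
    \<comment> \<open>A first-order system yields only one derivative of the displacement. The
      second comes from the slopes, which are quotients of differentiable functions as long as Z <
      0.\<close>
    have "slope1 \<xi> y differentiable (at Z)" "slope2 \<xi> y differentiable (at Z)"
      unfolding slope1_def[abs_def] slope2_def[abs_def]
      by (intro derivative_intros cdiff[OF l'] cdiff[OF m'] cdiff[OF sg'] diff[OF dy(1)[OF Z]] diff[OF dy(2)[OF Z]]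
          diff[OF dy(3)[OF Z]] diff[OF dy(4)[OF Z]] m_nz sg_nz)+
    then obtain s1 s2 where s: "(slope1 \<xi> y has_vector_derivative s1) (at Z)" "(slope2 \<xi> y has_vector_derivative s2) (at Z)"
      using vector_derivative_works by blast
    have "(vderiv (displacement y) has_vector_derivative vector [s1, s2]) (at Z)"
      by (rule has_vector_derivative_transform_within_open[OF has_vector_derivative_vector_2[OF s], of "{..<0}"])
         (use Z v in auto)
    then have dd: "vderiv (displacement y) differentiable (at Z)" by (rule differentiableI_vector)
    have d0: "displacement y differentiable (at Z)" using d[OF Z] by (rule differentiableI_vector)
    obtain d3 d4 where e:
      "((\<lambda>z. of_real (m z) * vderiv (displacement y) z $ 1 - \<xi> * of_real (m z) * displacement y z $ 2) has_vector_derivative d3) (at Z)"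
      "((\<lambda>z. of_real (sg z) * vderiv (displacement y) z $ 2 + \<xi> * of_real (l z) * displacement y z $ 1) has_vector_derivative d4) (at Z)"
      "rayleigh_op \<omega> lam mu \<xi> (displacement y) Z = vector
        [d3 - \<xi> * of_real (l Z) * vderiv (displacement y) Z $ 2 + ((of_real \<omega>)\<^sup>2 - \<xi>\<^sup>2 * of_real (sg Z)) * displacement y Z $ 1,
         d4 + \<xi> * of_real (m Z) * vderiv (displacement y) Z $ 1 + ((of_real \<omega>)\<^sup>2 - \<xi>\<^sup>2 * of_real (m Z)) * displacement y Z $ 2]"
      by (rule rayleigh_op_components[OF Z d0 dd])
    have "((\<lambda>z. of_real (m z) * vderiv (displacement y) z $ 1 - \<xi> * of_real (m z) * displacement y z $ 2)
         has_vector_derivative \<xi> * of_real (l Z) * slope2 \<xi> y Z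
        - ((of_real \<omega>)\<^sup>2 - \<xi>\<^sup>2 * of_real (sg Z)) * y 1 Z) (at Z)"
      by (rule has_vector_derivative_transform_within_open[OF dy(3)[OF Z], of "{..<0}"])
         (use Z m_nz in \<open>auto simp: v displacement_def slope1_def field_simps\<close>)
    from vector_derivative_unique_at[OF e(1) this]
    have d3: "d3 = \<xi> * of_real (l Z) * slope2 \<xi> y Z - ((of_real \<omega>)\<^sup>2 - \<xi>\<^sup>2 * of_real (sg Z)) * y 1 Z" .
    have "((\<lambda>z. of_real (sg z) * vderiv (displacement y) z $ 2 + \<xi> * of_real (l z) * displacement y z $ 1)
         has_vector_derivative - \<xi> * y 3 Z - (of_real \<omega>)\<^sup>2 * y 2 Z) (at Z)"
      by (rule has_vector_derivative_transform_within_open[OF dy(4)[OF Z], of "{..<0}"])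
         (use Z sg_nz in \<open>auto simp: v displacement_def slope2_def field_simps\<close>)
    from vector_derivative_unique_at[OF e(2) this]
    have d4: "d4 = - \<xi> * y 3 Z - (of_real \<omega>)\<^sup>2 * y 2 Z" .
    have "\<xi> * of_real (m Z) * slope1 \<xi> y Z = \<xi> * y 3 Z + \<xi>\<^sup>2 * of_real (m Z) * y 2 Z"
      using m_nz[of Z] by (simp add: slope1_def field_simps power2_eq_square)
    then have "rayleigh_op \<omega> lam mu \<xi> (displacement y) Z = 0"
      unfolding e(3) d3 d4 by (simp add: v[OF Z] displacement_def vec_eq_iff forall_2 algebra_simps)
    with d0 dd show "displacement y differentiable (at Z) \<and> vderiv (displacement y) differentiable (at Z) \<and>
       rayleigh_op \<omega> lam mu \<xi> (displacement y) Z = 0" by blast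
  qed
qed

lemma at_0_minus_eqI:
  assumes "\<forall>\<^sub>F Z in at_left 0. f Z = g Z" "isCont g (0::real)"
  shows "at_0_minus f = g 0"
proof -
  have "(g \<longlongrightarrow> g 0) (at_left 0)"
    using assms(2) unfolding isCont_def by (rule filterlim_mono) (auto simp: at_within_le_at)
  then have "(f \<longlongrightarrow> g 0) (at_left 0)"
    by (rule Lim_transform_eventually) (use assms(1) in \<open>auto elim: eventually_mono\<close>)
  then show ?thesis unfolding at_0_minus_def by (intro tendsto_Lim) auto
qed

lemma solves_isCont: "solves UNIV \<xi> y \<Longrightarrow> isCont (y i) Z"
  unfolding solves_def by (metis UNIV_I has_vector_derivative_continuous)

text \<open>Since y solves the extended system across 0, the one-sided limits are plain values of y
  at 0. Agreement just below 0 is all that is asked, because a column of the kernel is a single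
  solution only above \<open>Z'\<close>.\<close>

lemma tractions:
  assumes y: "solves UNIV \<xi> y" and "c < 0" and eq: "\<And>Z. c < Z \<Longrightarrow> Z < 0 \<Longrightarrow> \<psi> Z = displacement y Z"
  shows "a_hat lam mu \<xi> \<psi> = \<i> * y 4 0" "b_hat mu \<xi> \<psi> = y 3 0"
proof -
  have y0: "solves {..<0} \<xi> y" by (rule solves_subset[OF y]) simp
  have ev: "\<forall>\<^sub>F Z in at_left 0. c < Z \<and> Z < 0"
    using \<open>c < 0\<close> eventually_at_left_real by auto
  have cl: "isCont l 0" and cm: "isCont m 0"  and cs: "isCont sg 0"
    using l_continuous m_continuous sg_continuous by (auto simp: continuous_on_eq_continuous_at)
  have lam: "at_0_minus lam = l 0" and mu: "at_0_minus mu = m 0"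
    by (rule at_0_minus_eqI[OF eventually_mono[OF ev]]; simp add: l_eq m_eq cl cm)+
  have p: "at_0_minus (\<lambda>Z. \<psi> Z $ 1) = y 1 0" "at_0_minus (\<lambda>Z. \<psi> Z $ 2) = y 2 0"
    by (rule at_0_minus_eqI[OF eventually_mono[OF ev]]; simp add: eq displacement_def solves_isCont[OF y])+
  have v: "vderiv \<psi> Z = vector [slope1 \<xi> y Z, slope2 \<xi> y Z]" if "c < Z" "Z < 0" for Z
  proof -
    have "displacement y differentiable (at Z)"
      using rayleigh_solution_displacement[OF y0] that unfolding rayleigh_solution_def by blast
    then have "(\<psi> has_vector_derivative vderiv (displacement y) Z) (at Z)"
      by (intro has_vector_derivative_transform_within_open[OF vderiv_works, of "displacement y" Z "{c<..<0}"])
         (use that eq in auto)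
    then show ?thesis using vderivI vderiv_displacement[OF y0 that(2)] by metis
  qed
  have v1: "at_0_minus (\<lambda>Z. vderiv \<psi> Z $ 1) = slope1 \<xi> y 0"
    using m_pos[of 0] sg_pos[of 0]
    by (intro at_0_minus_eqI eventually_mono[OF ev])
       (auto simp: v slope1_def[abs_def] intro!: continuous_intros cm solves_isCont[OF y])
  have v2: "at_0_minus (\<lambda>Z. vderiv \<psi> Z $ 2) = slope2 \<xi> y 0"
    using m_pos[of 0] sg_pos[of 0]
    by (intro at_0_minus_eqI eventually_mono[OF ev])
       (auto simp: v slope2_def[abs_def] intro!: continuous_intros cl cs solves_isCont[OF y])
  have "of_real (l 0 + 2 * m 0) = (of_real (sg 0) :: complex)" by (simp add: sg_def)
  then show "a_hat lam mu \<xi> \<psi> = \<i> * y 4 0"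
    unfolding a_hat_def lam mu p v1 v2 using sg_nz[of 0] by (simp add: slope2_def field_simps)
  show "b_hat mu \<xi> \<psi> = y 3 0"
    unfolding b_hat_def lam mu p v1 v2 using m_nz[of 0] by (simp add: slope1_def field_simps)
qed

end

subsection \<open>Jost solutions\<close>

text \<open>
  The rows of a left inverse of the matrix with columns $x_1, x_2, b_1, b_2$ are combinations of their
  symplectic duals; the identity below is the statement that it is also a right inverse.
\<close>

lemma symplectic_completeness:
  fixes x b :: "2 \<Rightarrow> 4 \<Rightarrow> complex"
  defines "w \<equiv> \<lambda>u v :: 4 \<Rightarrow> complex. u 1 * v 3 + u 2 * v 4 - u 3 * v 1 - u 4 * v 2"
    and "om \<equiv> \<lambda>u :: 4 \<Rightarrow> complex. quad (- u 3) (- u 4) (u 1) (u 2)"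
  assumes lag: "w (x 1) (x 2) = 0" "w (b 1) (b 2) = 0"
    and a: "a 1 1 = w (x 2) (b 2)" "a 1 2 = - w (x 2) (b 1)" "a 2 1 = - w (x 1) (b 2)" "a 2 2 = w (x 1) (b 1)"
    and d: "d = w (x 1) (b 1) * w (x 2) (b 2) - w (x 2) (b 1) * w (x 1) (b 2)" "d \<noteq> 0"
  shows "(\<Sum>k\<in>UNIV. \<Sum>r\<in>UNIV. a k r * (b r i * om (x k) j - x k i * om (b r) j)) = (if i = j then d else 0)"
proof -
  define \<Psi> :: "complex^4^4" where "\<Psi> = (\<chi> i c. quad (x 1 i) (x 2 i) (b 1 i) (b 2 i) c)"
  define X :: "complex^4^4" where "X = (\<chi> c j. quad
     (- a 1 1 * om (b 1) j - a 1 2 * om (b 2) j) (- a 2 1 * om (b 1) j - a 2 2 * om (b 2) j)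
     (a 1 1 * om (x 1) j + a 2 1 * om (x 2) j) (a 1 2 * om (x 1) j + a 2 2 * om (x 2) j) c / d)"
  \<comment> \<open>Summing \<open>om u j * y j\<close> over j gives \<open>w u y\<close>; the
    entries of \<open>X ** \<Psi>\<close> thereby become pairings, known from the
    hypotheses.\<close>
  have lin: "(\<Sum>j\<in>UNIV. (p * om u j + q * om v j) / d * y j) = (p * w u y + q * w v y) / d"
    for p q u v and y :: "4 \<Rightarrow> complex"
    by (simp add: sum_4 om_def w_def add_divide_distrib diff_divide_distrib algebra_simps)
  have lin': "(\<Sum>j\<in>UNIV. (- p * om u j - q * om v j) / d * y j) = (- p * w u y - q * w v y) / d"
    for p q u v and y :: "4 \<Rightarrow> complex"
    using lin[of "- p" u "- q" v y] by simp
  have anti: "w u v = - w v u" for u v by (simp add: w_def)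
  have self: "w u u = 0" for u by (simp add: w_def)
  have "X ** \<Psi> = mat 1"
    unfolding vec_eq_iff forall_4 matrix_matrix_mult_def X_def \<Psi>_def mat_def vec_lambda_beta quad_simps lin lin'
    using lag d(2) anti[of "b 1" "x 1"] anti[of "b 1" "x 2"] anti[of "b 2" "x 1"] anti[of "b 2" "x 2"]
      anti[of "b 2" "b 1"] anti[of "x 2" "x 1"]
    by (simp add: a self) (simp add: d(1) algebra_simps)
  then have "\<Psi> ** X = mat 1" by (simp add: matrix_left_right_inverse)
  then have "(\<Psi> ** X) $ i $ j = (if i = j then 1 else 0)" by (simp add: mat_def)
  moreover have "(\<Psi> ** X) $ i $ j * d = (\<Sum>k\<in>UNIV. \<Sum>r\<in>UNIV. a k r * (b r i * om (x k) j - x k i * om (b r) j))"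
    using d(2) by (simp add: matrix_matrix_mult_def \<Psi>_def X_def sum_4 sum_2 distrib_right)
      (simp add: algebra_simps)
  ultimately show ?thesis by (simp split: if_splits)
qed

context rayleigh begin

definition qv :: "2 \<Rightarrow> point \<Rightarrow> complex" where
  "qv k p = (if k = 1 then fst (snd p) else snd (snd p))"

text \<open>The states of the minus-sign P and S waves in the homogeneous half-space, without the
  exponential. The dispersion relation has been used to remove q^2, so each entry has degree at most
  one in q.\<close>

definition amp :: "2 \<Rightarrow> point \<Rightarrow> 4 \<Rightarrow> complex" where
  "amp k p = (if k = 1
     then quad (- fst p) (- \<i> * qv 1 p) (2 * \<i> * of_real mu0 * fst p * qv 1 p)
            (2 * of_real mu0 * (fst p)\<^sup>2 - (of_real \<omega>)\<^sup>2)
     else quad (- \<i> * qv 2 p) (- fst p) (2 * of_real mu0 * (fst p)\<^sup>2 - (of_real \<omega>)\<^sup>2)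
            (2 * \<i> * of_real mu0 * fst p * qv 2 p))"

text \<open>Started at \<open>-H\<close>, where the state is explicit: the factor is exp(-i Z q) at
  Z = -H. All other dependence on the point goes through the entire flow.\<close>

definition jst :: "2 \<Rightarrow> point \<Rightarrow> 4 \<Rightarrow> real \<Rightarrow> complex" where
  "jst k p = flow (- H) (\<lambda>i. exp (\<i> * of_real H * qv k p) * amp k p i) (fst p)"

definition bst :: "2 \<Rightarrow> complex \<Rightarrow> 4 \<Rightarrow> real \<Rightarrow> complex" where
  "bst r \<xi> = flow 0 (if r = 1 then quad 1 0 0 0 else quad 0 1 0 0) \<xi>"

lemma jst_solves: "solves S (fst p) (jst k p)" unfolding jst_def by (rule flow_solves)
lemma bst_solves: "solves S \<xi> (bst r \<xi>)" unfolding bst_def by (rule flow_solves)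

lemma qv_surface:
  assumes "p \<in> surface \<omega> lam0 mu0"
  shows "(qv 1 p)\<^sup>2 = (of_real \<omega>)\<^sup>2 / of_real sigma - (fst p)\<^sup>2"
    "(qv 2 p)\<^sup>2 = (of_real \<omega>)\<^sup>2 / of_real mu0 - (fst p)\<^sup>2"
  using assms by (auto simp: surface_def qv_def)

text \<open>\<open>amp k p\<close> is an eigenvector of the constant system matrix below
  \<open>-H\<close> for the eigenvalue -i q; the four equations marked \<open>*\<close> say so with
  denominators cleared.\<close>

lemma amp_solves:
  assumes p: "p \<in> surface \<omega> lam0 mu0"
  shows "solves {..- H} (fst p) (\<lambda>i Z. exp (- \<i> * of_real Z * qv k p) * amp k p i)"
proof -
  have d: "((\<lambda>Z. exp (- \<i> * of_real Z * q) * c) has_vector_derivative exp (- \<i> * of_real Z * q) * (- \<i> * q * c)) (at Z within S)"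
    for q c Z S
    by (auto intro!: derivative_eq_intros has_vector_derivative_real_field simp: algebra_simps)
  show ?thesis unfolding solves_iff
  proof (intro ballI)
    fix Z assume "Z \<in> {..- H}"
    then have co: "l Z = lam0" "m Z = mu0" "sg Z = sigma" using l_below m_below sg_below by auto
    let ?\<xi> = "fst p" and ?E = "exp (- \<i> * of_real Z * qv k p)" and ?v = "amp k p"
    define L M W S where "L = (of_real lam0 :: complex)" and "M = (of_real mu0 :: complex)"
      and "W = (of_real \<omega> :: complex)\<^sup>2" and "S = (of_real sigma :: complex)"
    have nz: "M \<noteq> 0" "S \<noteq> 0" using mu0_pos sigma_pos by (auto simp: M_def S_def)
    have S: "S = L + 2 * M" by (simp add: S_def L_def M_def sigma0_def)
    have q: "S * (qv 1 p)\<^sup>2 = W - S * ?\<xi>\<^sup>2" "M * (qv 2 p)\<^sup>2 = W - M * ?\<xi>\<^sup>2"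
      using qv_surface[OF p] nz by (simp_all add: W_def[symmetric] M_def[symmetric] S_def[symmetric] field_simps)
    have I: "\<i> * \<i> = (-1 :: complex)" by simp
    have v: "?v = (if k = 1 then quad (- ?\<xi>) (- \<i> * qv k p) (2 * \<i> * M * ?\<xi> * qv k p) (2 * M * ?\<xi>\<^sup>2 - W)
        else quad (- \<i> * qv k p) (- ?\<xi>) (2 * M * ?\<xi>\<^sup>2 - W) (2 * \<i> * M * ?\<xi> * qv k p))"
      using exhaust_2[of k] by (auto simp: amp_def M_def W_def)
    have *: "M * (- \<i> * qv k p * ?v 1) = ?v 3 + M * ?\<xi> * ?v 2 \<and>
      S * (- \<i> * qv k p * ?v 2) = ?v 4 - ?\<xi> * L * ?v 1 \<and>
      - \<i> * qv k p * ?v 3 = ?\<xi> * L * (- \<i> * qv k p * ?v 2) - (W - ?\<xi>\<^sup>2 * S) * ?v 1 \<and>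
      - \<i> * qv k p * ?v 4 = - ?\<xi> * ?v 3 - W * ?v 2"
    proof (cases "k = 1")
      case True
      have "M * (- \<i> * qv 1 p * - ?\<xi>) = 2 * \<i> * M * ?\<xi> * qv 1 p + M * ?\<xi> * (- \<i> * qv 1 p)"
        by (simp add: algebra_simps)
      moreover have "S * (- \<i> * qv 1 p * (- \<i> * qv 1 p)) = 2 * M * ?\<xi>\<^sup>2 - W - ?\<xi> * L * - ?\<xi>"
        using q(1) S I by algebra
      moreover have "- \<i> * qv 1 p * (2 * \<i> * M * ?\<xi> * qv 1 p)
          = ?\<xi> * L * (- \<i> * qv 1 p * (- \<i> * qv 1 p)) - (W - ?\<xi>\<^sup>2 * S) * - ?\<xi>"
        using q(1) S I by algebra
      moreover have "- \<i> * qv 1 p * (2 * M * ?\<xi>\<^sup>2 - W) = - ?\<xi> * (2 * \<i> * M * ?\<xi> * qv 1 p) - W * (- \<i> * qv 1 p)"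
        by (simp add: algebra_simps power2_eq_square)
      ultimately show ?thesis unfolding v using True by simp
    next
      case False
      then have k: "k = 2" using exhaust_2[of k] by blast
      have "M * (- \<i> * qv 2 p * (- \<i> * qv 2 p)) = 2 * M * ?\<xi>\<^sup>2 - W + M * ?\<xi> * - ?\<xi>"
        using q(2) I by algebra
      moreover have "S * (- \<i> * qv 2 p * - ?\<xi>) = 2 * \<i> * M * ?\<xi> * qv 2 p - ?\<xi> * L * (- \<i> * qv 2 p)"
        using S by algebra
      moreover have "- \<i> * qv 2 p * (2 * M * ?\<xi>\<^sup>2 - W)
          = ?\<xi> * L * (- \<i> * qv 2 p * - ?\<xi>) - (W - ?\<xi>\<^sup>2 * S) * (- \<i> * qv 2 p)"
        using S by algebra
      moreover have "- \<i> * qv 2 p * (2 * \<i> * M * ?\<xi> * qv 2 p) = - ?\<xi> * (2 * M * ?\<xi>\<^sup>2 - W) - W * - ?\<xi>"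
        using q(2) I by algebra
      ultimately show ?thesis unfolding v using k by simp
    qed
    have "slope1 ?\<xi> (\<lambda>i Z. exp (- \<i> * of_real Z * qv k p) * amp k p i) Z = ?E * ((?v 3 + M * ?\<xi> * ?v 2) / M)"
      using nz by (simp add: slope1_def co M_def[symmetric] field_simps)
    then have e1: "slope1 ?\<xi> (\<lambda>i Z. exp (- \<i> * of_real Z * qv k p) * amp k p i) Z = ?E * (- \<i> * qv k p * ?v 1)"
      using nz *[THEN conjunct1, symmetric] by simp
    have "slope2 ?\<xi> (\<lambda>i Z. exp (- \<i> * of_real Z * qv k p) * amp k p i) Z = ?E * ((?v 4 - ?\<xi> * L * ?v 1) / S)"
      by (simp add: slope2_def co L_def[symmetric] S_def[symmetric] algebra_simps)
    then have e2: "slope2 ?\<xi> (\<lambda>i Z. exp (- \<i> * of_real Z * qv k p) * amp k p i) Z = ?E * (- \<i> * qv k p * ?v 2)"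
      using nz *[THEN conjunct2, THEN conjunct1, symmetric] by simp
    have e3: "?\<xi> * L * (?E * (- \<i> * qv k p * ?v 2)) - (W - ?\<xi>\<^sup>2 * S) * (?E * ?v 1) = ?E * (- \<i> * qv k p * ?v 3)"
      and e4: "- ?\<xi> * (?E * ?v 3) - W * (?E * ?v 2) = ?E * (- \<i> * qv k p * ?v 4)"
      using * by algebra+
    show "((\<lambda>Z. exp (- \<i> * of_real Z * qv k p) * amp k p 1) has_vector_derivative
          slope1 (fst p) (\<lambda>i Z. exp (- \<i> * of_real Z * qv k p) * amp k p i) Z) (at Z within {..- H}) \<and>
         ((\<lambda>Z. exp (- \<i> * of_real Z * qv k p) * amp k p 2) has_vector_derivative
          slope2 (fst p) (\<lambda>i Z. exp (- \<i> * of_real Z * qv k p) * amp k p i) Z) (at Z within {..- H}) \<and>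
         ((\<lambda>Z. exp (- \<i> * of_real Z * qv k p) * amp k p 3) has_vector_derivative
          fst p * of_real (l Z) * slope2 (fst p) (\<lambda>i Z. exp (- \<i> * of_real Z * qv k p) * amp k p i) Z -
          ((of_real \<omega>)\<^sup>2 - (fst p)\<^sup>2 * of_real (sg Z)) * (exp (- \<i> * of_real Z * qv k p) * amp k p 1)) (at Z within {..- H}) \<and>
         ((\<lambda>Z. exp (- \<i> * of_real Z * qv k p) * amp k p 4) has_vector_derivative
          - fst p * (exp (- \<i> * of_real Z * qv k p) * amp k p 3) -
          (of_real \<omega>)\<^sup>2 * (exp (- \<i> * of_real Z * qv k p) * amp k p 2)) (at Z within {..- H})"
      unfolding e1 e2 co L_def[symmetric] S_def[symmetric] W_def[symmetric] e3 e4
      by (intro conjI d)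
  qed
qed

lemma jst_below:
  assumes "p \<in> surface \<omega> lam0 mu0" "Z \<le> - H"
  shows "jst k p i Z = exp (- \<i> * of_real Z * qv k p) * amp k p i"
  by (rule solves_unique[OF jst_solves amp_solves[OF assms(1)], where c = "- H"])
     (use assms(2) in \<open>auto simp: jst_def\<close>)

lemma state_displacement:
  assumes "solves {..<0} \<xi> y" "Z < 0"
  shows "state \<xi> (displacement y) i Z = y i Z"
proof -
  have "\<forall>i. state \<xi> (displacement y) i Z = y i Z"
    unfolding forall_4 state_simps vderiv_displacement[OF assms]
    using m_nz[of Z] sg_nz[of Z] by (simp add: displacement_def slope1_def slope2_def field_simps)
  then show ?thesis by blast
qed

lemma rayleigh_solution_unique:
  assumes \<psi>: "rayleigh_solution \<omega> lam mu \<xi> \<psi>" and y: "solves {..<0} \<xi> y"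
    and eq: "\<And>Z. Z \<le> - H \<Longrightarrow> \<psi> Z = displacement y Z" and "Z < 0"
  shows "\<psi> Z = displacement y Z"
proof -
  \<comment> \<open>Strictly below \<open>-H\<close>, so that the two functions agree in a
    neighbourhood and their derivatives, hence their full states, agree too.\<close>
  let ?c = "- H - 1"
  have c: "?c < 0" using H by simp
  have "displacement y differentiable (at ?c)"
    using rayleigh_solution_displacement[OF y] c unfolding rayleigh_solution_def by blast
  then have "(\<psi> has_vector_derivative vderiv (displacement y) ?c) (at ?c)"
    by (intro has_vector_derivative_transform_within_open[OF vderiv_works, of "displacement y" ?c "{..<- H}"])
       (auto simp: eq)
  then have v: "vderiv \<psi> ?c = vderiv (displacement y) ?c" by (rule vderivI)
  have "state \<xi> \<psi> i ?c = y i ?c" for i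
    using state_displacement[OF y c, of i] by (simp add: state_def v eq)
  then have "state \<xi> \<psi> i Z = y i Z" for i
    using solves_unique[OF rayleigh_solution_solves[OF \<psi>] y _ _ _ , of ?c Z i] c \<open>Z < 0\<close> by auto
  from this[of 1] this[of 2] show ?thesis
    by (simp add: state_simps displacement_def vec_eq_iff forall_2)
qed

text \<open>Resolves the choice in the definition of the Jost solutions:
  \<open>displacement (jst k p)\<close> is a witness, and a solution is determined on Z < 0 by its
  values below \<open>-H\<close>.\<close>

lemma jost_eq:
  assumes p: "p \<in> surface \<omega> lam0 mu0" and "Z < 0"
  shows "jost_P \<omega> H lam mu (- 1) p Z = displacement (jst 1 p) Z"
    "jost_S \<omega> H lam mu (- 1) p Z = displacement (jst 2 p) Z"
proof -
  obtain \<xi> qP qS where peq: "p = (\<xi>, qP, qS)" by (cases p)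
  have below: "displacement (jst k p) Z = exp (- 1 * \<i> * of_real Z * qv k p) *s vector [amp k p 1, amp k p 2]"
    if "Z \<le> - H" for Z k
    using jst_below[OF p that] by (simp add: displacement_def vec_eq_iff forall_2)
  have sol: "rayleigh_solution \<omega> lam mu \<xi> (displacement (jst k p))" for k
    using rayleigh_solution_displacement[OF jst_solves[of _ p k]] by (simp add: peq)
  have y: "solves {..<0} \<xi> (jst k p)" for k using jst_solves[of _ p k] by (simp add: peq)
  have P: "rayleigh_solution \<omega> lam mu \<xi> (jost_P \<omega> H lam mu (- 1) p) \<and>
     (\<forall>Z\<le>-H. jost_P \<omega> H lam mu (- 1) p Z = exp (- 1 * \<i> * of_real Z * qP) *s vector [- \<xi>, - 1 * \<i> * qP])"
    unfolding jost_P_def peq prod.case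
    by (rule someI[of _ "displacement (jst 1 p)"]) (use sol below[of _ 1] in \<open>auto simp: amp_def qv_def peq\<close>)
  show "jost_P \<omega> H lam mu (- 1) p Z = displacement (jst 1 p) Z"
    by (rule rayleigh_solution_unique[OF conjunct1[OF P] y _ \<open>Z < 0\<close>])
       (use conjunct2[OF P] below[of _ 1] in \<open>auto simp: amp_def qv_def peq\<close>)
  have S: "rayleigh_solution \<omega> lam mu \<xi> (jost_S \<omega> H lam mu (- 1) p) \<and>
     (\<forall>Z\<le>-H. jost_S \<omega> H lam mu (- 1) p Z = exp (- 1 * \<i> * of_real Z * qS) *s vector [- 1 * \<i> * qS, - \<xi>])"
    unfolding jost_S_def peq prod.case
    by (rule someI[of _ "displacement (jst 2 p)"]) (use sol below[of _ 2] in \<open>auto simp: amp_def qv_def peq\<close>)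
  show "jost_S \<omega> H lam mu (- 1) p Z = displacement (jst 2 p) Z"
    by (rule rayleigh_solution_unique[OF conjunct1[OF S] y _ \<open>Z < 0\<close>])
       (use conjunct2[OF S] below[of _ 2] in \<open>auto simp: amp_def qv_def peq\<close>)
qed

section \<open>The determinant and the jump across the diagonal\<close>

text \<open>Equals $i \Delta$ on the surface.\<close>

definition det_traction :: "point \<Rightarrow> complex" where
  "det_traction p = jst 1 p 3 0 * jst 2 p 4 0 - jst 2 p 3 0 * jst 1 p 4 0"

lemma rayleigh_det_eq:
  assumes "p \<in> surface \<omega> lam0 mu0"
  shows "rayleigh_det \<omega> H lam mu p = - \<i> * det_traction p"
proof -
  have t: "a_hat lam mu (fst p) (jost_P \<omega> H lam mu (- 1) p) = \<i> * jst 1 p 4 0"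
    "b_hat mu (fst p) (jost_P \<omega> H lam mu (- 1) p) = jst 1 p 3 0"
    "a_hat lam mu (fst p) (jost_S \<omega> H lam mu (- 1) p) = \<i> * jst 2 p 4 0"
    "b_hat mu (fst p) (jost_S \<omega> H lam mu (- 1) p) = jst 2 p 3 0"
    by (rule tractions[OF jst_solves, of "-1"]; simp add: jost_eq[OF assms])+
  show ?thesis unfolding rayleigh_det_def t det_traction_def by (simp add: algebra_simps)
qed

text \<open>The entries of minus the adjugate of the matrix of tractions.\<close>

definition coef :: "point \<Rightarrow> 2 \<Rightarrow> 2 \<Rightarrow> complex" where
  "coef p k r = (if k = 1 then (if r = 1 then - jst 2 p 4 0 else jst 2 p 3 0)
                 else (if r = 1 then jst 1 p 4 0 else - jst 1 p 3 0))"

text \<open>Multiplied by the determinant, this is the difference of the two branches of the kernel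
  on the diagonal: displacements match and the traction jumps by a unit vector.\<close>

lemma jump:
  assumes "det_traction p \<noteq> 0" and j: "j = 1 \<or> j = 2"
  shows "(\<Sum>k\<in>UNIV. \<Sum>r\<in>UNIV. coef p k r * (bst r (fst p) i Z * jst k p j Z - jst k p i Z * bst r (fst p) j Z)) =
    (if i = 3 \<and> j = 1 \<or> i = 4 \<and> j = 2 then det_traction p else 0)"
proof -
  let ?x = "\<lambda>k i. jst k p i Z" and ?b = "\<lambda>r i. bst r (fst p) i Z"
  \<comment> \<open>Both planes are Lagrangian: the P and S amplitudes pair to zero at
    \<open>-H\<close>, and the \<open>bst\<close> solutions have no traction at 0. The mixed
    pairings, evaluated at 0, are minus the tractions of the Jost solutions.\<close>
  have xx: "wronskian (jst 1 p) (jst 2 p) Z = 0"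
    using wronskian_eq[OF jst_solves[of UNIV p 1] jst_solves[of UNIV p 2], of Z "- H"]
    by (simp add: wronskian_def jst_def amp_def algebra_simps)
  have bb: "wronskian (bst 1 (fst p)) (bst 2 (fst p)) Z = 0"
    using wronskian_eq[OF bst_solves[of UNIV "fst p" 1] bst_solves[of UNIV "fst p" 2], of Z 0]
    by (simp add: wronskian_def bst_def)
  have xb: "wronskian (jst k p) (bst r (fst p)) Z = - jst k p (if r = 1 then 3 else 4) 0" for k r
    using wronskian_eq[OF jst_solves[of UNIV p k] bst_solves[of UNIV "fst p" r], of Z 0]
    by (simp add: wronskian_def bst_def)
  note W = xx bb xb[unfolded wronskian_def]
  have *: "(\<Sum>k\<in>UNIV. \<Sum>r\<in>UNIV. coef p k r * (?b r i * quad (- ?x k 3) (- ?x k 4) (?x k 1) (?x k 2) j'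
        - ?x k i * quad (- ?b r 3) (- ?b r 4) (?b r 1) (?b r 2) j')) = (if i = j' then det_traction p else 0)" for j'
    by (rule symplectic_completeness)
       (use W assms in \<open>simp_all add: wronskian_def coef_def det_traction_def\<close>)
  show ?thesis using *[of 3] *[of 4] j by auto
qed

end

subsection \<open>The resolvent kernel on the physical sheet\<close>

lemma test_function_differentiable:
  assumes "test_function \<phi>"
  shows "\<phi> differentiable (at Z)" "vderiv \<phi> differentiable (at Z)"
proof -
  have "Ck_on 2 \<phi> UNIV" using assms by (simp add: test_function_def)
  then obtain f' f'' where d: "\<And>x. (\<phi> has_vector_derivative f' x) (at x)" "\<And>x. (f' has_vector_derivative f'' x) (at x)"
    by (auto simp: numeral_2_eq_2)
  have "vderiv \<phi> = f'" using vderivI[OF d(1)] by auto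
  with d show "\<phi> differentiable (at Z)" "vderiv \<phi> differentiable (at Z)"
    by (auto intro: differentiableI_vector)
qed

text \<open>Differentiability is not assumed: \<open>vector_derivative\<close> is a choice from a
  predicate that is the same for f and g.\<close>

lemma vderiv_cong_open:
  assumes "open S" "Z \<in> S" "\<And>z. z \<in> S \<Longrightarrow> f z = g z"
  shows "vderiv f Z = vderiv g Z"
proof -
  have "(f has_vector_derivative d) (at Z) \<longleftrightarrow> (g has_vector_derivative d) (at Z)" for d
    using has_vector_derivative_transform_within_open[of f d Z S g]
      has_vector_derivative_transform_within_open[of g d Z S f] assms by auto
  then show ?thesis by (simp add: vderiv_def vector_derivative_def)
qed

lemma vderiv_const_0: "vderiv (\<lambda>_. 0) Z = 0"
  by (rule vderivI) simp

context rayleigh begin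

lemma rayleigh_op_local:
  assumes "open S" "Z \<in> S" "\<And>z. z \<in> S \<Longrightarrow> \<phi> z = 0"
  shows "vderiv \<phi> Z = 0" "rayleigh_op \<omega> lam mu \<xi> \<phi> Z = 0"
proof -
  have v: "vderiv \<phi> z = 0" if "z \<in> S" for z
    using vderiv_cong_open[OF assms(1) that, of \<phi> "\<lambda>_. 0"] assms(3) by (simp add: vderiv_const_0)
  then show "vderiv \<phi> Z = 0" using assms(2) .
  have "vderiv (\<lambda>z. P_mat lam mu z *v vderiv \<phi> z) Z = 0" "vderiv (\<lambda>z. transpose (N_mat lam mu z) *v \<phi> z) Z = 0"
    using vderiv_cong_open[OF assms(1,2), of "\<lambda>z. P_mat lam mu z *v vderiv \<phi> z" "\<lambda>_. 0"] v
      vderiv_cong_open[OF assms(1,2), of "\<lambda>z. transpose (N_mat lam mu z) *v \<phi> z" "\<lambda>_. 0"] assms(3)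
    by (simp_all add: vderiv_const_0)
  then show "rayleigh_op \<omega> lam mu \<xi> \<phi> Z = 0"
    using v[OF assms(2)] assms(2,3) by (simp add: rayleigh_op_def)
qed

text \<open>Lagrange's identity: against a solution w, an arbitrary function contributes exactly w
  times its image under the operator.\<close>

lemma wronskian_state_derivative:
  assumes w: "solves UNIV \<xi> w" and Z: "Z < 0" and \<phi>: "\<phi> differentiable (at Z)" "vderiv \<phi> differentiable (at Z)"
  shows "(wronskian w (state \<xi> \<phi>) has_vector_derivative
    (\<Sum>i\<in>UNIV. w (if i = 1 then 1 else 2) Z * rayleigh_op \<omega> lam mu \<xi> \<phi> Z $ i)) (at Z)"
proof -
  obtain d3 d4 where d:
    "(state \<xi> \<phi> 3 has_vector_derivative d3) (at Z)"
    "(state \<xi> \<phi> 4 has_vector_derivative d4) (at Z)"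
    "rayleigh_op \<omega> lam mu \<xi> \<phi> Z = vector
      [d3 - \<xi> * of_real (l Z) * vderiv \<phi> Z $ 2 + ((of_real \<omega>)\<^sup>2 - \<xi>\<^sup>2 * of_real (sg Z)) * \<phi> Z $ 1,
       d4 + \<xi> * of_real (m Z) * vderiv \<phi> Z $ 1 + ((of_real \<omega>)\<^sup>2 - \<xi>\<^sup>2 * of_real (m Z)) * \<phi> Z $ 2]"
    unfolding state_simps by (rule rayleigh_op_components[OF Z \<phi>])
  have d12: "(state \<xi> \<phi> 1 has_vector_derivative vderiv \<phi> Z $ 1) (at Z)"
    "(state \<xi> \<phi> 2 has_vector_derivative vderiv \<phi> Z $ 2) (at Z)"
    unfolding state_simps by (intro has_vector_derivative_vec_nth vderiv_works \<phi>)+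
  note dw = w[unfolded solves_iff, rule_format, OF UNIV_I, of Z]
  have prods: "((\<lambda>Z. p Z * q Z) has_vector_derivative p Z * q' + p' * q Z) (at Z)"
    if "(p has_vector_derivative p') (at Z)" "(q has_vector_derivative q') (at Z)"
    for p q :: "real \<Rightarrow> complex" and p' q' using has_vector_derivative_mult[OF that] .
  have der: "(wronskian w (state \<xi> \<phi>) has_vector_derivative
     (w 1 Z * d3 + slope1 \<xi> w Z * state \<xi> \<phi> 3 Z) + (w 2 Z * d4 + slope2 \<xi> w Z * state \<xi> \<phi> 4 Z)
     - (w 3 Z * vderiv \<phi> Z $ 1 + (\<xi> * of_real (l Z) * slope2 \<xi> w Z
        - ((of_real \<omega>)\<^sup>2 - \<xi>\<^sup>2 * of_real (sg Z)) * w 1 Z) * state \<xi> \<phi> 1 Z)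
     - (w 4 Z * vderiv \<phi> Z $ 2 + (- \<xi> * w 3 Z - (of_real \<omega>)\<^sup>2 * w 2 Z) * state \<xi> \<phi> 2 Z)) (at Z)"
    unfolding wronskian_def[abs_def] using dw d d12
    by (intro has_vector_derivative_add has_vector_derivative_diff prods) auto
  have A: "w 3 Z = of_real (m Z) * (slope1 \<xi> w Z - \<xi> * w 2 Z)"
    "w 4 Z = of_real (sg Z) * slope2 \<xi> w Z + \<xi> * of_real (l Z) * w 1 Z"
    using m_nz[of Z] sg_nz[of Z] by (simp_all add: slope1_def slope2_def)
  have "(w 1 Z * d3 + slope1 \<xi> w Z * state \<xi> \<phi> 3 Z) + (w 2 Z * d4 + slope2 \<xi> w Z * state \<xi> \<phi> 4 Z)
     - (w 3 Z * vderiv \<phi> Z $ 1 + (\<xi> * of_real (l Z) * slope2 \<xi> w Z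
        - ((of_real \<omega>)\<^sup>2 - \<xi>\<^sup>2 * of_real (sg Z)) * w 1 Z) * state \<xi> \<phi> 1 Z)
     - (w 4 Z * vderiv \<phi> Z $ 2 + (- \<xi> * w 3 Z - (of_real \<omega>)\<^sup>2 * w 2 Z) * state \<xi> \<phi> 2 Z)
     = (\<Sum>i\<in>UNIV. w (if i = 1 then 1 else 2) Z * rayleigh_op \<omega> lam mu \<xi> \<phi> Z $ i)"
    unfolding d(3) state_simps A by (simp add: sum_2 algebra_simps power2_eq_square)
  with der show ?thesis by simp
qed

definition ix :: "2 \<Rightarrow> 4" where "ix i = (if i = 1 then 1 else 2)"

text \<open>The determinant times -J T^{-1} B^T, kept for all state components. The displacement
  entries, selected by \<open>ix\<close>, form the kernel; the others carry the tractions needed for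
  the jump.\<close>

definition lower :: "point \<Rightarrow> real \<Rightarrow> real \<Rightarrow> 4 \<Rightarrow> 4 \<Rightarrow> complex" where
  "lower p Z Z' i j = (\<Sum>k\<in>UNIV. \<Sum>r\<in>UNIV. coef p k r * jst k p i Z * bst r (fst p) j Z')"

text \<open>
  The numerator of the resolvent kernel; below the diagonal the columns are combinations of Jost
  solutions, above it of solutions without traction at $0$.
\<close>

definition ker :: "point \<Rightarrow> real \<Rightarrow> real \<Rightarrow> 4 \<Rightarrow> 4 \<Rightarrow> complex" where
  "ker p Z Z' i j = (if Z \<le> Z' then lower p Z Z' i j else lower p Z' Z j i)"

lemma lower_solves: "solves S (fst p) (\<lambda>i Z. lower p Z Z' i j / c)"
proof -
  have "(\<lambda>i Z. lower p Z Z' i j / c) = (\<lambda>i Z. \<Sum>k\<in>UNIV. ((\<Sum>r\<in>UNIV. coef p k r * bst r (fst p) j Z') / c) * jst k p i Z)"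
    unfolding lower_def by (simp add: sum_2 fun_eq_iff add_divide_distrib algebra_simps)
  then show ?thesis by (simp only: solves_combination[OF jst_solves])
qed

lemma upper_solves: "solves S (fst p) (\<lambda>i Z. lower p Z' Z j i / c)"
proof -
  have "(\<lambda>i Z. lower p Z' Z j i / c) = (\<lambda>i Z. \<Sum>r\<in>UNIV. ((\<Sum>k\<in>UNIV. coef p k r * jst k p j Z') / c) * bst r (fst p) i Z)"
    unfolding lower_def by (simp add: sum_2 fun_eq_iff add_divide_distrib algebra_simps)
  then show ?thesis by (simp only: solves_combination[OF bst_solves])
qed

text \<open>The modulus of exp(-i Z q) is exp(Z Im q), which tends to 0 at minus infinity when Im q
  > 0.\<close>

lemma jst_decay:
  assumes "p \<in> physical_sheet \<omega> lam0 mu0"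
  shows "(jst k p i \<longlongrightarrow> 0) at_bot"
proof -
  have p: "p \<in> surface \<omega> lam0 mu0" and q: "Im (qv k p) > 0"
    using assms by (auto simp: physical_sheet_def qv_def)
  have "((\<lambda>Z. norm (exp (- \<i> * of_real Z * qv k p) * amp k p i)) \<longlongrightarrow> 0) at_bot"
  proof -
    have "filterlim (\<lambda>Z::real. Im (qv k p) * Z) at_bot at_bot"
      using q by (intro filterlim_tendsto_pos_mult_at_bot[OF tendsto_const]) (auto simp: filterlim_ident)
    then have "((\<lambda>Z. exp (Im (qv k p) * Z) * norm (amp k p i)) \<longlongrightarrow> 0 * norm (amp k p i)) at_bot"
      by (intro tendsto_intros filterlim_compose[OF exp_at_bot])
    then show ?thesis by (simp add: norm_mult mult.commute)
  qed
  then have "((\<lambda>Z. exp (- \<i> * of_real Z * qv k p) * amp k p i) \<longlongrightarrow> 0) at_bot"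
    by (rule tendsto_norm_zero_cancel)
  then show ?thesis
    by (rule Lim_transform_eventually)
       (auto simp: eventually_at_bot_linorder jst_below[OF p] intro!: exI[of _ "- H"])
qed

text \<open>Lagrange's identity, integrated on either side of \<open>Z'\<close>, leaves boundary
  terms only at \<open>Z'\<close>, where the unit jump of traction pairs with the test function to
  give its value. The branch above \<open>Z'\<close> is built from traction-free solutions, the
  branch below from decaying ones.\<close>

lemma kernel_is_resolvent:
  assumes p: "p \<in> physical_sheet \<omega> lam0 mu0" and D: "det_traction p \<noteq> 0" and Z': "Z' < 0"
  shows "resolvent_kernel \<omega> lam mu p Z' (\<lambda>Z. \<chi> i j. ker p Z Z' (ix i) (ix j) / det_traction p)"
proof -
  define d where "d = det_traction p"
  define lo up where "lo j = (\<lambda>i Z. lower p Z Z' i (ix j) / d)" and "up j = (\<lambda>i Z. lower p Z' Z (ix j) i / d)"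
    for j :: 2
  have lo: "solves S (fst p) (lo j)" and up: "solves S (fst p) (up j)" for S j
    unfolding lo_def up_def by (rule lower_solves upper_solves)+
  define g :: "real \<Rightarrow> complex^2^2" where "g Z = (\<chi> i j. if Z \<le> Z' then lo j (ix i) Z else up j (ix i) Z)" for Z
  have g_eq: "(\<lambda>Z. \<chi> i j. ker p Z Z' (ix i) (ix j) / det_traction p) = g"
    by (simp add: g_def ker_def lo_def up_def d_def fun_eq_iff vec_eq_iff)
  have diff: "up j i Z' - lo j i Z' = (if i = 3 \<and> j = 1 \<or> i = 4 \<and> j = 2 then 1 else 0)" for i j
  proof -
    have "(up j i Z' - lo j i Z') * d = lower p Z' Z' (ix j) i - lower p Z' Z' i (ix j)"
      using D by (simp add: up_def lo_def d_def diff_divide_distrib[symmetric])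
    also have "\<dots> = (\<Sum>k\<in>UNIV. \<Sum>r\<in>UNIV.
        coef p k r * (bst r (fst p) i Z' * jst k p (ix j) Z' - jst k p i Z' * bst r (fst p) (ix j) Z'))"
      by (simp add: lower_def sum_2 algebra_simps)
    also have "\<dots> = (if i = 3 \<and> ix j = 1 \<or> i = 4 \<and> ix j = 2 then d else 0)"
      unfolding d_def by (rule jump[OF D]) (simp add: ix_def)
    finally show ?thesis using D exhaust_2[of j] by (auto simp: d_def ix_def split: if_splits)
  qed
  have cont: "continuous_on UNIV (lo j i)" "continuous_on UNIV (up j i)" for i j
    using solves_isCont[OF lo] solves_isCont[OF up] by (auto intro: continuous_at_imp_continuous_on)
  have "continuous_on {..<0} g"
    unfolding g_def
  proof (intro continuous_on_vec_lambda)
    fix i j :: 2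
    have "continuous_on ({..Z'} \<union> {Z'..}) (\<lambda>Z. if Z \<le> Z' then lo j (ix i) Z else up j (ix i) Z)"
    proof (rule continuous_on_If)
      show "lo j (ix i) Z = up j (ix i) Z" if "Z \<in> {..Z'}" "\<not> Z \<le> Z'" for Z using that by simp
      show "lo j (ix i) Z = up j (ix i) Z" if "Z \<in> {Z'..}" "Z \<le> Z'" for Z
        using that diff[of j "ix i"] by (auto simp: ix_def split: if_splits)
    qed (auto intro: continuous_on_subset[OF cont(1)] continuous_on_subset[OF cont(2)])
    then show "continuous_on {..<0} (\<lambda>Z. if Z \<le> Z' then lo j (ix i) Z else up j (ix i) Z)"
      by (rule continuous_on_subset) auto
  qed
  moreover have "fundamental_solution \<omega> lam mu (fst p) Z' g"
    unfolding fundamental_solution_def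
  proof (intro allI impI)
    fix \<phi> assume \<phi>: "test_function \<phi>"
    note \<phi>d = test_function_differentiable[OF \<phi>]
    obtain a b where ab: "b < 0" "\<And>Z. Z \<notin> {a..b} \<Longrightarrow> \<phi> Z = 0"
      using \<phi> by (auto simp: test_function_def)
    have out: "vderiv \<phi> Z = 0" "rayleigh_op \<omega> lam mu \<xi> \<phi> Z = 0" if "Z \<notin> {a..b}" for Z \<xi>
      by (rule rayleigh_op_local[of "- {a..b}"]; use that ab(2) in auto)+
    \<comment> \<open>Endpoints strictly outside the support and on both sides of \<open>Z'\<close>;
      halving a negative number moves it towards 0 but keeps it negative.\<close>
    define a' b' where "a' = min a Z' - 1" and "b' = max b Z' / 2"
    have ab': "a' < a" "a' < Z'" "b < b'" "Z' < b'" "b' < 0"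
      using ab(1) Z' by (auto simp: a'_def b'_def max_def)
    let ?L = "\<lambda>Z. rayleigh_op \<omega> lam mu (fst p) \<phi> Z"
    have st0: "state (fst p) \<phi> i Z = 0" if "Z \<notin> {a..b}" for i Z
      using out(1)[OF that] ab(2)[OF that] by (simp add: state_def quad_def)
    have comp: "((\<lambda>Z. (?L Z v* g Z) $ j) has_integral \<phi> Z' $ j) {a'..b'}" for j
    proof -
      have F: "((\<lambda>Z. \<Sum>i\<in>UNIV. w (ix i) Z * ?L Z $ i) has_integral
          wronskian w (state (fst p) \<phi>) t - wronskian w (state (fst p) \<phi>) s) {s..t}"
        if "solves UNIV (fst p) w" "s \<le> t" "t < 0" for w s t
      proof (rule fundamental_theorem_of_calculus[OF that(2)])
        fix Z assume "Z \<in> {s..t}"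
        then have "Z < 0" using that(3) by simp
        from wronskian_state_derivative[OF that(1) this \<phi>d]
        show "(wronskian w (state (fst p) \<phi>) has_vector_derivative (\<Sum>i\<in>UNIV. w (ix i) Z * ?L Z $ i)) (at Z within {s..t})"
          unfolding ix_def by (rule has_vector_derivative_at_within)
      qed
      have 1: "((\<lambda>Z. (?L Z v* g Z) $ j) has_integral
          wronskian (lo j) (state (fst p) \<phi>) Z' - wronskian (lo j) (state (fst p) \<phi>) a') {a'..Z'}"
        by (rule has_integral_eq[OF _ F[OF lo]])
           (use ab' Z' in \<open>auto simp: vector_matrix_mult_def g_def sum_2 mult.commute\<close>)
      have 2: "((\<lambda>Z. (?L Z v* g Z) $ j) has_integral
          wronskian (up j) (state (fst p) \<phi>) b' - wronskian (up j) (state (fst p) \<phi>) Z') {Z'..b'}"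
      proof (rule has_integral_eq[OF _ F[OF up]])
        \<comment> \<open>At Z = \<open>Z'\<close> itself g is defined by the lower branch, so
          continuity of the displacements is needed.\<close>
        fix Z assume "Z \<in> {Z'..b'}"
        moreover have "lo j (ix i) Z' = up j (ix i) Z'" for i
          using diff[of j "ix i"] by (auto simp: ix_def split: if_splits)
        ultimately show "(\<Sum>i\<in>UNIV. up j (ix i) Z * ?L Z $ i) = (?L Z v* g Z) $ j"
          by (cases "Z = Z'") (auto simp: vector_matrix_mult_def g_def sum_2 mult.commute)
      qed (use ab' in auto)
      have "wronskian w (state (fst p) \<phi>) a' = 0" "wronskian w (state (fst p) \<phi>) b' = 0" for w
        using ab' by (simp_all add: wronskian_def st0)
      moreover have "wronskian (lo j) (state (fst p) \<phi>) Z' - wronskian (up j) (state (fst p) \<phi>) Z' = \<phi> Z' $ j"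
      proof -
        have "up j i Z' = lo j i Z' + (if i = 3 \<and> j = 1 \<or> i = 4 \<and> j = 2 then 1 else 0)" for i
          using diff[of j i] by (simp add: algebra_simps)
        then show ?thesis using exhaust_2[of j]
          by (auto simp: wronskian_def state_simps algebra_simps)
      qed
      ultimately show ?thesis
        using has_integral_combine[OF _ _ 1 2] ab' by (simp add: algebra_simps)
    qed
    have "((\<lambda>Z. \<Sum>j\<in>UNIV. axis j ((?L Z v* g Z) $ j)) has_integral (\<Sum>j\<in>UNIV. axis j (\<phi> Z' $ j))) {a'..b'}"
    proof (rule has_integral_sum)
      fix j :: 2
      have "bounded_linear (axis j :: complex \<Rightarrow> complex^2)"
        by (auto simp: linear_conv_bounded_linear[symmetric] linear_iff vec_eq_iff axis_def)
      from has_integral_linear[OF comp this]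
      show "((\<lambda>Z. axis j ((?L Z v* g Z) $ j)) has_integral axis j (\<phi> Z' $ j)) {a'..b'}"
        by (simp add: o_def)
    qed simp
    moreover have "(\<Sum>j\<in>UNIV. axis j (v $ j)) = v" for v :: "complex^2"
      by (simp add: vec_eq_iff forall_2 sum_2 axis_def)
    ultimately have "((\<lambda>Z. ?L Z v* g Z) has_integral \<phi> Z') {a'..b'}" by simp
    then show "((\<lambda>Z. ?L Z v* g Z) has_integral \<phi> Z') {..<0}"
      by (rule has_integral_on_superset) (use ab' out(2) in \<open>auto simp: vector_matrix_mult_def vec_eq_iff\<close>)
  qed
  moreover have "a_hat lam mu (fst p) (\<lambda>Z. column j (g Z)) = 0 \<and> b_hat mu (fst p) (\<lambda>Z. column j (g Z)) = 0 \<and>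
      ((\<lambda>Z. column j (g Z)) \<longlongrightarrow> 0) at_bot" for j
  proof (intro conjI)
    have "bst r (fst p) 3 0 = 0" "bst r (fst p) 4 0 = 0" for r by (simp_all add: bst_def)
    then have u0: "up j 3 0 = 0" "up j 4 0 = 0" by (simp_all add: up_def lower_def)
    have "column j (g Z) = displacement (up j) Z" if "Z' < Z" for Z
      using that by (simp add: column_def g_def displacement_def ix_def vec_eq_iff forall_2)
    note t = tractions[OF up Z', where \<psi> = "\<lambda>Z. column j (g Z)", OF this]
    show "a_hat lam mu (fst p) (\<lambda>Z. column j (g Z)) = 0" "b_hat mu (fst p) (\<lambda>Z. column j (g Z)) = 0"
      using t u0 by simp_all
    show "((\<lambda>Z. column j (g Z)) \<longlongrightarrow> 0) at_bot"
    proof (rule vec_tendstoI)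
      fix i
      have "(lo j (ix i) \<longlongrightarrow> (\<Sum>k\<in>UNIV. \<Sum>r\<in>UNIV. coef p k r * 0 * bst r (fst p) (ix j) Z') / d) at_bot"
        unfolding lo_def lower_def using D
        by (intro tendsto_intros jst_decay[OF p]) (simp add: d_def)
      then have "(lo j (ix i) \<longlongrightarrow> 0) at_bot" by simp
      then show "((\<lambda>Z. column j (g Z) $ i) \<longlongrightarrow> 0 $ i) at_bot"
        by (simp, elim Lim_transform_eventually)
           (auto simp: eventually_at_bot_linorder column_def g_def intro!: exI[of _ Z'])
    qed
  qed
  ultimately show ?thesis unfolding g_eq resolvent_kernel_def by blast
qed

end

subsection \<open>A point where the determinant does not vanish\<close>

lemma singular_2x2_kernel:
  fixes a b c d :: "'a::field"
  assumes "a * d - b * c = 0"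
  obtains x y where "x \<noteq> 0 \<or> y \<noteq> 0" "x * a + y * b = 0" "x * c + y * d = 0"
proof (cases "a = 0 \<and> b = 0")
  case True
  show thesis
  proof (cases "c = 0 \<and> d = 0")
    case True
    then show thesis using \<open>a = 0 \<and> b = 0\<close> that[of 1 0] by simp
  next
    case False
    then show thesis using True that[of d "- c"] by (auto simp: algebra_simps)
  qed
next
  case False
  then show thesis using assms that[of b "- a"] by (auto simp: algebra_simps)
qed

context rayleigh begin

text \<open>For real \<xi> the system has real coefficients, so real parts solve it. With \<kappa> =
  alpha0 / 9 the bound on mu becomes m \<ge> 9 \<kappa>, and the condition on x becomes \<omega>^2 <
  \<kappa> x^2.\<close>

lemma decaying_traction_free_Re:
  assumes y: "solves UNIV (of_real x) y" and lim: "\<And>i. (y i \<longlongrightarrow> 0) at_bot"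
    and bc: "y 3 0 = 0" "y 4 0 = 0" and x: "x > 0" "9 * \<omega>\<^sup>2 < alpha0 * x\<^sup>2" and Z: "Z < 0"
  shows "Re (y 1 Z) = 0 \<and> Re (y 2 Z) = 0"
proof (rule no_surface_wave_of_large_wavenumber[where u = "\<lambda>Z. Re (y 1 Z)"
      and v = "\<lambda>Z. Re (y 2 Z)" and Z = Z and s = "\<lambda>Z. Re (y 3 Z)" and t = "\<lambda>Z. Re (y 4 Z)"
      and l = l and m = m and x = x and \<omega> = \<omega> and \<kappa> = "alpha0 / 9"])
  have d: "((\<lambda>Z. Re (f Z)) has_real_derivative Re f') (at Z)"
    if "(f has_vector_derivative f') (at Z)" for f f' Z
    using bounded_linear.has_vector_derivative[OF bounded_linear_Re that]
    by (simp add: has_real_derivative_iff_has_vector_derivative)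
  note dy = y[unfolded solves_iff, rule_format, OF UNIV_I]
  have s2: "Re (slope2 (of_real x) y Z) = (Re (y 4 Z) - x * l Z * Re (y 1 Z)) / (l Z + 2 * m Z)" for Z
    by (simp add: slope2_def sg_def[symmetric])
  fix Z
  show "((\<lambda>Z. Re (y 1 Z)) has_real_derivative Re (y 3 Z) / m Z + x * Re (y 2 Z)) (at Z)"
    using d[of "y 1" "slope1 (of_real x) y Z" Z] dy[of Z] by (simp add: slope1_def)
  show "((\<lambda>Z. Re (y 2 Z)) has_real_derivative (Re (y 4 Z) - x * l Z * Re (y 1 Z)) / (l Z + 2 * m Z)) (at Z)"
    using d[of "y 2" "slope2 (of_real x) y Z" Z] dy[of Z] by (simp add: s2)
  have "Re (of_real x * of_real (l Z) * slope2 (of_real x) y Z - ((of_real \<omega>)\<^sup>2 - (of_real x)\<^sup>2 * of_real (sg Z)) * y 1 Z)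
      = x * l Z * ((Re (y 4 Z) - x * l Z * Re (y 1 Z)) / (l Z + 2 * m Z)) - (\<omega>\<^sup>2 - x\<^sup>2 * (l Z + 2 * m Z)) * Re (y 1 Z)"
    by (simp add: s2 sg_def flip: of_real_power of_real_mult of_real_diff)
  then show "((\<lambda>Z. Re (y 3 Z)) has_real_derivative x * l Z * ((Re (y 4 Z) - x * l Z * Re (y 1 Z)) / (l Z + 2 * m Z))
      - (\<omega>\<^sup>2 - x\<^sup>2 * (l Z + 2 * m Z)) * Re (y 1 Z)) (at Z)"
    using d[of "y 3" _ Z] dy[of Z] by metis
  show "((\<lambda>Z. Re (y 4 Z)) has_real_derivative - x * Re (y 3 Z) - \<omega>\<^sup>2 * Re (y 2 Z)) (at Z)"
    using d[of "y 4" "- of_real x * y 3 Z - (of_real \<omega>)\<^sup>2 * y 2 Z" Z] dy[of Z] by (simp flip: of_real_power)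
  show "((\<lambda>Z. Re (y 1 Z)) \<longlongrightarrow> 0) at_bot" "((\<lambda>Z. Re (y 2 Z)) \<longlongrightarrow> 0) at_bot"
    "((\<lambda>Z. Re (y 3 Z)) \<longlongrightarrow> 0) at_bot" "((\<lambda>Z. Re (y 4 Z)) \<longlongrightarrow> 0) at_bot"
    using tendsto_Re[OF lim] by auto
  show "2 * m Z + 3 * l Z \<ge> 0" using bulk_pos[of Z] by simp
  show "m Z \<ge> 9 * (alpha0 / 9)" using m_ge[of Z] by simp
qed (use alpha0 x bc Z in auto)

lemma decaying_traction_free:
  assumes "solves UNIV (of_real x) y" "\<And>i. (y i \<longlongrightarrow> 0) at_bot"
    and "y 3 0 = 0" "y 4 0 = 0" "x > 0" "9 * \<omega>\<^sup>2 < alpha0 * x\<^sup>2" "Z < 0"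
  shows "y 1 Z = 0 \<and> y 2 Z = 0"
proof -
  \<comment> \<open>The real part of -i y is the imaginary part of y; the one-element sum fits the
    lemma on linear combinations.\<close>
  have "solves UNIV (of_real x) (\<lambda>i Z. \<Sum>k\<in>{()}. - \<i> * y i Z)"
    using assms(1) by (intro solves_combination)
  then have "Re (- \<i> * y 1 Z) = 0 \<and> Re (- \<i> * y 2 Z) = 0"
    using assms tendsto_mult_left[OF assms(2), of "- \<i>"]
    by (intro decaying_traction_free_Re) auto
  moreover have "Re (y 1 Z) = 0 \<and> Re (y 2 Z) = 0" by (rule decaying_traction_free_Re[OF assms])
  ultimately show ?thesis by (simp add: complex_eq_iff)
qed

text \<open>A zero of the determinant at a large real \<xi> on the physical sheet would produce a
  decaying traction-free combination of Jost solutions. The energy estimate makes it vanish at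
  \<open>-H\<close>, against the independence of the P and S displacements there.\<close>

lemma det_traction_nonzero_somewhere: "\<exists>p\<in>surface \<omega> lam0 mu0. det_traction p \<noteq> 0"
proof -
  \<comment> \<open>The summand 1 makes x > 1, so that x^2 > x > 9 \<omega>^2 / alpha0.\<close>
  define x where "x = 1 + 9 * (\<omega>\<^sup>2 / alpha0)"
  have "\<omega>\<^sup>2 / alpha0 > 0" using \<omega> alpha0 by simp
  then have "1 < x" by (simp add: x_def)
  then have "x < x\<^sup>2" by (simp add: power2_eq_square)
  then have "9 * (\<omega>\<^sup>2 / alpha0) < x\<^sup>2" by (simp add: x_def)
  then have x: "x > 0" "9 * \<omega>\<^sup>2 < alpha0 * x\<^sup>2" "\<omega>\<^sup>2 / alpha0 < x\<^sup>2"
    using alpha0 \<open>1 < x\<close> \<open>\<omega>\<^sup>2 / alpha0 > 0\<close> by (linarith | simp add: field_simps)+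
  have "\<omega>\<^sup>2 / mu0 \<le> \<omega>\<^sup>2 / alpha0" "\<omega>\<^sup>2 / sigma \<le> \<omega>\<^sup>2 / mu0"
    using m_ge[of "-H"] m_below[of "-H"] alpha0 mu0_less_sigma mu0_pos by (auto intro!: divide_left_mono)
  then have le: "\<omega>\<^sup>2 / mu0 < x\<^sup>2" "\<omega>\<^sup>2 / sigma < x\<^sup>2" using x by linarith+
  define kP kS where "kP = sqrt (x\<^sup>2 - \<omega>\<^sup>2 / sigma)" and "kS = sqrt (x\<^sup>2 - \<omega>\<^sup>2 / mu0)"
  have k2: "kP\<^sup>2 = x\<^sup>2 - \<omega>\<^sup>2 / sigma" "kS\<^sup>2 = x\<^sup>2 - \<omega>\<^sup>2 / mu0" and kpos: "kP > 0" "kS > 0"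
    using le by (auto simp: kP_def kS_def)
  have "kP < x" "kS < x"
    using k2 x \<omega> sigma_pos mu0_pos by (intro power2_less_imp_less[of _ x]; simp)+
  then have kk: "kP * kS < x * x" using kpos by (intro mult_strict_mono) auto
  define p :: point where "p = (of_real x, \<i> * of_real kP, \<i> * of_real kS)"
  have p: "p \<in> physical_sheet \<omega> lam0 mu0"
    using kpos k2 by (auto simp: p_def physical_sheet_def surface_def power_mult_distrib simp flip: of_real_power of_real_divide of_real_diff of_real_minus)
  then have ps: "p \<in> surface \<omega> lam0 mu0" by (auto simp: physical_sheet_def)
  have "det_traction p \<noteq> 0"
  proof
    assume "det_traction p = 0"
    then obtain c1 c2 where c: "c1 \<noteq> 0 \<or> c2 \<noteq> 0"
      "c1 * jst 1 p 3 0 + c2 * jst 2 p 3 0 = 0" "c1 * jst 1 p 4 0 + c2 * jst 2 p 4 0 = 0"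
      unfolding det_traction_def by (rule singular_2x2_kernel)
    define y where "y i Z = (\<Sum>k\<in>UNIV. (if k = 1 then c1 else c2) * jst k p i Z)" for i Z
    have y: "solves UNIV (of_real x) y"
      using solves_combination[of UNIV UNIV "of_real x" "\<lambda>k. jst k p"] jst_solves[of UNIV p]
      unfolding y_def by (simp add: p_def)
    have ylim: "(y i \<longlongrightarrow> 0) at_bot" for i
    proof -
      have "((\<lambda>Z. \<Sum>k\<in>UNIV. (if k = 1 then c1 else c2) * jst k p i Z) \<longlongrightarrow> (\<Sum>k\<in>(UNIV::2 set). (if k = 1 then c1 else c2) * 0)) at_bot"
        by (intro tendsto_intros jst_decay[OF p])
      then show ?thesis by (simp add: y_def[abs_def])
    qed
    have "y 1 (- H) = 0 \<and> y 2 (- H) = 0"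
      using c x H by (intro decaying_traction_free[OF y ylim]) (auto simp: y_def sum_2)
    moreover define e1 e2 where "e1 = exp (\<i> * of_real H * qv 1 p) * c1" and "e2 = exp (\<i> * of_real H * qv 2 p) * c2"
    moreover have "y i (- H) = e1 * amp 1 p i + e2 * amp 2 p i" for i
      by (simp add: y_def sum_2 jst_below[OF ps] e1_def e2_def)
    \<comment> \<open>Vanishing displacement at \<open>-H\<close>; this system for e1 and e2 has
      determinant x^2 - kP kS, positive because both roots are below x.\<close>
    ultimately have "- of_real x * e1 + of_real kS * e2 = 0" "of_real kP * e1 - of_real x * e2 = 0"
      by (simp_all add: amp_def qv_def p_def algebra_simps)
    then have "(of_real (x * x - kP * kS) :: complex) * e1 = 0" "(of_real (x * x - kP * kS) :: complex) * e2 = 0"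
      unfolding of_real_diff of_real_mult by algebra+
    moreover have "(of_real (x * x - kP * kS) :: complex) \<noteq> 0" using kk by (simp del: of_real_diff of_real_mult)
    ultimately have "e1 = 0" "e2 = 0" by auto
    then show False using c(1) by (auto simp: e1_def e2_def)
  qed
  with ps show ?thesis by blast
qed

end

subsection \<open>Continuation to the surface\<close>

definition analytic_curve :: "(complex \<Rightarrow> point) \<Rightarrow> bool" where
  "analytic_curve \<gamma> \<longleftrightarrow> (\<lambda>t. fst (\<gamma> t)) analytic_on {0} \<and> (\<lambda>t. fst (snd (\<gamma> t))) analytic_on {0} \<and>
     (\<lambda>t. snd (snd (\<gamma> t))) analytic_on {0}"

text \<open>Cramer's rule in the limit: the unknowns inherit limits from the right-hand sides when
  the limiting determinant is nonzero.\<close>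

lemma solve_2x2_tendsto:
  fixes x y a b c d :: "complex \<Rightarrow> complex"
  assumes lim: "a \<midarrow>0\<rightarrow> a0" "b \<midarrow>0\<rightarrow> b0" "c \<midarrow>0\<rightarrow> c0" "d \<midarrow>0\<rightarrow> d0"
    and r: "\<exists>u. (\<lambda>t. a t * x t + b t * y t) \<midarrow>0\<rightarrow> u" "\<exists>v. (\<lambda>t. c t * x t + d t * y t) \<midarrow>0\<rightarrow> v"
    and det: "a0 * d0 - b0 * c0 \<noteq> 0"
  shows "(\<exists>u. x \<midarrow>0\<rightarrow> u) \<and> (\<exists>v. y \<midarrow>0\<rightarrow> v)"
proof -
  from r obtain u v where uv: "(\<lambda>t. a t * x t + b t * y t) \<midarrow>0\<rightarrow> u" "(\<lambda>t. c t * x t + d t * y t) \<midarrow>0\<rightarrow> v"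
    by blast
  let ?D = "\<lambda>t. a t * d t - b t * c t"
  have D: "?D \<midarrow>0\<rightarrow> a0 * d0 - b0 * c0" by (intro tendsto_intros lim)
  have ne: "\<forall>\<^sub>F t in at 0. ?D t \<noteq> 0" using D det by (rule tendsto_imp_eventually_ne)
  have "(\<lambda>t. (d t * (a t * x t + b t * y t) - b t * (c t * x t + d t * y t)) / ?D t)
      \<midarrow>0\<rightarrow> (d0 * u - b0 * v) / (a0 * d0 - b0 * c0)"
    by (intro tendsto_intros lim uv det)
  then have x: "x \<midarrow>0\<rightarrow> (d0 * u - b0 * v) / (a0 * d0 - b0 * c0)"
    by (rule Lim_transform_eventually) (use ne in eventually_elim, simp add: field_simps)
  have "(\<lambda>t. (a t * (c t * x t + d t * y t) - c t * (a t * x t + b t * y t)) / ?D t)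
      \<midarrow>0\<rightarrow> (a0 * v - c0 * u) / (a0 * d0 - b0 * c0)"
    by (intro tendsto_intros lim uv det)
  then have y: "y \<midarrow>0\<rightarrow> (a0 * v - c0 * u) / (a0 * d0 - b0 * c0)"
    by (rule Lim_transform_eventually) (use ne in eventually_elim, simp add: field_simps)
  show ?thesis using x y by blast
qed

context rayleigh begin

text \<open>At a branch point \<xi> has zero derivative along a chart. That \<xi> nevertheless
  leaves its initial value is recorded separately, as passing from the chart to the \<xi>-plane
  relies on it.\<close>

definition good_param :: "point \<Rightarrow> (complex \<Rightarrow> point) \<Rightarrow> bool" where
  "good_param p \<gamma> \<longleftrightarrow> local_param \<omega> lam0 mu0 p \<gamma> \<and> (\<forall>\<^sub>F t in at 0. fst (\<gamma> t) \<noteq> fst p)"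

lemma local_paramD:
  assumes "local_param \<omega> lam0 mu0 p \<gamma>"
  shows "\<gamma> 0 = p" "\<forall>\<^sub>F t in nhds 0. \<gamma> t \<in> surface \<omega> lam0 mu0" "analytic_curve \<gamma>"
  using assms by (auto simp: local_param_def analytic_curve_def)

text \<open>Away from branch points \<xi> is a coordinate; where q_P or q_S vanishes, that root is
  one. There \<xi> and the other root are nonzero, so the remaining entries are analytic square
  roots.\<close>

lemma good_param_exists:
  assumes p: "p \<in> surface \<omega> lam0 mu0"
  shows "\<exists>\<gamma>. good_param p \<gamma>"
proof -
  obtain \<xi> qP qS where peq: "p = (\<xi>, qP, qS)" by (cases p)
  define a b where "a = (of_real (\<omega>\<^sup>2 / sigma) :: complex)" and "b = (of_real (\<omega>\<^sup>2 / mu0) :: complex)"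
  have "\<omega>\<^sup>2 / sigma < \<omega>\<^sup>2 / mu0" using mu0_pos mu0_less_sigma \<omega> by (intro divide_strict_left_mono) auto
  then have ab: "a \<noteq> 0" "b \<noteq> 0" "a \<noteq> b"
    using \<omega> mu0_pos sigma_pos by (auto simp: a_def b_def simp del: of_real_divide)
  have surf: "(x, y, z) \<in> surface \<omega> lam0 mu0 \<longleftrightarrow> y\<^sup>2 = a - x\<^sup>2 \<and> z\<^sup>2 = b - x\<^sup>2" for x y z
    by (simp add: surface_def a_def b_def)
  have q: "qP\<^sup>2 = a - \<xi>\<^sup>2" "qS\<^sup>2 = b - \<xi>\<^sup>2" using p by (simp_all add: peq surf)
  \<comment> \<open>The branch of the square root that equals c at c^2; it is analytic there because
    \<open>csqrt\<close> is evaluated near 1.\<close>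
  have root: "(c * csqrt (w / c\<^sup>2))\<^sup>2 = w" if "c \<noteq> 0" for c w using that by (simp add: power_mult_distrib)
  have ev: "\<forall>\<^sub>F t in at 0. t \<noteq> (0::complex)" by (simp add: eventually_at_filter)
  consider "qP \<noteq> 0" "qS \<noteq> 0" | "qP = 0" | "qS = 0" by blast
  then show ?thesis
  proof cases
    case 1
    let ?\<gamma> = "\<lambda>t. (\<xi> + t, qP * csqrt ((a - (\<xi> + t)\<^sup>2) / qP\<^sup>2), qS * csqrt ((b - (\<xi> + t)\<^sup>2) / qS\<^sup>2))"
    have "((\<lambda>t. \<xi> + t) has_field_derivative 1) (at 0)" by (auto intro!: derivative_eq_intros)
    then have "deriv (\<lambda>t. \<xi> + t) 0 = 1" by (rule DERIV_imp_deriv)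
    moreover have "(a - \<xi>\<^sup>2) / qP\<^sup>2 = 1" "(b - \<xi>\<^sup>2) / qS\<^sup>2 = 1" "a \<noteq> \<xi>\<^sup>2" "b \<noteq> \<xi>\<^sup>2"
      using 1 q by auto
    moreover have "?\<gamma> t \<in> surface \<omega> lam0 mu0" for t unfolding surf using 1 by (simp add: root)
    ultimately have "good_param p ?\<gamma>"
      unfolding good_param_def local_param_def using 1 ev
      by (auto simp: peq intro!: analytic_intros)
    then show ?thesis by blast
  next
    case 2
    then have nz: "\<xi> \<noteq> 0" "qS \<noteq> 0" and x: "\<xi>\<^sup>2 = a" "qS\<^sup>2 = b - a" using q ab by auto
    let ?\<gamma> = "\<lambda>t. (\<xi> * csqrt ((a - t\<^sup>2) / \<xi>\<^sup>2), t, qS * csqrt ((b - a + t\<^sup>2) / qS\<^sup>2))"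
    have "deriv (\<lambda>t::complex. t) 0 = 1" by simp
    moreover have "?\<gamma> t \<in> surface \<omega> lam0 mu0" for t unfolding surf using nz by (simp add: root)
    moreover have "\<xi> * csqrt ((a - t\<^sup>2) / \<xi>\<^sup>2) \<noteq> \<xi>" if "t \<noteq> 0" for t
    proof
      assume "\<xi> * csqrt ((a - t\<^sup>2) / \<xi>\<^sup>2) = \<xi>"
      then have "a - t\<^sup>2 = \<xi>\<^sup>2" using root[OF nz(1), of "a - t\<^sup>2"] nz(1) by simp
      then show False using that x by simp
    qed
    then have "\<forall>\<^sub>F t in at 0. \<xi> * csqrt ((a - t\<^sup>2) / \<xi>\<^sup>2) \<noteq> \<xi>" by (rule eventually_mono[OF ev])
    moreover have "a / \<xi>\<^sup>2 = 1" "(b - a) / qS\<^sup>2 = 1" using nz x by auto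
    ultimately have "good_param p ?\<gamma>"
      unfolding good_param_def local_param_def using nz ab 2
      by (auto simp: peq intro!: analytic_intros)
    then show ?thesis by blast
  next
    case 3
    then have nz: "\<xi> \<noteq> 0" "qP \<noteq> 0" and x: "\<xi>\<^sup>2 = b" "qP\<^sup>2 = a - b" using q ab by auto
    let ?\<gamma> = "\<lambda>t. (\<xi> * csqrt ((b - t\<^sup>2) / \<xi>\<^sup>2), qP * csqrt ((a - b + t\<^sup>2) / qP\<^sup>2), t)"
    have "deriv (\<lambda>t::complex. t) 0 = 1" by simp
    moreover have "?\<gamma> t \<in> surface \<omega> lam0 mu0" for t unfolding surf using nz by (simp add: root)
    moreover have "\<xi> * csqrt ((b - t\<^sup>2) / \<xi>\<^sup>2) \<noteq> \<xi>" if "t \<noteq> 0" for t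
    proof
      assume "\<xi> * csqrt ((b - t\<^sup>2) / \<xi>\<^sup>2) = \<xi>"
      then have "b - t\<^sup>2 = \<xi>\<^sup>2" using root[OF nz(1), of "b - t\<^sup>2"] nz(1) by simp
      then show False using that x by simp
    qed
    then have "\<forall>\<^sub>F t in at 0. \<xi> * csqrt ((b - t\<^sup>2) / \<xi>\<^sup>2) \<noteq> \<xi>" by (rule eventually_mono[OF ev])
    moreover have "b / \<xi>\<^sup>2 = 1" "(a - b) / qP\<^sup>2 = 1" using nz x by auto
    ultimately have "good_param p ?\<gamma>"
      unfolding good_param_def local_param_def using nz ab 3
      by (auto simp: peq intro!: analytic_intros)
    then show ?thesis by blast
  qed
qed

section \<open>Analyticity along curves and isolated zeros of the determinant\<close>

lemma fund_analytic:
  assumes "g analytic_on {0}"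
  shows "(\<lambda>t. fund c k i Z (g t)) analytic_on {0}"
proof -
  have "(\<lambda>\<xi>. fund c k i Z \<xi>) analytic_on UNIV" using fund_holomorphic by (simp add: analytic_on_open)
  then have "((\<lambda>\<xi>. fund c k i Z \<xi>) \<circ> g) analytic_on {0}"
    by (intro analytic_on_compose assms) (rule analytic_on_subset, auto)
  then show ?thesis by (simp add: o_def)
qed

lemma
  assumes "analytic_curve \<gamma>"
  shows jst_analytic: "(\<lambda>t. jst k (\<gamma> t) i Z) analytic_on {0}"
    and bst_analytic: "(\<lambda>t. bst r (fst (\<gamma> t)) i Z) analytic_on {0}"
proof -
  have \<gamma>: "(\<lambda>t. fst (\<gamma> t)) analytic_on {0}" "(\<lambda>t. qv k (\<gamma> t)) analytic_on {0}" for k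
    using assms by (cases "k = 1"; simp add: analytic_curve_def qv_def)+
  have "\<forall>j. (\<lambda>t. amp k (\<gamma> t) j) analytic_on {0}"
    unfolding forall_4 amp_def by (cases "k = 1") (auto intro!: analytic_intros \<gamma>)
  then show "(\<lambda>t. jst k (\<gamma> t) i Z) analytic_on {0}"
    unfolding jst_def flow_def by (auto intro!: analytic_intros \<gamma> fund_analytic)
  show "(\<lambda>t. bst r (fst (\<gamma> t)) i Z) analytic_on {0}"
    unfolding bst_def flow_def by (intro analytic_intros \<gamma> fund_analytic)
qed

lemma coef_analytic: "analytic_curve \<gamma> \<Longrightarrow> (\<lambda>t. coef (\<gamma> t) k r) analytic_on {0}"
  unfolding coef_def by (cases "k = 1"; cases "r = 1"; simp; intro analytic_intros jst_analytic)

lemma det_traction_analytic: "analytic_curve \<gamma> \<Longrightarrow> (\<lambda>t. det_traction (\<gamma> t)) analytic_on {0}"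
  unfolding det_traction_def by (intro analytic_intros jst_analytic)

lemma ker_analytic: "analytic_curve \<gamma> \<Longrightarrow> (\<lambda>t. ker (\<gamma> t) Z Z' i j) analytic_on {0}"
  unfolding ker_def lower_def
  by (cases "Z \<le> Z'"; simp; intro analytic_intros jst_analytic bst_analytic coef_analytic)

lemma det_traction_not_locally_zero:
  assumes p: "p \<in> surface \<omega> lam0 mu0" and \<gamma>: "good_param p \<gamma>"
  shows "\<forall>\<^sub>F t in at 0. det_traction (\<gamma> t) \<noteq> 0"
proof (rule ccontr)
  assume "\<not> ?thesis"
  then have fr: "\<exists>\<^sub>F t in at 0. det_traction (\<gamma> t) = 0" by (simp add: frequently_def)
  have lp: "\<gamma> 0 = p" "\<forall>\<^sub>F t in nhds 0. \<gamma> t \<in> surface \<omega> lam0 mu0" "analytic_curve \<gamma>"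
    using \<gamma> local_paramD unfolding good_param_def by blast+
  have zero: "\<forall>\<^sub>F t in at 0. det_traction (\<gamma> t) = 0"
    by (intro not_essential_frequently_0_imp_eventually_0 isolated_singularity_at_analytic
        not_essential_analytic det_traction_analytic lp fr)
  define f where "f i j \<xi> = fund (- H) j i 0 \<xi>" for i j \<xi>
  define M W where "M = (of_real mu0 :: complex)" and "W = (of_real \<omega> :: complex)\<^sup>2"
  \<comment> \<open>At 0 each Jost state is its exponential times \<alpha> + q \<beta>, with
    \<alpha> and \<beta> entire in \<xi>; primes mark the S solution.\<close>
  define \<alpha> where "\<alpha> i \<xi> = - \<xi> * f i 1 \<xi> + (2 * M * \<xi>\<^sup>2 - W) * f i 4 \<xi>" for i \<xi>
  define \<beta> where "\<beta> i \<xi> = - \<i> * f i 2 \<xi> + 2 * \<i> * M * \<xi> * f i 3 \<xi>" for i \<xi>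
  define \<alpha>' where "\<alpha>' i \<xi> = - \<xi> * f i 2 \<xi> + (2 * M * \<xi>\<^sup>2 - W) * f i 3 \<xi>" for i \<xi>
  define \<beta>' where "\<beta>' i \<xi> = - \<i> * f i 1 \<xi> + 2 * \<i> * M * \<xi> * f i 4 \<xi>" for i \<xi>
  define E where "E k p = exp (\<i> * of_real H * qv k p)" for k p
  have j1: "jst 1 p i 0 = E 1 p * (\<alpha> i (fst p) + qv 1 p * \<beta> i (fst p))" for p i
    by (simp add: jst_def flow_def sum_4 amp_def E_def \<alpha>_def \<beta>_def f_def M_def W_def algebra_simps)
  have j2: "jst 2 p i 0 = E 2 p * (\<alpha>' i (fst p) + qv 2 p * \<beta>' i (fst p))" for p i
    by (simp add: jst_def flow_def sum_4 amp_def E_def \<alpha>'_def \<beta>'_def f_def M_def W_def algebra_simps)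
  define D0 D1 D2 D3 where "D0 \<xi> = \<alpha> 3 \<xi> * \<alpha>' 4 \<xi> - \<alpha>' 3 \<xi> * \<alpha> 4 \<xi>" and "D1 \<xi> = \<beta> 3 \<xi> * \<alpha>' 4 \<xi> - \<alpha>' 3 \<xi> * \<beta> 4 \<xi>"
    and "D2 \<xi> = \<alpha> 3 \<xi> * \<beta>' 4 \<xi> - \<beta>' 3 \<xi> * \<alpha> 4 \<xi>" and "D3 \<xi> = \<beta> 3 \<xi> * \<beta>' 4 \<xi> - \<beta>' 3 \<xi> * \<beta> 4 \<xi>" for \<xi>
  have det: "det_traction p = E 1 p * E 2 p * (D0 (fst p) + qv 1 p * D1 (fst p) + qv 2 p * D2 (fst p)
      + qv 1 p * qv 2 p * D3 (fst p))" for p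
    unfolding det_traction_def j1 j2 D0_def D1_def D2_def D3_def by (simp add: algebra_simps)
  have E0: "E k p \<noteq> 0" for k p by (simp add: E_def)
  have fh: "f i j holomorphic_on UNIV" for i j
    unfolding f_def[abs_def] by (rule fund_holomorphic)
  have hol: "D0 holomorphic_on UNIV" "D1 holomorphic_on UNIV" "D2 holomorphic_on UNIV" "D3 holomorphic_on UNIV"
    unfolding D0_def[abs_def] D1_def[abs_def] D2_def[abs_def] D3_def[abs_def] \<alpha>_def \<beta>_def \<alpha>'_def \<beta>'_def
    by (intro holomorphic_intros fh)+
  define a b where "a = (of_real (\<omega>\<^sup>2 / sigma) :: complex)" and "b = (of_real (\<omega>\<^sup>2 / mu0) :: complex)"
  have "\<omega>\<^sup>2 / sigma < \<omega>\<^sup>2 / mu0" using mu0_pos mu0_less_sigma \<omega> by (intro divide_strict_left_mono) auto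
  then have ab: "a \<noteq> 0" "b \<noteq> 0" "a \<noteq> b"
    using \<omega> mu0_pos sigma_pos by (auto simp: a_def b_def simp del: of_real_divide)
  have sat: "\<forall>\<^sub>F t in at 0. \<gamma> t \<in> surface \<omega> lam0 mu0"
    using lp(2) by (simp add: eventually_nhds_conv_at)
  have "isCont (\<lambda>t. fst (\<gamma> t)) 0"
    using lp(3) unfolding analytic_curve_def by (intro analytic_at_imp_isCont) auto
  then have X: "filterlim (\<lambda>t. fst (\<gamma> t)) (at (fst p)) (at 0)"
    using \<gamma> lp(1) unfolding good_param_def by (simp add: filterlim_at isCont_def)
  have "D0 z = 0 \<and> D1 z = 0 \<and> D2 z = 0 \<and> D3 z = 0" for z
  proof (rule entire_coefficients_unique[OF ab hol X])
    show "\<forall>\<^sub>F t in at 0. (qv 1 (\<gamma> t))\<^sup>2 = a - (fst (\<gamma> t))\<^sup>2" "\<forall>\<^sub>F t in at 0. (qv 2 (\<gamma> t))\<^sup>2 = b - (fst (\<gamma> t))\<^sup>2"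
      by (rule eventually_mono[OF sat]; simp add: qv_surface a_def b_def)+
    show "\<forall>\<^sub>F t in at 0. D0 (fst (\<gamma> t)) + qv 1 (\<gamma> t) * D1 (fst (\<gamma> t)) + qv 2 (\<gamma> t) * D2 (fst (\<gamma> t))
        + qv 1 (\<gamma> t) * qv 2 (\<gamma> t) * D3 (fst (\<gamma> t)) = 0"
      using zero by eventually_elim (use E0 in \<open>simp add: det\<close>)
  qed simp
  \<comment> \<open>The coefficients vanish on the whole plane, hence so does the determinant on
    every sheet.\<close>
  then have "det_traction p = 0" for p by (simp add: det)
  then show False using det_traction_nonzero_somewhere by blast
qed

section \<open>The continued kernel and its poles\<close>

definition chart :: "point \<Rightarrow> complex \<Rightarrow> point" where
  "chart p = (SOME \<gamma>. good_param p \<gamma>)"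

lemma chart: "p \<in> surface \<omega> lam0 mu0 \<Longrightarrow> good_param p (chart p)"
  unfolding chart_def by (rule someI_ex[OF good_param_exists])

text \<open>
  At a zero of the determinant an entry of the kernel may have a removable singularity, so its value
  there is read off along a chart.
\<close>

definition kernel :: "real \<Rightarrow> real \<Rightarrow> point \<Rightarrow> complex^2^2" where
  "kernel Z Z' p = (\<chi> i j. if det_traction p \<noteq> 0 then ker p Z Z' (ix i) (ix j) / det_traction p
     else remove_sings (\<lambda>t. ker (chart p t) Z Z' (ix i) (ix j) / det_traction (chart p t)) 0)"

text \<open>An arbitrary local parameter is allowed, since \<open>surface_pole\<close> quantifies
  over all of them; this excludes poles where the determinant is nonzero.\<close>

lemma kernel_analytic:
  assumes "local_param \<omega> lam0 mu0 p \<gamma>" "det_traction p \<noteq> 0"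
  shows "(\<lambda>t. kernel Z Z' (\<gamma> t) $ i $ j) analytic_on {0}"
proof -
  note \<gamma> = local_paramD[OF assms(1)]
  have "(\<lambda>t. ker (\<gamma> t) Z Z' (ix i) (ix j) / det_traction (\<gamma> t)) analytic_on {0}"
    using assms(2) by (intro analytic_intros ker_analytic det_traction_analytic \<gamma>) (auto simp: \<gamma>)
  moreover have "\<forall>\<^sub>F t in nhds 0. det_traction (\<gamma> t) \<noteq> 0"
  proof -
    have "isCont (\<lambda>t. det_traction (\<gamma> t)) 0" by (intro analytic_at_imp_isCont det_traction_analytic \<gamma>)
    then have "\<forall>\<^sub>F t in at 0. det_traction (\<gamma> t) \<noteq> 0"
      using assms(2) \<gamma>(1) unfolding isCont_def by (auto intro: tendsto_imp_eventually_ne)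
    then show ?thesis using assms(2) \<gamma>(1) by (simp add: eventually_nhds_conv_at)
  qed
  then have "\<forall>\<^sub>F t in nhds 0. kernel Z Z' (\<gamma> t) $ i $ j = ker (\<gamma> t) Z Z' (ix i) (ix j) / det_traction (\<gamma> t)"
    by eventually_elim (simp add: kernel_def)
  ultimately show ?thesis using analytic_at_cong by fast
qed

lemma kernel_chart:
  assumes p: "p \<in> surface \<omega> lam0 mu0"
  shows "\<forall>\<^sub>F t in at 0. kernel Z Z' (chart p t) $ i $ j = ker (chart p t) Z Z' (ix i) (ix j) / det_traction (chart p t)"
  using det_traction_not_locally_zero[OF p chart[OF p]] by eventually_elim (simp add: kernel_def)

lemma kernel_chart_meromorphic:
  assumes p: "p \<in> surface \<omega> lam0 mu0"
  shows "(\<lambda>t. kernel Z Z' (chart p t) $ i $ j) nicely_meromorphic_on {0}"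
proof -
  define \<gamma> where "\<gamma> = chart p"
  have lp: "local_param \<omega> lam0 mu0 p \<gamma>" using chart[OF p] by (simp add: \<gamma>_def good_param_def)
  note \<gamma> = local_paramD[OF lp]
  let ?F = "\<lambda>t. ker (\<gamma> t) Z Z' (ix i) (ix j) / det_traction (\<gamma> t)" and ?G = "\<lambda>t. kernel Z Z' (\<gamma> t) $ i $ j"
  have ev: "\<forall>\<^sub>F t in at 0. ?G t = ?F t" using kernel_chart[OF p] by (simp add: \<gamma>_def)
  show ?thesis
  proof (cases "det_traction p = 0")
    case False
    have "?G analytic_on {0}" by (rule kernel_analytic[OF lp False])
    then show ?thesis unfolding \<gamma>_def by (rule analytic_on_imp_nicely_meromorphic_on)
  next
    case True
    have mero: "?F meromorphic_on {0}"
      by (intro meromorphic_intros analytic_on_imp_meromorphic_on ker_analytic det_traction_analytic \<gamma>)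
    then have "?G meromorphic_on {0}"
      using meromorphic_on_cong[of "{0}" ?G ?F "{0}"] ev by simp
    moreover have "(is_pole ?G 0 \<and> ?G 0 = 0) \<or> ?G \<midarrow>0\<rightarrow> ?G 0"
    proof -
      have val: "?G 0 = remove_sings ?F 0" using True \<gamma>(1) by (simp add: kernel_def \<gamma>_def)
      have "not_essential ?F 0" using mero by (simp add: meromorphic_at_iff)
      then consider "is_pole ?F 0" | c where "?F \<midarrow>0\<rightarrow> c" unfolding not_essential_def by blast
      then show ?thesis
      proof cases
        case 1
        \<comment> \<open>\<open>remove_sings\<close> returns 0 at a pole, the value that
          \<open>nicely_meromorphic_on\<close> prescribes.\<close>
        then show ?thesis using is_pole_cong[OF ev refl] val by simp
      next
        case 2
        then have "?G 0 = c" unfolding val by (rule remove_sings_eqI)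
        moreover have "?G \<midarrow>0\<rightarrow> c" using 2 tendsto_cong[OF ev] by blast
        ultimately show ?thesis by blast
      qed
    qed
    ultimately show ?thesis by (simp add: nicely_meromorphic_on_def \<gamma>_def)
  qed
qed

text \<open>At a single depth the P and S displacements can be parallel, namely when \<xi>^2 + q_P
  q_S = 0. Since q_P \<noteq> q_S, a second depth changes the ratio of the exponentials and restores
  independence.\<close>

lemma jost_values_independent:
  assumes p: "p \<in> surface \<omega> lam0 mu0"
  obtains Z1 Z2 i1 i2 where "Z1 \<le> - H" "Z2 \<le> - H"
    "jst 1 p (ix i1) Z1 * jst 2 p (ix i2) Z2 - jst 2 p (ix i1) Z1 * jst 1 p (ix i2) Z2 \<noteq> 0"
proof -
  let ?v = "\<lambda>k i. amp k p (ix i)"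
  note q = qv_surface[OF p]
  have W: "(of_real \<omega> :: complex)\<^sup>2 \<noteq> 0" "(of_real mu0 :: complex) \<noteq> 0" "(of_real sigma :: complex) \<noteq> 0"
    using \<omega> mu0_pos sigma_pos by auto
  have "qv 1 p \<noteq> 0 \<or> fst p \<noteq> 0" "qv 2 p \<noteq> 0 \<or> fst p \<noteq> 0" using q W by auto
  then have "?v 1 1 \<noteq> 0 \<or> ?v 1 2 \<noteq> 0" "?v 2 1 \<noteq> 0 \<or> ?v 2 2 \<noteq> 0"
    by (auto simp: amp_def ix_def)
  then obtain i1 i2 where i: "?v 1 i1 \<noteq> 0" "?v 2 i2 \<noteq> 0" by blast
  define \<delta> where "\<delta> = qv 2 p - qv 1 p"
  have "\<delta> \<noteq> 0"
  proof
    assume "\<delta> = 0"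
    then have "(qv 1 p)\<^sup>2 = (qv 2 p)\<^sup>2" by (simp add: \<delta>_def)
    then have "(of_real sigma :: complex) = of_real mu0" using q W by (simp add: field_simps)
    then show False using mu0_less_sigma by (simp del: of_real_eq_iff add: of_real_eq_iff)
  qed
  \<comment> \<open>This makes i s \<delta> a number of modulus 1, too small to be a nonzero
    multiple of 2 pi i.\<close>
  define s where "s = 1 / norm \<delta>"
  have s: "s > 0" using \<open>\<delta> \<noteq> 0\<close> by (simp add: s_def)
  have "exp (\<i> * of_real s * \<delta>) \<noteq> 1"
  proof
    assume e: "exp (\<i> * of_real s * \<delta>) = 1"
    define w where "w = \<i> * of_real s * \<delta>"
    obtain n :: int where n: "Re w = 0" "Im w = of_int (2 * n) * pi"
      using e unfolding w_def[symmetric] exp_eq_1 by blast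
    have "norm w = 1" using \<open>\<delta> \<noteq> 0\<close> by (simp add: w_def norm_mult norm_divide s_def)
    moreover have "norm w = \<bar>Im w\<bar>" using n(1) by (simp add: cmod_def)
    ultimately have "\<bar>of_int (2 * n) * pi\<bar> = 1" using n(2) by simp
    then have *: "2 * \<bar>real_of_int n\<bar> * pi = 1" by (simp add: abs_mult)
    then have "n \<noteq> 0" by auto
    then have "1 \<le> \<bar>real_of_int n\<bar>" by linarith
    then have "2 * 1 * pi \<le> 2 * \<bar>real_of_int n\<bar> * pi" by (intro mult_right_mono) auto
    then show False using * pi_gt3 by simp
  qed
  then have ne: "exp (\<i> * of_real s * qv 2 p) \<noteq> exp (\<i> * of_real s * qv 1 p)"
    by (simp add: \<delta>_def algebra_simps exp_diff)
  define E where "E = exp (\<i> * of_real H * qv 1 p) * exp (\<i> * of_real H * qv 2 p)"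
  have det: "jst 1 p (ix i1) (- H) * jst 2 p (ix i2) (- H - s) - jst 2 p (ix i1) (- H) * jst 1 p (ix i2) (- H - s)
     = E * (?v 1 i1 * ?v 2 i2 * exp (\<i> * of_real s * qv 2 p) - ?v 2 i1 * ?v 1 i2 * exp (\<i> * of_real s * qv 1 p))"
    and det0: "jst 1 p (ix i1) (- H) * jst 2 p (ix i2) (- H) - jst 2 p (ix i1) (- H) * jst 1 p (ix i2) (- H)
     = E * (?v 1 i1 * ?v 2 i2 - ?v 2 i1 * ?v 1 i2)"
    using s by (simp_all add: jst_below[OF p] E_def algebra_simps exp_add exp_diff exp_minus)
  have E: "E \<noteq> 0" by (simp add: E_def)
  show thesis
  proof (cases "?v 1 i1 * ?v 2 i2 = ?v 2 i1 * ?v 1 i2")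
    case False
    then show thesis using that[of "- H" "- H" i1 i2] det0 E by simp
  next
    case True
    then have "?v 1 i1 * ?v 2 i2 * exp (\<i> * of_real s * qv 2 p) - ?v 2 i1 * ?v 1 i2 * exp (\<i> * of_real s * qv 1 p)
       = ?v 1 i1 * ?v 2 i2 * (exp (\<i> * of_real s * qv 2 p) - exp (\<i> * of_real s * qv 1 p))"
      by (simp add: algebra_simps)
    also have "\<dots> \<noteq> 0" using i ne by simp
    finally show thesis using that[of "- H" "- H - s" i1 i2] det E s by simp
  qed
qed

text \<open>Without poles, B can be cancelled from the kernel at one \<open>Z'\<close> near 0 and
  then J at one or two depths below \<open>-H\<close>, each time by Cramer's rule. What remains is a
  limit of -T^{-1} at a point where T is singular.\<close>

lemma kernel_has_pole:
  assumes p: "p \<in> surface \<omega> lam0 mu0" and D: "det_traction p = 0"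
  shows "\<exists>Z<0. \<exists>Z'<0. \<exists>i j. is_pole (\<lambda>t. kernel Z Z' (chart p t) $ i $ j) 0"
proof (rule ccontr)
  assume "\<not> ?thesis"
  then have np: "\<not> is_pole (\<lambda>t. kernel Z Z' (chart p t) $ i $ j) 0" if "Z < 0" "Z' < 0" for Z Z' i j
    using that by blast
  define \<gamma> where "\<gamma> = chart p"
  have lp: "local_param \<omega> lam0 mu0 p \<gamma>" using chart[OF p] by (simp add: \<gamma>_def good_param_def)
  note \<gamma> = local_paramD[OF lp]
  define K where "K k r t = coef (\<gamma> t) k r / det_traction (\<gamma> t)" for k r t
  have lim: "\<exists>c. (\<lambda>t. lower (\<gamma> t) Z Z' (ix i) (ix j) / det_traction (\<gamma> t)) \<midarrow>0\<rightarrow> c"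
    if "Z \<le> Z'" "Z' < 0" for Z Z' i j
  proof -
    have 1: "(\<lambda>t. kernel Z Z' (\<gamma> t) $ i $ j) \<midarrow>0\<rightarrow> kernel Z Z' (\<gamma> 0) $ i $ j"
      using kernel_chart_meromorphic[OF p, of Z Z' i j] np[of Z Z' i j] that
      unfolding nicely_meromorphic_on_def \<gamma>_def by auto
    have ev: "\<forall>\<^sub>F t in at 0. kernel Z Z' (\<gamma> t) $ i $ j = lower (\<gamma> t) Z Z' (ix i) (ix j) / det_traction (\<gamma> t)"
      using kernel_chart[OF p, of Z Z' i j] that by (simp add: \<gamma>_def ker_def)
    show ?thesis using 1 unfolding tendsto_cong[OF ev] by blast
  qed
  have jc: "(\<lambda>t. jst k (\<gamma> t) i Z) \<midarrow>0\<rightarrow> jst k p i Z" for k i Z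
    using analytic_at_imp_isCont[OF jst_analytic[OF \<gamma>(3)]] by (simp add: isCont_def \<gamma>(1))
  have bc: "(\<lambda>t. bst r (fst (\<gamma> t)) i Z) \<midarrow>0\<rightarrow> bst r (fst p) i Z" for r i Z
    using analytic_at_imp_isCont[OF bst_analytic[OF \<gamma>(3)]] by (simp add: isCont_def \<gamma>(1))
  \<comment> \<open>The \<open>bst\<close> displacements are the unit vectors at 0, hence still
    independent just below. With \<open>Z'\<close> above \<open>-H\<close>, every Z \<le> -H lies on
    the Jost side of the diagonal.\<close>
  obtain Z' where Z': "- H < Z'" "Z' < 0"
    "bst 1 (fst p) (ix 1) Z' * bst 2 (fst p) (ix 2) Z' - bst 2 (fst p) (ix 1) Z' * bst 1 (fst p) (ix 2) Z' \<noteq> 0"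
  proof -
    let ?d = "\<lambda>Z. bst 1 (fst p) (ix 1) Z * bst 2 (fst p) (ix 2) Z - bst 2 (fst p) (ix 1) Z * bst 1 (fst p) (ix 2) Z"
    have "isCont ?d 0" by (intro continuous_intros solves_isCont[OF bst_solves])
    then have "(?d \<longlongrightarrow> ?d 0) (at_left 0)" by (simp add: isCont_def filterlim_at_split)
    moreover have "?d 0 \<noteq> 0" by (simp add: bst_def ix_def)
    ultimately have "\<forall>\<^sub>F Z in at_left 0. ?d Z \<noteq> 0" by (rule tendsto_imp_eventually_ne)
    moreover have "\<forall>\<^sub>F Z in at_left 0. - H < Z \<and> Z < 0"
      using H eventually_at_left_real[of "- H" 0] by auto
    ultimately have "\<forall>\<^sub>F Z in at_left 0. - H < Z \<and> Z < 0 \<and> ?d Z \<noteq> 0" by eventually_elim simp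
    then show thesis using that eventually_happens[of _ "at_left (0::real)"] by auto
  qed
  have rows: "\<exists>c. (\<lambda>t. \<Sum>k\<in>UNIV. K k r t * jst k (\<gamma> t) (ix i) Z) \<midarrow>0\<rightarrow> c" if "Z \<le> - H" for Z i r
  proof -
    let ?M = "\<lambda>r t. \<Sum>k\<in>UNIV. K k r t * jst k (\<gamma> t) (ix i) Z"
    have "\<exists>c. (\<lambda>t. bst 1 (fst (\<gamma> t)) (ix j) Z' * ?M 1 t + bst 2 (fst (\<gamma> t)) (ix j) Z' * ?M 2 t) \<midarrow>0\<rightarrow> c" for j
      using lim[of Z Z' i j] that Z' by (simp add: lower_def K_def sum_2 add_divide_distrib algebra_simps)
    from solve_2x2_tendsto[OF bc bc bc bc this[of 1] this[of 2] Z'(3)]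
    show ?thesis using exhaust_2[of r] by auto
  qed
  obtain Z1 Z2 i1 i2 where Z12: "Z1 \<le> - H" "Z2 \<le> - H"
    "jst 1 p (ix i1) Z1 * jst 2 p (ix i2) Z2 - jst 2 p (ix i1) Z1 * jst 1 p (ix i2) Z2 \<noteq> 0"
    by (rule jost_values_independent[OF p])
  have "\<exists>c. K k r \<midarrow>0\<rightarrow> c" for k r
  proof -
    have "\<exists>c. (\<lambda>t. jst 1 (\<gamma> t) (ix i) Z * K 1 r t + jst 2 (\<gamma> t) (ix i) Z * K 2 r t) \<midarrow>0\<rightarrow> c" if "Z \<le> - H" for i Z
      using rows[OF that, of r i] by (simp add: sum_2 algebra_simps)
    from solve_2x2_tendsto[OF jc jc jc jc this[OF Z12(1), of i1] this[OF Z12(2), of i2] Z12(3)]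
    show ?thesis using exhaust_2[of k] by auto
  qed
  then obtain K0 where K0: "\<And>k r. K k r \<midarrow>0\<rightarrow> K0 k r" by metis
  text \<open>$K$ is minus the inverse of the matrix of tractions, so this limit inverts a singular matrix.\<close>
  have id: "K0 k 1 * jst k' p 3 0 + K0 k 2 * jst k' p 4 0 = (if k = k' then - 1 else 0)" for k k'
  proof -
    have "(\<lambda>t. K k 1 t * jst k' (\<gamma> t) 3 0 + K k 2 t * jst k' (\<gamma> t) 4 0)
        \<midarrow>0\<rightarrow> K0 k 1 * jst k' p 3 0 + K0 k 2 * jst k' p 4 0"
      by (intro tendsto_intros K0 jc)
    moreover have "\<forall>\<^sub>F t in at 0. K k 1 t * jst k' (\<gamma> t) 3 0 + K k 2 t * jst k' (\<gamma> t) 4 0 = (if k = k' then - 1 else 0)"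
      using det_traction_not_locally_zero[OF p chart[OF p], folded \<gamma>_def]
    proof eventually_elim
      case (elim t)
      have "coef (\<gamma> t) k 1 * jst k' (\<gamma> t) 3 0 + coef (\<gamma> t) k 2 * jst k' (\<gamma> t) 4 0
          = (if k = k' then - 1 else 0) * det_traction (\<gamma> t)"
        using exhaust_2[of k] exhaust_2[of k'] by (auto simp: coef_def det_traction_def algebra_simps)
      then show ?case using elim unfolding K_def by (simp add: field_simps)
    qed
    ultimately have "(\<lambda>t. if k = k' then - 1 else 0) \<midarrow>(0::complex)\<rightarrow> K0 k 1 * jst k' p 3 0 + K0 k 2 * jst k' p 4 0"
      using tendsto_cong by fast
    from this[unfolded tendsto_const_iff[OF at_neq_bot]] show ?thesis by (rule sym)
  qed
  \<comment> \<open>Determinants of the limiting identity: the right-hand side is minus the 2 by 2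
    identity matrix, of determinant 1.\<close>
  have "(K0 1 1 * K0 2 2 - K0 1 2 * K0 2 1) * det_traction p = 1"
    using id[of 1 1] id[of 1 2] id[of 2 1] id[of 2 2] unfolding det_traction_def by simp algebra
  with D show False by simp
qed

theorem resolvent_continuation:
  "\<exists>G :: real \<Rightarrow> real \<Rightarrow> point \<Rightarrow> complex^2^2.
    (\<forall>p\<in>physical_sheet \<omega> lam0 mu0. rayleigh_det \<omega> H lam mu p \<noteq> 0 \<longrightarrow>
       (\<forall>Z'<0. resolvent_kernel \<omega> lam mu p Z' (\<lambda>Z. G Z Z' p))) \<and>
    (\<forall>Z<0. \<forall>Z'<0. \<forall>i j. surface_meromorphic \<omega> lam0 mu0 (\<lambda>p. G Z Z' p $ i $ j)) \<and>
    (\<forall>p\<in>surface \<omega> lam0 mu0 - branch_points \<omega> lam0 mu0.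
       kernel_pole \<omega> lam0 mu0 G p \<longleftrightarrow> rayleigh_det \<omega> H lam mu p = 0)"
proof (intro exI[of _ kernel] conjI ballI allI impI)
  fix p Z' assume p: "p \<in> physical_sheet \<omega> lam0 mu0" "rayleigh_det \<omega> H lam mu p \<noteq> 0" "(Z'::real) < 0"
  then have "p \<in> surface \<omega> lam0 mu0" by (auto simp: physical_sheet_def)
  then have D: "det_traction p \<noteq> 0" using p(2) rayleigh_det_eq by simp
  then show "resolvent_kernel \<omega> lam mu p Z' (\<lambda>Z. kernel Z Z' p)"
    using kernel_is_resolvent[OF p(1) D p(3)] by (simp add: kernel_def)
next
  fix Z Z' :: real and i j
  show "surface_meromorphic \<omega> lam0 mu0 (\<lambda>p. kernel Z Z' p $ i $ j)"
    unfolding surface_meromorphic_def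
    using chart kernel_chart_meromorphic unfolding good_param_def by blast
next
  fix p assume "p \<in> surface \<omega> lam0 mu0 - branch_points \<omega> lam0 mu0"
  then have p: "p \<in> surface \<omega> lam0 mu0" by blast
  have D: "rayleigh_det \<omega> H lam mu p = 0 \<longleftrightarrow> det_traction p = 0" using rayleigh_det_eq[OF p] by simp
  have lp: "local_param \<omega> lam0 mu0 p (chart p)" using chart[OF p] by (simp add: good_param_def)
  show "kernel_pole \<omega> lam0 mu0 kernel p \<longleftrightarrow> rayleigh_det \<omega> H lam mu p = 0"
    unfolding D
  proof
    show "det_traction p = 0" if "kernel_pole \<omega> lam0 mu0 kernel p"
      using that kernel_analytic analytic_at_imp_no_pole unfolding kernel_pole_def surface_pole_def by blast
    show "kernel_pole \<omega> lam0 mu0 kernel p" if "det_traction p = 0"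
      using kernel_has_pole[OF p that] lp unfolding kernel_pole_def surface_pole_def by blast
  qed
qed

end

theorem mainTheorem5:
  fixes \<omega> H lam0 mu0 alpha0 beta0 :: real and lam mu :: "real \<Rightarrow> real"
  assumes "\<omega> > 0" and "H > 0"
    and "Ck_on 3 lam {..0}" and "Ck_on 3 mu {..0}"
    and "alpha0 > 0" and "\<And>Z. Z \<le> 0 \<Longrightarrow> mu Z \<ge> alpha0"
    and "beta0 > 0" and "\<And>Z. Z \<le> 0 \<Longrightarrow> 2 * mu Z + 3 * lam Z \<ge> beta0"
    and "\<And>Z. Z < - H \<Longrightarrow> lam Z = lam0" and "\<And>Z. Z < - H \<Longrightarrow> mu Z = mu0"
  shows "\<exists>G :: real \<Rightarrow> real \<Rightarrow> point \<Rightarrow> complex^2^2.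
    (\<forall>p\<in>physical_sheet \<omega> lam0 mu0. rayleigh_det \<omega> H lam mu p \<noteq> 0 \<longrightarrow>
       (\<forall>Z'<0. resolvent_kernel \<omega> lam mu p Z' (\<lambda>Z. G Z Z' p))) \<and>
    (\<forall>Z<0. \<forall>Z'<0. \<forall>i j. surface_meromorphic \<omega> lam0 mu0 (\<lambda>p. G Z Z' p $ i $ j)) \<and>
    (\<forall>p\<in>surface \<omega> lam0 mu0 - branch_points \<omega> lam0 mu0.
       kernel_pole \<omega> lam0 mu0 G p \<longleftrightarrow> rayleigh_det \<omega> H lam mu p = 0)"
proof -
  interpret rayleigh \<omega> H lam0 mu0 alpha0 beta0 lam mu
    by unfold_locales (use assms in auto)
  show ?thesis by (rule resolvent_continuation)
qed

end
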